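(* Let $\mathfrak{O}$ be the ring of integers of a quadratic number field. Let $f>0$ be a rational integer and let $\mathfrak{O}_f$ be the unique order of index $f$ in $\mathfrak{O}$. Then the number of cusps of $\mathfrak{O}_f$ is $$\sum_{f'\mid f}\frac{\varphi(f/f')}{2^{\epsilon(f,f')}}\,|\mathrm{Pic}(\mathfrak{O}_{f'})|,$$ where the sum is over the positive divisors $f'$ of $f$, $\varphi$ is the Euler totient function, and $\epsilon(f,f')=1$ if $\mathfrak{O}_{f'}$ has a unit of norm $-1$ and $f/f'>2$, and $\epsilon(f,f')=0$ otherwise.
   Context: For each integer $f'>0$, $\mathfrak{O}_{f'}$ denotes the unique subring of index $f'$ in $\mathfrak{O}$. $\mathrm{Pic}(R)$ is the Picard group of $R$, the group of classes of invertible fractional ideals modulo principal ones. Norms are taken over $\mathbb{Q}$. For a domain $R$ with field of fractions $K(R)$, the set of cusps of $R$ is the orbit set $\mathbb{P}^1(K(R))/\mathrm{SL}_2(R)$, where $\mathrm{SL}_2(R)$ acts on the projective line from the right by $[r:s]\begin{pmatrix} a&b\\c&d\end{pmatrix}=[ar+cs:br+ds]$. *)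

theory Defs
  imports
    "HOL-Analysis.Analysis"
    "HOL-Algebra.Algebra"
    "HOL-Algebra.Algebraic_Closure_Type"
    "HOL-Computational_Algebra.Computational_Algebra"
    "HOL-Number_Theory.Totient"
begin

section \<open>Quadratic number fields and their orders\<close>

text \<open>
  The ambient number field is a type \<open>'a\<close> of class \<open>field_char_0\<close>; it is a quadratic field
  when it has dimension 2 over the rationals, i.e.\ \<open>rat_vs.dim (UNIV :: 'a set) = 2\<close>.
\<close>

interpretation rat_vs: vector_space "\<lambda>(q :: rat) (x :: 'a :: field_char_0). of_rat q * x"
  by standard (simp_all add: algebra_simps of_rat_add of_rat_mult)

abbreviation field_ring :: "'a :: field_char_0 ring" where
  "field_ring \<equiv> ring_of_type_algebra"

definition integer_ring :: "'a :: field_char_0 ring" where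
  "integer_ring = field_ring\<lparr>carrier := {x. algebraic_int x}\<rparr>"

text \<open>
  The subring (containing 1) of index \<open>f\<close> in the ring of integers. In a quadratic field it exists
  and is unique for every \<open>f > 0\<close>. As \<open>card\<close> of an infinite set is 0, the condition forces the
  index to be finite if \<open>f > 0\<close>.
\<close>

definition quadratic_order :: "nat \<Rightarrow> 'a :: field_char_0 set" where
  "quadratic_order f =
     (THE R. subring R integer_ring \<and> card (a_rcosets\<^bsub>integer_ring\<^esub> R) = f)"

text \<open>
  The norm over the rationals for a quadratic field: the determinant of multiplication by \<open>x\<close>,
  computed in any basis.
\<close>

definition quadratic_norm :: "'a :: field_char_0 \<Rightarrow> rat" where
  "quadratic_norm x = (THE q. \<exists>(b :: 2 \<Rightarrow> 'a) (A :: rat^2^2).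
     inj b \<and> rat_vs.independent (range b) \<and> rat_vs.span (range b) = UNIV \<and>
     (\<forall>i. x * b i = (\<Sum>j\<in>UNIV. of_rat (A $ i $ j) * b j)) \<and> q = det A)"

definition has_unit_of_norm_minus_one :: "'a :: field_char_0 set \<Rightarrow> bool" where
  "has_unit_of_norm_minus_one R \<longleftrightarrow>
     (\<exists>u \<in> Units (field_ring\<lparr>carrier := R\<rparr>). quadratic_norm u = -1)"

definition epsilon :: "'a :: field_char_0 itself \<Rightarrow> nat \<Rightarrow> nat \<Rightarrow> nat" where
  "epsilon _ f f' =
     (if has_unit_of_norm_minus_one (quadratic_order f' :: 'a set) \<and> f div f' > 2 then 1 else 0)"


section \<open>Picard groups\<close>

text \<open>
  From here on, a domain is a subring \<open>R\<close> of the field \<open>'a\<close>, and \<open>frac_field R\<close> is its field of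
  fractions inside \<open>'a\<close>.
\<close>

definition frac_field :: "'a :: field_char_0 set \<Rightarrow> 'a set" where
  "frac_field R = {a / b | a b. a \<in> R \<and> b \<in> R \<and> b \<noteq> 0}"

definition fractional_ideal :: "'a :: field_char_0 set \<Rightarrow> 'a set \<Rightarrow> bool" where
  "fractional_ideal R I \<longleftrightarrow>
     I \<subseteq> frac_field R \<and> 0 \<in> I \<and> (\<forall>x\<in>I. \<forall>y\<in>I. x + y \<in> I) \<and> (\<forall>r\<in>R. \<forall>x\<in>I. r * x \<in> I) \<and>
     (\<exists>d\<in>R. d \<noteq> 0 \<and> (\<forall>x\<in>I. d * x \<in> R))"

text \<open>
  \<open>ideal_prod\<close> is the set of finite sums of products; it is used here for subsets of the field.
  The units of this monoid are the invertible fractional ideals.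
\<close>

definition fractional_ideal_monoid :: "'a :: field_char_0 set \<Rightarrow> 'a set monoid" where
  "fractional_ideal_monoid R =
     \<lparr>carrier = {I. fractional_ideal R I}, monoid.mult = ideal_prod field_ring, one = R\<rparr>"

definition principal_fractional_ideals :: "'a :: field_char_0 set \<Rightarrow> 'a set set" where
  "principal_fractional_ideals R = {(\<lambda>a. x * a) ` R | x. x \<in> frac_field R \<and> x \<noteq> 0}"

definition Pic :: "'a :: field_char_0 set \<Rightarrow> 'a set set monoid" where
  "Pic R = units_of (fractional_ideal_monoid R) Mod principal_fractional_ideals R"


section \<open>Cusps\<close>

text \<open>Homogeneous coordinates \<open>[r : s]\<close> are row vectors in \<open>'a^2\<close>.\<close>

definition proj_coords :: "'a :: field_char_0 set \<Rightarrow> ('a^2) set" where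
  "proj_coords K = {v. (\<forall>i. v $ i \<in> K) \<and> v \<noteq> 0}"

definition proj_line :: "'a :: field_char_0 set \<Rightarrow> ('a^2) set set" where
  "proj_line K = proj_coords K //
     {(v, w). v \<in> proj_coords K \<and> w \<in> proj_coords K \<and> (\<exists>c\<in>K. c \<noteq> 0 \<and> w = c *s v)}"

definition SL2 :: "'a :: field_char_0 set \<Rightarrow> ('a^2^2) set" where
  "SL2 R = {A. (\<forall>i j. A $ i $ j \<in> R) \<and> det A = 1}"

definition cusps :: "'a :: field_char_0 set \<Rightarrow> ('a^2) set set set" where
  "cusps R = proj_line (frac_field R) //
     {(p, q). p \<in> proj_line (frac_field R) \<and> q \<in> proj_line (frac_field R) \<and>
              (\<exists>A\<in>SL2 R. q = (\<lambda>v. v v* A) ` p)}"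

end

theory Submission
  imports Defs
begin

text \<open>
  Write \<open>R\<close> for the order of index \<open>f\<close>. A point \<open>[r : s]\<close> generates the lattice \<open>I = R r + R s\<close>, whose
  multiplier ring is the order \<open>S\<close> of some index \<open>k\<close> dividing \<open>f\<close>. Since \<open>I\<close> is invertible over \<open>S\<close>, the
  point determines a class in \<open>Pic(S)\<close>, and this class depends only on the cusp.

  Fix such an \<open>I\<close> with a basis \<open>a, b\<close> and put \<open>g = f / k\<close>, so that \<open>R\<close> consists of the integers plus
  \<open>g S\<close>. A pair \<open>(r, s)\<close> in \<open>I\<close> has an integral determinant \<open>n\<close> with respect to \<open>a, b\<close>. If the pair
  generates \<open>I\<close> over \<open>R\<close>, then \<open>n\<close> is coprime to \<open>g\<close>, every residue coprime to \<open>g\<close> occurs, and two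
  such pairs are equivalent under \<open>SL\<^sub>2(R)\<close> iff their determinants agree modulo \<open>g\<close>. Rescaling by a
  unit \<open>u\<close> of \<open>S\<close> multiplies \<open>n\<close> by the norm of \<open>u\<close>, which is 1 or -1. So the cusps over a class
  of \<open>Pic(S)\<close> correspond to the units modulo \<open>g\<close>, up to sign if \<open>S\<close> has a unit of norm -1.
\<close>

section \<open>Integral bases of quadratic fields\<close>

text \<open>Special to degree two is that a lattice \<open>I\<close> is invertible over its own
  multiplier ring: up to scaling, \<open>I\<close> is spanned by \<open>1\<close> and a root
  \<open>t\<close> of a primitive form \<open>(p, q, r)\<close>, and this form yields both the
  multiplier ring and an explicit inverse. Hence \<open>Pic(S)\<close> is the set of homothety
  classes of lattices with multiplier ring exactly \<open>S\<close>, and the class of a pair can be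
  read off from its lattice.

  The obstacle is that \<open>I\<close> need not be invertible over \<open>R\<close> itself. The
  congruence modulo \<open>g\<close> measures this failure: a matrix over \<open>R\<close> is an
  integer matrix modulo \<open>g S\<close>, so its determinant acts on \<open>n\<close> through an
  integer modulo \<open>g\<close>. Corrections with entries in \<open>g S\<close> remain possible,
  because \<open>g S\<close> lies in \<open>R\<close> and is an ideal of \<open>S\<close>, over
  which \<open>I\<close> is invertible.

  The factor 2 occurs only for \<open>g > 2\<close>, since 1 and -1 agree modulo 1 and modulo 2.
  Finiteness of \<open>Pic\<close> is part of the work: \<open>card\<close> of an infinite set is 0,
  so counting over classes is meaningful only when there are finitely many.\<close>

lemma Rats_of_int_relation:
  fixes z :: "'a :: field_char_0"
  assumes "of_int u + of_int v * z = 0" "z \<notin> \<rat>"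
  shows "u = 0 \<and> v = 0"
proof -
  have v: "v = 0"
  proof (rule ccontr)
    assume "v \<noteq> 0"
    with assms(1) have "z = - of_int u / of_int v"
      by (simp add: field_simps eq_neg_iff_add_eq_0 add.commute)
    then have "z \<in> \<rat>" by simp
    with assms(2) show False by simp
  qed
  with assms(1) show ?thesis by simp
qed

lemma poly_map_of_int:
  fixes z :: "'a :: field_char_0" and p q :: "int poly"
  shows poly_of_int_smult: "poly (map_poly of_int (Polynomial.smult c p)) z = of_int c * poly (map_poly of_int p) z"
    and poly_of_int_add: "poly (map_poly of_int (p + q)) z = poly (map_poly of_int p) z + poly (map_poly of_int q) z"
    and poly_of_int_mult: "poly (map_poly of_int (p * q)) z = poly (map_poly of_int p) z * poly (map_poly of_int q) z"
proof -
  show smult: "poly (map_poly of_int (Polynomial.smult c p)) z = of_int c * poly (map_poly of_int p) z" for c p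
    by (induction p) (auto simp: map_poly_pCons algebra_simps)
  show add: "poly (map_poly of_int (p + q)) z = poly (map_poly of_int p) z + poly (map_poly of_int q) z" for p q
    by (induction p q rule: poly_induct2) (auto simp: map_poly_pCons algebra_simps)
  show "poly (map_poly of_int (p * q)) z = poly (map_poly of_int p) z * poly (map_poly of_int q) z"
    by (induction p) (auto simp: map_poly_pCons smult add algebra_simps)
qed

text \<open>Gauss' lemma: pseudo-division shows that a primitive quadratic with root \<open>z\<close> divides any
  monic integer polynomial with root \<open>z\<close>, first up to a constant and then, comparing contents, exactly.\<close>

lemma algebraic_int_imp_lead_coeff_unit:
  fixes z :: "'a :: field_char_0"
  assumes "algebraic_int z" "z \<notin> \<rat>" "p \<noteq> 0" "gcd p (gcd q r) = 1"
    and rel: "of_int p * z ^ 2 + of_int q * z + of_int r = 0"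
  shows "\<bar>p\<bar> = 1"
proof -
  obtain P :: "int poly" where P: "poly (map_poly of_int P) z = 0" "Polynomial.lead_coeff P = 1"
    using assms(1) algebraic_int_altdef_ipoly by blast
  define G where "G = [:r, q, p:]"
  have G0: "G \<noteq> 0" "Polynomial.degree G = 2" using \<open>p \<noteq> 0\<close> by (auto simp: G_def)
  have Gz: "poly (map_poly of_int G) z = 0"
    using rel by (simp add: G_def map_poly_pCons algebra_simps power2_eq_square)
  obtain c Q where c: "c \<noteq> 0" and eq: "Polynomial.smult c P = G * Q + pseudo_mod P G"
    using pseudo_mod(1)[OF G0(1)] by metis
  define R where "R = pseudo_mod P G"
  have "R = 0"
  proof -
    have "R = 0 \<or> Polynomial.degree R < 2" using pseudo_mod(2)[OF G0(1)] G0(2) R_def by metis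
    then have degR: "Polynomial.degree R \<le> 1" by auto
    have Req: "R = [:poly.coeff R 0, poly.coeff R 1:]"
    proof (rule poly_eqI)
      fix n show "poly.coeff R n = poly.coeff [:poly.coeff R 0, poly.coeff R 1:] n"
        using degR by (cases n; cases "n - 1") (auto simp: Polynomial.coeff_eq_0)
    qed
    have "of_int c * poly (map_poly of_int P) z
        = poly (map_poly of_int G) z * poly (map_poly of_int Q) z + poly (map_poly of_int R) z"
      using eq unfolding R_def by (metis poly_map_of_int)
    then have "poly (map_poly of_int R) z = 0" using P(1) Gz by simp
    then have "of_int (poly.coeff R 0) + of_int (poly.coeff R 1) * z = 0"
      by (subst (asm) Req) (simp add: map_poly_pCons mult.commute)
    then have "poly.coeff R 0 = 0 \<and> poly.coeff R 1 = 0" using Rats_of_int_relation assms(2) by blast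
    then show ?thesis using Req by simp
  qed
  with eq R_def have eq': "Polynomial.smult c P = G * Q" by simp
  have "Polynomial.content P dvd Polynomial.lead_coeff P" by (rule content_dvd_coeff)
  then have cP: "Polynomial.content P = 1" using P(2) by (metis normalize_content is_unit_normalize)
  have cG: "Polynomial.content G = 1"
  proof -
    have "Polynomial.content G dvd p" "Polynomial.content G dvd q" "Polynomial.content G dvd r"
      using content_dvd_coeff[of G 2] content_dvd_coeff[of G 1] content_dvd_coeff[of G 0]
      by (simp_all add: G_def numeral_2_eq_2)
    then have "Polynomial.content G dvd gcd p (gcd q r)" by simp
    then show ?thesis using assms(4) by (metis normalize_content is_unit_normalize)
  qed
  have "Polynomial.content (Polynomial.smult c P) = Polynomial.content (G * Q)" using eq' by simp
  then have cQ: "\<bar>c\<bar> = Polynomial.content Q" by (simp add: content_mult cP cG)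
  define Q' where "Q' = Polynomial.primitive_part Q"
  \<comment> \<open>The constant \<open>c\<close> of the pseudo-division may be negative, so the
    content of \<open>Q\<close> is its absolute value. Cancelling it leaves leading coefficients
    whose product is 1 or -1.\<close>
  have "Q = Polynomial.smult \<bar>c\<bar> Q'" using cQ Q'_def by (metis content_times_primitive_part)
  with eq' have "Polynomial.smult c P = Polynomial.smult \<bar>c\<bar> (G * Q')" by simp
  then have "c * Polynomial.lead_coeff P = \<bar>c\<bar> * (Polynomial.lead_coeff G * Polynomial.lead_coeff Q')"
    by (metis Polynomial.lead_coeff_smult Polynomial.lead_coeff_mult)
  then have "c * 1 = \<bar>c\<bar> * (p * Polynomial.lead_coeff Q')"
    using P(2) \<open>p \<noteq> 0\<close> by (simp add: G_def)
  then have "\<bar>c\<bar> * 1 = \<bar>c\<bar> * \<bar>p * Polynomial.lead_coeff Q'\<bar>" by (metis abs_abs abs_mult abs_one)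
  then have "\<bar>p * Polynomial.lead_coeff Q'\<bar> = 1" using c by simp
  then show ?thesis by (auto simp: abs_mult zmult_eq_1_iff)
qed

text \<open>If \<open>b\<close> is the denominator of \<open>n\<close> in lowest terms, then
  \<open>b ^ 2\<close> divides \<open>s\<close>, so \<open>b\<close> is a unit. This limits the
  denominators of integral elements to 2.\<close>

lemma squarefree_mult_square_int:
  fixes s k :: int and n :: rat
  assumes "squarefree s" "of_int s * n ^ 2 = of_int k"
  shows "n \<in> \<int>"
proof -
  obtain a b where ab: "quotient_of n = (a, b)" by force
  then have b: "b > 0" "coprime a b" "n = of_int a / of_int b"
    using quotient_of_denom_pos quotient_of_coprime quotient_of_div by auto
  have "(of_int (s * a ^ 2) :: rat) = of_int (k * b ^ 2)"
    using assms(2) b by (simp add: field_simps power_divide)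
  then have "s * a ^ 2 = k * b ^ 2" by (simp only: of_int_eq_iff)
  then have "b ^ 2 dvd s * a ^ 2" by simp
  moreover have "coprime (b ^ 2) (a ^ 2)" using b(2) by (simp add: coprime_commute)
  ultimately have "b ^ 2 dvd s" using coprime_dvd_mult_left_iff by blast
  then have "is_unit b" using assms(1) squarefreeD by blast
  then have "b = 1" using b(1) by simp
  then show ?thesis using b(3) by simp
qed

text \<open>Completing the square for an irrational element gives a square root of a rational
  number; removing the square part turns it into a square root of a squarefree integer.\<close>

lemma quadratic_field_sqrt:
  assumes dim: "rat_vs.dim (UNIV :: 'a :: field_char_0 set) = 2"
  obtains t :: "'a :: field_char_0" and s :: int
  where "t * t = of_int s" "squarefree s" "t \<notin> \<rat>" "\<And>z. \<exists>x y. z = of_rat x + of_rat y * t"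
proof -
  obtain B :: "'a set" where B: "rat_vs.independent B" "UNIV \<subseteq> rat_vs.span B" "card B = 2"
    using rat_vs.basis_exists[of "UNIV :: 'a set"] dim by metis
  have finB: "finite B" using B(3) by (metis card.infinite zero_neq_numeral)
  have span1: "rat_vs.span {1 :: 'a} = \<rat>"
  proof -
    have "rat_vs.span {1 :: 'a} = range (\<lambda>k. of_rat k * 1)" by (rule rat_vs.span_singleton)
    then show ?thesis by (simp add: Rats_def)
  qed
  \<comment> \<open>Any irrational \<open>t\<close> completes \<open>1\<close> to a basis, as three
    independent elements would exceed the dimension.\<close>
  have spans: "\<exists>x y. z = of_rat x + of_rat y * t" if t: "t \<notin> \<rat>" for z t :: 'a
  proof -
    have ind: "rat_vs.independent {1 :: 'a}" by simp
    then have ind2: "rat_vs.independent {t, 1}"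
      using t span1 by (subst rat_vs.independent_insert) auto
    have "z \<in> rat_vs.span {t, 1}"
    proof (rule ccontr)
      assume z: "z \<notin> rat_vs.span {t, 1}"
      then have "z \<notin> {t, 1}" using rat_vs.span_base by blast
      then have "rat_vs.independent {z, t, 1}"
        using z ind2 by (subst rat_vs.independent_insert) auto
      then have "card {z, t, 1} \<le> card B"
        using rat_vs.independent_span_bound[OF finB, of "{z, t, 1}"] B(2) by blast
      moreover have "t \<noteq> 1" using t by auto
      ultimately show False using \<open>z \<notin> {t, 1}\<close> B(3) by simp
    qed
    then obtain k where "z - of_rat k * t \<in> rat_vs.span {1}"
      using rat_vs.span_breakdown_eq by blast
    then obtain x where "z - of_rat k * t = of_rat x" using span1 by (auto elim: Rats_cases)
    then show ?thesis by (intro exI[of _ x] exI[of _ k]) (simp add: algebra_simps)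
  qed
  have "\<exists>x :: 'a. x \<notin> \<rat>"
  proof (rule ccontr)
    assume "\<not> ?thesis"
    then have "UNIV \<subseteq> rat_vs.span {1 :: 'a}" using span1 by auto
    then have "rat_vs.dim (UNIV :: 'a set) \<le> card {1 :: 'a}" by (rule rat_vs.dim_le_card) simp
    then show False using dim by simp
  qed
  then obtain x :: 'a where x: "x \<notin> \<rat>" by blast
  obtain p q where pq: "x * x = of_rat p + of_rat q * x" using spans[OF x] by blast
  define t0 where "t0 = x - of_rat (q / 2)"
  have t0: "t0 \<notin> \<rat>"
  proof
    assume "t0 \<in> \<rat>"
    then have "t0 + of_rat (q / 2) \<in> \<rat>" by (intro Rats_add Rats_of_rat)
    then show False using x by (simp add: t0_def)
  qed
  define e where "e = p + q ^ 2 / 4"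
  have "t0 * t0 = x * x - of_rat q * x + of_rat (q ^ 2 / 4)"
    by (simp add: t0_def algebra_simps of_rat_divide of_rat_power power2_eq_square)
  then have t0e: "t0 * t0 = of_rat e" by (simp add: pq e_def of_rat_add)
  obtain a b where ab: "quotient_of e = (a, b)" by force
  then have b: "b > 0" "e = of_int a / of_int b"
    using quotient_of_denom_pos quotient_of_div by auto
  define u where "u = square_part (a * b)"
  define s where "s = squarefree_part (a * b)"
  have dec: "a * b = s * u ^ 2" unfolding s_def u_def by (rule squarefree_decompose)
  have "e \<noteq> 0" using t0e t0 by auto
  then have "a * b \<noteq> 0" using b by auto
  then have u: "u \<noteq> 0" using dec by auto
  \<comment> \<open>The square of \<open>t0\<close> is \<open>a / b\<close>, so the factor
    \<open>b / u\<close> changes it to \<open>a * b / u ^ 2\<close>, which is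
    \<open>s\<close>.\<close>
  define t where "t = t0 * of_rat (of_int b / of_int u)"
  have "t * t = of_rat e * of_rat ((of_int b / of_int u) ^ 2)"
    by (simp only: t_def power2_eq_square of_rat_mult flip: t0e) (simp add: mult_ac)
  also have "\<dots> = of_rat (of_int (a * b) / of_int (u ^ 2))"
    using b(1) by (simp add: b(2) power2_eq_square flip: of_rat_mult)
  also have "\<dots> = of_rat (of_int s)"
    using u by (simp add: dec)
  finally have tt: "t * t = of_int s" by simp
  have tr: "t \<notin> \<rat>"
  proof
    assume "t \<in> \<rat>"
    then have "t / of_rat (of_int b / of_int u) \<in> \<rat>" by (intro Rats_divide Rats_of_rat)
    then show False using t0 b(1) u by (simp add: t_def of_rat_divide)
  qed
  show thesis
    by (rule that[OF tt _ tr spans[OF tr]]) (simp add: s_def squarefree_squarefree_part)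
qed

text \<open>The triple is \<open>(1, u, v)\<close> with denominators cleared and the common factor
  removed. It supplies the primitive quadratic equation of an irrational element, both for testing
  integrality and for lattices.\<close>

lemma primitive_triple_rat:
  fixes u v :: rat
  obtains p q r :: int where "p \<noteq> 0" "gcd p (gcd q r) = 1"
    "of_int q = of_int p * u" "of_int r = of_int p * v"
proof -
  obtain a b where ab: "quotient_of u = (a, b)" by force
  then have b: "b > 0" "u = of_int a / of_int b"
    using quotient_of_denom_pos quotient_of_div by auto
  obtain c d where cd: "quotient_of v = (c, d)" by force
  then have d: "d > 0" "v = of_int c / of_int d"
    using quotient_of_denom_pos quotient_of_div by auto
  define g where "g = gcd (b * d) (gcd (a * d) (c * b))"
  have "b * d \<noteq> 0" using b d by simp
  then have g0: "g > 0" unfolding g_def by (metis gcd_pos_int)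
  obtain p q r where pqr: "b * d = g * p" "a * d = g * q" "c * b = g * r"
    using g_def by (metis dvdE gcd_dvd1 gcd_dvd2 dvd_trans)
  have "g = gcd (g * p) (gcd (g * q) (g * r))" using g_def pqr by simp
  also have "\<dots> = g * gcd p (gcd q r)"
    using g0 by (simp add: gcd_mult_left)
  finally have 1: "gcd p (gcd q r) = 1" using g0 by simp
  have p0: "p \<noteq> 0" using pqr(1) b d by auto
  have gp: "of_int g * of_int p = (of_int b * of_int d :: rat)"
    "of_int g * of_int q = (of_int a * of_int d :: rat)"
    "of_int g * of_int r = (of_int c * of_int b :: rat)"
    unfolding of_int_mult[symmetric] pqr by simp_all
  have "of_int g * of_int q = of_int g * of_int p * u"
    unfolding gp using b by simp
  then have 2: "of_int q = of_int p * u" using g0 by simp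
  have "of_int g * of_int r = of_int g * of_int p * v"
    unfolding gp using d by simp
  then have 3: "of_int r = of_int p * v" using g0 by simp
  show thesis by (rule that[OF p0 1 2 3])
qed

lemma quadratic_algebraic_int:
  fixes z :: "'a :: field_char_0"
  assumes "z * z = of_int a * z + of_int b"
  shows "algebraic_int z"
proof -
  have "poly (map_poly of_int [:-b, -a, 1:]) z = 0"
    using assms by (simp add: map_poly_pCons algebra_simps)
  then show ?thesis unfolding algebraic_int_altdef_ipoly by (intro exI[of _ "[:-b, -a, 1:]"]) auto
qed

text \<open>An irrational \<open>x + y t\<close> is a root of
  \<open>X^2 - 2 x X + (x^2 - s y^2)\<close>. Made primitive, this polynomial must have leading
  coefficient 1 or -1, so its coefficients were integral. For \<open>y = 0\<close> the element is
  rational and is treated separately.\<close>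

lemma algebraic_int_imp_trace_norm_int:
  fixes t :: "'a :: field_char_0"
  assumes "t * t = of_int s" "t \<notin> \<rat>" "algebraic_int (of_rat x + of_rat y * t)"
  shows "2 * x \<in> \<int> \<and> x ^ 2 - of_int s * y ^ 2 \<in> \<int>"
proof (cases "y = 0")
  case True
  then have "algebraic_int (of_rat x :: 'a)" using assms(3) by simp
  then have "(of_rat x :: 'a) \<in> \<int>" by (rule rational_algebraic_int_is_int) simp
  then obtain k where "(of_rat x :: 'a) = of_int k" by (auto elim: Ints_cases)
  then have "x = of_int k" by (metis of_rat_eq_iff of_rat_of_int_eq)
  then show ?thesis using True by simp
next
  case False
  define z where "z = of_rat x + of_rat y * t"
  have "z \<notin> \<rat>"
  proof
    assume "z \<in> \<rat>"
    then have "(z - of_rat x) / of_rat y \<in> \<rat>" by (intro Rats_divide Rats_diff Rats_of_rat)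
    then show False using False assms(2) by (simp add: z_def)
  qed
  obtain p q r where pqr: "p \<noteq> 0" "gcd p (gcd q r) = 1" "of_int q = of_int p * (- 2 * x)"
      "of_int r = of_int p * (x ^ 2 - of_int s * y ^ 2)"
    using primitive_triple_rat by blast
  have "(of_int q :: 'a) = of_rat (of_int q)" "(of_int r :: 'a) = of_rat (of_int r)" by simp_all
  then have qr: "(of_int q :: 'a) = of_int p * (- 2 * of_rat x)"
    "(of_int r :: 'a) = of_int p * (of_rat x ^ 2 - of_int s * of_rat y ^ 2)"
    unfolding pqr by (simp_all add: of_rat_mult of_rat_diff of_rat_power of_rat_minus)
  have "z ^ 2 - 2 * of_rat x * z + (of_rat x ^ 2 - of_int s * of_rat y ^ 2)
      = of_rat y ^ 2 * (t * t - of_int s)"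
    unfolding z_def by (simp add: power2_eq_square algebra_simps)
  then have "z ^ 2 - 2 * of_rat x * z + (of_rat x ^ 2 - of_int s * of_rat y ^ 2) = 0"
    using assms(1) by simp
  then have "of_int p * (z ^ 2 - 2 * of_rat x * z + (of_rat x ^ 2 - of_int s * of_rat y ^ 2)) = 0"
    by simp
  then have "of_int p * z ^ 2 + of_int q * z + of_int r = 0"
    unfolding qr by (simp add: algebra_simps)
  then have "\<bar>p\<bar> = 1"
    using algebraic_int_imp_lead_coeff_unit[OF _ \<open>z \<notin> \<rat>\<close> pqr(1,2)] assms(3) z_def by blast
  then have "p = 1 \<or> p = -1" by auto
  then have "2 * x = of_int (-q) \<and> x ^ 2 - of_int s * y ^ 2 = of_int r
      \<or> 2 * x = of_int q \<and> x ^ 2 - of_int s * y ^ 2 = of_int (-r)"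
    using pqr(3,4) by auto
  then show ?thesis by (metis Ints_of_int)
qed

text \<open>Integrality of trace and norm leaves halves of integers as coordinates with respect to
  \<open>t\<close>. Which halves occur depends on \<open>s\<close> modulo 4, and \<open>w\<close> is
  \<open>t\<close> or \<open>(1 + t) / 2\<close> accordingly.\<close>

lemma quadratic_field_integral_basis:
  assumes dim: "rat_vs.dim (UNIV :: 'a :: field_char_0 set) = 2"
  obtains w :: "'a :: field_char_0" and A B :: int
  where "w * w = of_int A * w + of_int B" "w \<notin> \<rat>" "\<And>z. \<exists>x y. z = of_rat x + of_rat y * w"
    "\<And>z. algebraic_int z \<longleftrightarrow> (\<exists>m n. z = of_int m + of_int n * w)"
proof -
  obtain t :: 'a and s where t: "t * t = of_int s" "squarefree s" "t \<notin> \<rat>"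
    and sp: "\<And>z. \<exists>x y. z = of_rat x + of_rat y * t"
    using quadratic_field_sqrt[OF dim] by blast
  have half: "\<exists>m n :: int. 4 dvd m ^ 2 - s * n ^ 2 \<and> x = of_int m / 2 \<and> y = of_int n / 2"
    if "algebraic_int (of_rat x + of_rat y * t)" for x y
  proof -
    from algebraic_int_imp_trace_norm_int[OF t(1,3) that]
    obtain m k where m: "2 * x = of_int m" and k: "x ^ 2 - of_int s * y ^ 2 = of_int k"
      by (auto elim!: Ints_cases)
    have x: "x = of_int m / 2" using m by simp
    have eq: "of_int s * (2 * y) ^ 2 = of_int (m ^ 2 - 4 * k)"
      using k by (simp add: x field_simps power2_eq_square)
    then have "2 * y \<in> \<int>" using squarefree_mult_square_int[OF t(2)] by blast
    then obtain n where n: "2 * y = of_int n" by (auto elim: Ints_cases)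
    have "(of_int (s * n ^ 2) :: rat) = of_int (m ^ 2 - 4 * k)" using eq n by simp
    then have "s * n ^ 2 = m ^ 2 - 4 * k" by (simp only: of_int_eq_iff)
    then have "m ^ 2 - s * n ^ 2 = 4 * k" by simp
    then show ?thesis using x n by (intro exI[of _ m] exI[of _ n]) auto
  qed
  have alg: "algebraic_int (of_int m + of_int n * w)" if "w * w = of_int A * w + of_int B"
    for m n A B and w :: 'a
  proof (rule quadratic_algebraic_int)
    define z where "z = of_int m + of_int n * w"
    have "z * z - (of_int (2 * m + n * A) * z + of_int (n^2 * B - m^2 - m * n * A))
       = of_int n ^ 2 * (w * w - (of_int A * w + of_int B))"
      by (simp add: z_def algebra_simps power2_eq_square)
    then show "z * z = of_int (2 * m + n * A) * z + of_int (n^2 * B - m^2 - m * n * A)"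
      using that by simp
  qed
  show thesis
  proof (cases "s mod 4 = 1")
    case False
    have "\<exists>m n. z = of_int m + of_int n * t" if "algebraic_int z" for z
    proof -
      obtain x y where z: "z = of_rat x + of_rat y * t" using sp by blast
      then obtain m n where mn: "4 dvd m ^ 2 - s * n ^ 2" "x = of_int m / 2" "y = of_int n / 2"
        using half \<open>algebraic_int z\<close> by blast
      \<comment> \<open>A squarefree \<open>s\<close> is not 0 modulo 4, so 2 and 3 remain; for
        these \<open>m ^ 2 = s * n ^ 2\<close> modulo 4 is impossible with an odd \<open>m\<close>
        or \<open>n\<close>.\<close>
      have "\<not> 4 dvd s"
        using squarefreeD[OF t(2), of 2] by auto
      have s4: "s mod 4 = 2 \<or> s mod 4 = 3" 
        using False \<open>\<not> 4 dvd s\<close> by presburger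
      have "even m \<and> even n"
      proof -
        have sq: "k ^ 2 mod 4 = (if even k then 0 else 1)" for k :: int
        proof (cases "even k")
          case True then show ?thesis by (auto elim!: evenE simp: power2_eq_square)
        next
          case odd: False
          then obtain j where "k = 2 * j + 1" by (auto elim: oddE)
          then have "k ^ 2 = 1 + 4 * (j ^ 2 + j)" by (simp add: power2_eq_square algebra_simps)
          then show ?thesis using odd by presburger
        qed
        have "m ^ 2 mod 4 = (s * n ^ 2) mod 4" using mn(1) by (simp add: mod_eq_dvd_iff)
        also have "\<dots> = ((s mod 4) * (n ^ 2 mod 4)) mod 4" by (simp add: mod_mult_eq)
        finally show ?thesis using s4 sq[of m] sq[of n] by (auto split: if_splits)
      qed
      then obtain m' n' where "m = 2 * m'" "n = 2 * n'" by (auto elim!: evenE)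
      then show ?thesis using z mn(2,3) by (intro exI[of _ m'] exI[of _ n']) simp
    qed
    moreover have tt: "t * t = of_int 0 * t + of_int s" using t(1) by simp
    ultimately show ?thesis using that[OF tt t(3) sp] alg[OF tt] by blast
  next
    case True
    define w where "w = (1 + t) / 2"
    define k where "k = s div 4"
    have s: "s = 4 * k + 1" using True k_def by presburger
    have "w * w = (1 + 2 * t + t * t) / 4" by (simp add: w_def field_simps)
    also have "\<dots> = of_int 1 * w + of_int k" using t(1) by (simp add: w_def s field_simps)
    finally have ww: "w * w = of_int 1 * w + of_int k" .
    have tw: "t = 2 * w - 1" by (simp add: w_def add_divide_distrib)
    have wr: "w \<notin> \<rat>" using t(3) unfolding tw
      by (metis Rats_1 Rats_diff Rats_mult Rats_number_of)
    have spw: "\<exists>x y. z = of_rat x + of_rat y * w" for z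
    proof -
      obtain x y where "z = of_rat x + of_rat y * t" using sp by blast
      then have "z = of_rat (x - y) + of_rat (2 * y) * w"
        by (simp add: tw of_rat_diff of_rat_mult algebra_simps)
      then show ?thesis by blast
    qed
    have "\<exists>m n. z = of_int m + of_int n * w" if "algebraic_int z" for z
    proof -
      obtain x y where z: "z = of_rat x + of_rat y * t" using sp by blast
      then obtain m n where mn: "4 dvd m ^ 2 - s * n ^ 2" "x = of_int m / 2" "y = of_int n / 2"
        using half \<open>algebraic_int z\<close> by blast
      have "m ^ 2 - s * n ^ 2 = (m ^ 2 - n ^ 2) - 4 * (k * n ^ 2)" by (simp add: s algebra_simps)
      then have "4 dvd m ^ 2 - n ^ 2" using mn(1)
        by (metis dvd_triv_left dvd_diff_commute dvd_add_right_iff diff_add_cancel dvd_add_left_iff)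
      then have "even (m ^ 2 - n ^ 2)" by presburger
      \<comment> \<open>Here only the parity of \<open>m - n\<close> is forced, which is what the
        basis element \<open>(1 + t) / 2\<close> accounts for.\<close>
      then have "even (m - n)" by simp
      then obtain j where "m = n + 2 * j" by (metis dvdE add.commute diff_add_cancel)
      then have "x = of_int j + of_int n / 2" using mn(2) by (simp add: add_divide_distrib)
      then have xy: "of_rat x = of_int j + of_int n / (2 :: 'a)" "of_rat y = of_int n / (2 :: 'a)"
        by (simp_all only: mn(3) of_rat_add of_rat_divide of_rat_of_int_eq of_rat_numeral_eq)
      have "z = of_int j + of_int n * w" unfolding z tw xy by (simp add: algebra_simps)
      then show ?thesis by blast
    qed
    then show ?thesis using that[OF ww wr spw] alg[OF ww] by blast
  qed
qed

section \<open>Coordinates, norms and orders\<close>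

text \<open>Division with remainder by the least positive element. The zero subgroup is covered by
  \<open>k = 0\<close>.\<close>

lemma int_subgroup_principal:
  fixes H :: "int set"
  assumes "0 \<in> H" "\<And>x y. x \<in> H \<Longrightarrow> y \<in> H \<Longrightarrow> x - y \<in> H"
  obtains k :: nat where "H = {n. int k dvd n}"
proof -
  have neg: "- x \<in> H" if "x \<in> H" for x using assms(2)[OF assms(1) that] by simp
  have add: "x + y \<in> H" if "x \<in> H" "y \<in> H" for x y using assms(2)[OF that(1) neg[OF that(2)]] by simp
  have mult: "int j * x \<in> H" if "x \<in> H" for x j
    by (induction j) (auto simp: assms(1) add that algebra_simps)
  have imult: "j * x \<in> H" if "x \<in> H" for x j
    using mult[OF that, of "nat \<bar>j\<bar>"] neg[OF mult[OF that, of "nat \<bar>j\<bar>"]] by (cases "j \<ge> 0") auto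
  show thesis
  proof (cases "H = {0}")
    case True
    then show ?thesis using that[of 0] by auto
  next
    case False
    then obtain x where x: "x \<in> H" "x \<noteq> 0" using assms(1) by auto
    have ex: "\<exists>n. n > 0 \<and> int n \<in> H"
      using x neg[OF x(1)] by (intro exI[of _ "nat \<bar>x\<bar>"]) (auto simp: abs_if)
    define k where "k = (LEAST n. n > 0 \<and> int n \<in> H)"
    have k: "k > 0" "int k \<in> H" using LeastI_ex[OF ex] unfolding k_def by auto
    have min: "k \<le> n" if "n > 0" "int n \<in> H" for n
      unfolding k_def using that by (intro Least_le) auto
    have "int k dvd n" if n: "n \<in> H" for n
    proof (rule ccontr)
      assume nd: "\<not> int k dvd n"
      have "n mod int k = n - (n div int k) * int k" by (simp add: minus_div_mult_eq_mod)
      then have m: "n mod int k \<in> H" using assms(2)[OF n imult[OF k(2)]] by simp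
      have "n mod int k \<noteq> 0" using nd by (simp add: dvd_eq_mod_eq_0)
      then have "n mod int k > 0" using k(1) by (simp add: order_le_neq_trans)
      then have "k \<le> nat (n mod int k)" using min m by simp
      moreover have "n mod int k < int k" using k(1) by simp
      ultimately show False using k(1) by linarith
    qed
    moreover have "n \<in> H" if "int k dvd n" for n
      using imult[OF k(2)] that by (auto elim!: dvdE simp: mult.commute)
    ultimately show ?thesis using that[of k] by blast
  qed
qed

text \<open>When \<open>a\<close> itself lies in \<open>H\<close>, the resulting \<open>k\<close>
  divides 1; applied this way, the lemma shows that a subgroup contains all integer multiples of its
  elements.\<close>

lemma multiples_in_subgroup:
  fixes H :: "'a :: field_char_0 set" and a :: 'a
  assumes "0 \<in> H" "\<And>x y. x \<in> H \<Longrightarrow> y \<in> H \<Longrightarrow> x - y \<in> H"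
  obtains k :: nat where "\<And>n :: int. of_int n * a \<in> H \<longleftrightarrow> int k dvd n"
proof -
  have "of_int (m - n) * a \<in> H" if "of_int m * a \<in> H" "of_int n * a \<in> H" for m n :: int
    using assms(2)[OF that] by (simp add: algebra_simps)
  then obtain k :: nat where "{n. of_int n * a \<in> H} = {n. int k dvd n}"
    using int_subgroup_principal[of "{n :: int. of_int n * a \<in> H}"] assms(1)
    by (metis (mono_tags, lifting) mem_Collect_eq mult_zero_left of_int_0)
  then show thesis using that by blast
qed

definition zlat :: "'a :: field_char_0 \<Rightarrow> 'a \<Rightarrow> 'a set" where
  "zlat a b = {of_int m * a + of_int n * b | m n. True}"

lemma subring_integer_ring_iff:
  "subring R (integer_ring :: 'a :: field_char_0 ring) \<longleftrightarrow>
     R \<subseteq> {x. algebraic_int x} \<and> 0 \<in> R \<and> 1 \<in> R \<and> (\<forall>x\<in>R. \<forall>y\<in>R. x + y \<in> R) \<and>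
     (\<forall>x\<in>R. - x \<in> R) \<and> (\<forall>x\<in>R. \<forall>y\<in>R. x * y \<in> R)"
proof -
  have inv: "inv\<^bsub>add_monoid (integer_ring :: 'a ring)\<^esub> x = - x" if "algebraic_int x" for x :: 'a
    unfolding m_inv_def using that
    by (intro the_equality) (auto simp: integer_ring_def ring_of_type_algebra_def dest: minus_unique)
  have *: "subgroup R (add_monoid integer_ring) \<longleftrightarrow> R \<subseteq> {x. algebraic_int x} \<and> 0 \<in> R \<and>
     (\<forall>x\<in>R. \<forall>y\<in>R. x + y \<in> R) \<and> (\<forall>x\<in>R. - x \<in> R)"
  proof (cases "R \<subseteq> {x. algebraic_int x}")
    case True
    have "(\<forall>x. x \<in> R \<longrightarrow> inv\<^bsub>add_monoid integer_ring\<^esub> x \<in> R) \<longleftrightarrow> (\<forall>x\<in>R. - x \<in> R)"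
      using inv True by (metis mem_Collect_eq subsetD)
    then show ?thesis unfolding subgroup_def
      using True by (auto simp: integer_ring_def ring_of_type_algebra_def)
  next
    case False
    then show ?thesis unfolding subgroup_def by (auto simp: integer_ring_def ring_of_type_algebra_def)
  qed
  show ?thesis unfolding subring_def * submonoid_def
    by (auto simp: integer_ring_def ring_of_type_algebra_def)
qed

text \<open>All later arithmetic takes place in the integral basis \<open>1, w\<close>. Here
  \<open>A\<close> is the trace of \<open>w\<close>, \<open>- B\<close> its norm, and
  \<open>A ^ 2 + 4 * B\<close> the discriminant of the field.\<close>

locale quadratic_basis =
  fixes w :: "'a :: field_char_0" and A B :: int
  assumes w_square: "w * w = of_int A * w + of_int B"
    and w_irrational: "w \<notin> \<rat>"
    and spans: "\<exists>x y. z = of_rat x + of_rat y * w"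
    and algebraic_int_iff: "algebraic_int z \<longleftrightarrow> (\<exists>m n. z = of_int m + of_int n * w)"
begin

text \<open>These are rational coordinates with respect to \<open>1, w\<close>, not real and
  imaginary parts.\<close>

definition re :: "'a \<Rightarrow> rat" where "re z = fst (SOME p. z = of_rat (fst p) + of_rat (snd p) * w)"
definition im :: "'a \<Rightarrow> rat" where "im z = snd (SOME p. z = of_rat (fst p) + of_rat (snd p) * w)"

lemma coords: "z = of_rat (re z) + of_rat (im z) * w"
proof -
  have "\<exists>p. z = of_rat (fst p) + of_rat (snd p) * w" using spans by simp
  from someI_ex[OF this] show ?thesis unfolding re_def im_def .
qed

lemma coords_unique:
  assumes "of_rat x + of_rat y * w = of_rat x' + of_rat y' * w"
  shows "x = x' \<and> y = y'"
proof -
  have "y = y'"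
  proof (rule ccontr)
    assume "y \<noteq> y'"
    then have n: "(of_rat (y - y') :: 'a) \<noteq> 0" by simp
    have "of_rat (y - y') * w = of_rat (x' - x)"
      using assms by (simp add: of_rat_diff algebra_simps)
    then have "w = of_rat (x' - x) / of_rat (y - y')" using n by (metis nonzero_mult_div_cancel_left)
    then show False using w_irrational by simp
  qed
  then show ?thesis using assms by simp
qed

lemma coords_eqI: "z = of_rat x + of_rat y * w \<Longrightarrow> re z = x \<and> im z = y"
  using coords[of z] coords_unique by metis

lemma coords_simps [simp]:
  "re (x + y) = re x + re y" "im (x + y) = im x + im y"
  "re (x - y) = re x - re y" "im (x - y) = im x - im y"
  "re (- x) = - re x" "im (- x) = - im x"
  "re 0 = 0" "im 0 = 0" "re 1 = 1" "im 1 = 0" "re w = 0" "im w = 1"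
  "re (of_rat q) = q" "im (of_rat q) = 0" "re (of_int i) = of_int i" "im (of_int i) = 0"
  "re (of_nat n) = of_nat n" "im (of_nat n) = 0"
  "re (x * y) = re x * re y + of_int B * im x * im y"
  "im (x * y) = re x * im y + im x * re y + of_int A * im x * im y"
proof -
  have "x + y = (of_rat (re x) + of_rat (im x) * w) + (of_rat (re y) + of_rat (im y) * w)"
    by (simp only: coords[symmetric])
  also have "\<dots> = of_rat (re x + re y) + of_rat (im x + im y) * w"
    by (simp add: of_rat_add algebra_simps)
  finally show "re (x + y) = re x + re y" "im (x + y) = im x + im y"
    using coords_eqI by blast+
  have "x - y = (of_rat (re x) + of_rat (im x) * w) - (of_rat (re y) + of_rat (im y) * w)"
    by (simp only: coords[symmetric])
  also have "\<dots> = of_rat (re x - re y) + of_rat (im x - im y) * w"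
    by (simp add: of_rat_diff algebra_simps)
  finally show "re (x - y) = re x - re y" "im (x - y) = im x - im y"
    using coords_eqI by blast+
  have "- x = - (of_rat (re x) + of_rat (im x) * w)" by (simp only: coords[symmetric])
  also have "\<dots> = of_rat (- re x) + of_rat (- im x) * w" by (simp add: of_rat_minus)
  finally show "re (- x) = - re x" "im (- x) = - im x" using coords_eqI by blast+
  show "re 0 = 0" "im 0 = 0" "re 1 = 1" "im 1 = 0" "re w = 0" "im w = 1"
    using coords_eqI[of 0 0 0] coords_eqI[of 1 1 0] coords_eqI[of w 0 1] by auto
  show "re (of_rat q) = q" "im (of_rat q) = 0" "re (of_int i) = of_int i" "im (of_int i) = 0"
    "re (of_nat n) = of_nat n" "im (of_nat n) = 0"
    using coords_eqI[of "of_rat q" q 0] coords_eqI[of "of_int i" "of_int i" 0]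
      coords_eqI[of "of_nat n" "of_nat n" 0] by auto
  have "x * y = (of_rat (re x) + of_rat (im x) * w) * (of_rat (re y) + of_rat (im y) * w)"
    by (simp only: coords[symmetric])
  also have "\<dots> = of_rat (re x) * of_rat (re y) + of_rat (im x) * of_rat (im y) * (w * w)
      + (of_rat (re x) * of_rat (im y) + of_rat (im x) * of_rat (re y)) * w"
    by (simp add: algebra_simps)
  also have "\<dots> = of_rat (re x * re y + of_int B * im x * im y)
      + of_rat (re x * im y + im x * re y + of_int A * im x * im y) * w"
    unfolding w_square by (simp add: of_rat_add of_rat_mult algebra_simps)
  finally show "re (x * y) = re x * re y + of_int B * im x * im y"
    "im (x * y) = re x * im y + im x * re y + of_int A * im x * im y"
    using coords_eqI by blast+
qed

lemma eq_iff: "x = y \<longleftrightarrow> re x = re y \<and> im x = im y"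
  using coords[of x] coords[of y] by metis

text \<open>The determinant in the basis \<open>1, w\<close>. Its quotient by
  \<open>det2 a b\<close> is the determinant with respect to \<open>a, b\<close>, the invariant
  \<open>n\<close> of a generating pair.\<close>

definition det2 :: "'a \<Rightarrow> 'a \<Rightarrow> rat" where "det2 x y = re x * im y - im x * re y"

definition nrm :: "'a \<Rightarrow> rat" where "nrm x = re x * (re x + of_int A * im x) - of_int B * im x ^ 2"

text \<open>The Galois conjugate, which sends \<open>w\<close> to \<open>A - w\<close>.\<close>

definition conj :: "'a \<Rightarrow> 'a" where "conj x = of_rat (re x + of_int A * im x) - of_rat (im x) * w"

lemma mult_conj: "x * conj x = of_rat (nrm x)"
  unfolding eq_iff by (simp add: conj_def nrm_def algebra_simps power2_eq_square)

lemma nrm_eq_0_iff [simp]: "nrm x = 0 \<longleftrightarrow> x = 0"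
proof
  assume "nrm x = 0"
  then have "x * conj x = 0" by (simp add: mult_conj)
  then have "x = 0 \<or> conj x = 0" by simp
  then show "x = 0" by (auto simp: conj_def eq_iff)
qed (simp add: nrm_def)

text \<open>Multiplication by \<open>l\<close> is a linear map of determinant \<open>nrm l\<close>.
  Through this identity a unit of norm -1 reverses the sign of the invariant of a pair.\<close>

lemma det2_mult: "det2 (l * x) (l * y) = nrm l * det2 x y"
  by (simp add: det2_def nrm_def algebra_simps power2_eq_square)

lemma cramer: "of_rat (det2 a b) * x = of_rat (det2 x b) * a + of_rat (det2 a x) * b"
  unfolding eq_iff by (simp add: det2_def algebra_simps)

lemma det2_comb:
  "det2 (of_rat p * a + of_rat q * b) (of_rat r * a + of_rat s * b) = (p * s - q * r) * det2 a b"
  by (simp add: det2_def algebra_simps)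

lemma det2_comb_int:
  "det2 (of_int p * a + of_int q * b) (of_int r * a + of_int s * b) = of_int (p * s - q * r) * det2 a b"
  using det2_comb[of "of_int p" a "of_int q" b "of_int r" "of_int s"] by simp

text \<open>The basis \<open>1, w\<close> provides one admissible matrix. For any basis, scaling
  \<open>b 1, b 2\<close> by \<open>x\<close> multiplies their \<open>det2\<close> both by
  \<open>det M\<close> and by \<open>nrm x\<close>; as this \<open>det2\<close> is nonzero by
  independence, the value is unique.\<close>

lemma quadratic_norm_eq: "quadratic_norm x = nrm x"
  unfolding quadratic_norm_def
proof (rule the_equality)
  have U: "(UNIV :: 2 set) = {1, 2}" by (rule UNIV_2)
  define b :: "2 \<Rightarrow> 'a" where "b i = (if i = 1 then 1 else w)" for i
  define M :: "rat^2^2" where "M = (\<chi> i j. if i = 1 then (if j = 1 then re x else im x)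
      else (if j = 1 then of_int B * im x else re x + of_int A * im x))"
  have 1: "w \<noteq> 1" using w_irrational by auto
  have r: "range b = {w, 1}" by (auto simp: b_def U)
  have "rat_vs.independent {1 :: 'a}" by simp
  moreover have "w \<notin> rat_vs.span {1}" using w_irrational rat_vs.span_singleton[of "1 :: 'a"] by (auto simp: Rats_def)
  ultimately have ind: "rat_vs.independent (range b)"
    unfolding r using 1 by (subst rat_vs.independent_insert) auto
  have "z \<in> rat_vs.span {w, 1}" for z
  proof -
    have "z - of_rat (im z) * w = of_rat (re z)" by (rule iffD2[OF diff_eq_eq, OF coords])
    also have "of_rat (re z) = of_rat (re z) * 1" by simp
    also have "\<dots> \<in> rat_vs.span {1}" by (intro rat_vs.span_scale rat_vs.span_base) simp
    finally show ?thesis unfolding rat_vs.span_breakdown_eq by blast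
  qed
  then have sp: "rat_vs.span (range b) = UNIV" unfolding r by auto
  have inj: "inj b" by (rule injI) (metis (full_types) 1 b_def exhaust_2)
  have "x * b i = (\<Sum>j\<in>UNIV. of_rat (M $ i $ j) * b j)" for i
    unfolding U by (simp add: M_def b_def eq_iff algebra_simps)
  moreover have "nrm x = det M" by (simp add: det_2 M_def nrm_def algebra_simps power2_eq_square)
  ultimately show "\<exists>(b :: 2 \<Rightarrow> 'a) A. inj b \<and> rat_vs.independent (range b) \<and> rat_vs.span (range b) = UNIV \<and>
     (\<forall>i. x * b i = (\<Sum>j\<in>UNIV. of_rat (A $ i $ j) * b j)) \<and> nrm x = det A"
    using inj ind sp by (intro exI[of _ b] exI[of _ M] conjI allI) auto
next
  have U: "(UNIV :: 2 set) = {1, 2}" by (rule UNIV_2)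
  fix q assume "\<exists>(b :: 2 \<Rightarrow> 'a) A. inj b \<and> rat_vs.independent (range b) \<and> rat_vs.span (range b) = UNIV \<and>
     (\<forall>i. x * b i = (\<Sum>j\<in>UNIV. of_rat (A $ i $ j) * b j)) \<and> q = det A"
  then obtain b :: "2 \<Rightarrow> 'a" and M :: "rat^2^2" where b: "inj b" "rat_vs.independent (range b)"
    and M: "\<And>i. x * b i = (\<Sum>j\<in>UNIV. of_rat (M $ i $ j) * b j)" and q: "q = det M" by blast
  have "det2 (x * b 1) (x * b 2) = (M $ 1 $ 1 * M $ 2 $ 2 - M $ 1 $ 2 * M $ 2 $ 1) * det2 (b 1) (b 2)"
    unfolding M U by (simp add: det2_comb)
  then have eq: "nrm x * det2 (b 1) (b 2) = q * det2 (b 1) (b 2)"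
    by (simp add: det2_mult q det_2)
  have r: "range b = {b 1, b 2}" by (simp add: U)
  have ne: "b 1 \<noteq> b 2" using b(1) by (simp add: inj_eq)
  have "b 1 \<notin> rat_vs.span {b 2}" "b 2 \<noteq> 0"
    using b(2) ne unfolding r by (auto simp: rat_vs.independent_insert)
  moreover have "b 1 \<in> rat_vs.span {b 2}" if d: "det2 (b 1) (b 2) = 0" and "b 2 \<noteq> 0"
  proof -
    \<comment> \<open>For nonzero \<open>b 2\<close> the pair \<open>b 2, w * b 2\<close> is a
      basis, its \<open>det2\<close> being \<open>nrm (b 2)\<close>. Expanding \<open>b 1\<close> in
      it shows that a vanishing \<open>det2\<close> makes \<open>b 1\<close> a multiple of
      \<open>b 2\<close>.\<close>
    have "of_rat (det2 (b 2) (w * b 2)) * b 1 = of_rat (det2 (b 1) (w * b 2)) * b 2 + of_rat (det2 (b 2) (b 1)) * (w * b 2)"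
      by (rule cramer)
    moreover have "det2 (b 2) (b 1) = 0" using d by (simp add: det2_def mult.commute)
    moreover have "det2 (b 2) (w * b 2) = nrm (b 2)"
      using det2_mult[of "b 2" 1 w] by (simp add: det2_def mult.commute)
    ultimately have "of_rat (nrm (b 2)) * b 1 = of_rat (det2 (b 1) (w * b 2)) * b 2" by simp
    then have "b 1 = of_rat (det2 (b 1) (w * b 2) / nrm (b 2)) * b 2"
      using \<open>b 2 \<noteq> 0\<close> by (simp add: of_rat_divide field_simps)
    then show ?thesis unfolding rat_vs.span_singleton by blast
  qed
  ultimately have "det2 (b 1) (b 2) \<noteq> 0" by blast
  then show "q = nrm x" using eq by simp
qed

definition qorder :: "nat \<Rightarrow> 'a set" where "qorder f = zlat 1 (of_nat f * w)"

lemma qorder_iff: "x \<in> qorder f \<longleftrightarrow> (\<exists>m n :: int. x = of_int m + of_int n * (of_nat f * w))"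
  by (auto simp: qorder_def zlat_def)

lemma qorder_iff_coords: "x \<in> qorder f \<longleftrightarrow> re x \<in> \<int> \<and> (\<exists>n :: int. im x = of_int n * of_nat f)"
proof
  assume "x \<in> qorder f"
  then show "re x \<in> \<int> \<and> (\<exists>n :: int. im x = of_int n * of_nat f)"
    unfolding qorder_iff by auto
next
  assume "re x \<in> \<int> \<and> (\<exists>n :: int. im x = of_int n * of_nat f)"
  then obtain m n :: int where "re x = of_int m" "im x = of_int n * of_nat f" by (metis Ints_cases)
  then show "x \<in> qorder f" unfolding qorder_iff eq_iff[of x] by (intro exI[of _ m] exI[of _ n]) simp
qed

lemma qorder_subring:
  "0 \<in> qorder f" "1 \<in> qorder f" "of_int i \<in> qorder f" "x \<in> qorder f \<Longrightarrow> - x \<in> qorder f"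
  "x \<in> qorder f \<Longrightarrow> y \<in> qorder f \<Longrightarrow> x + y \<in> qorder f"
  "x \<in> qorder f \<Longrightarrow> y \<in> qorder f \<Longrightarrow> x - y \<in> qorder f"
  "x \<in> qorder f \<Longrightarrow> y \<in> qorder f \<Longrightarrow> x * y \<in> qorder f"
  "x \<in> qorder f \<Longrightarrow> conj x \<in> qorder f"
proof -
  show "0 \<in> qorder f" "1 \<in> qorder f" "of_int i \<in> qorder f"
    by (auto simp: qorder_iff_coords intro: exI[of _ 0])
  assume x: "x \<in> qorder f"
  then obtain m n :: int where mn: "re x = of_int m" "im x = of_int n * of_nat f"
    by (metis qorder_iff_coords Ints_cases)
  show "- x \<in> qorder f" using mn by (auto simp: qorder_iff_coords intro!: exI[of _ "-n"])
  show "conj x \<in> qorder f" using mn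
    by (auto simp: qorder_iff_coords conj_def intro!: exI[of _ "-n"] Ints_mult)
  assume y: "y \<in> qorder f"
  then obtain m' n' :: int where mn': "re y = of_int m'" "im y = of_int n' * of_nat f"
    by (metis qorder_iff_coords Ints_cases)
  show "x + y \<in> qorder f"
    using mn mn' by (auto simp: qorder_iff_coords algebra_simps intro!: exI[of _ "n + n'"])
  show "x - y \<in> qorder f"
    using mn mn' by (auto simp: qorder_iff_coords algebra_simps intro!: exI[of _ "n - n'"])
  show "x * y \<in> qorder f" using mn mn'
    by (auto simp: qorder_iff_coords algebra_simps 
      intro!: exI[of _ "m * n' + n * m' + A * n * n' * int f"] Ints_add Ints_mult)
qed

text \<open>A subgroup containing \<open>1\<close> contains all integers, so whether it contains
  \<open>m + n w\<close> depends on \<open>n\<close> only, and these \<open>n\<close> are the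
  multiples of some \<open>k\<close>.\<close>

lemma additive_subgroup_eq_qorder:
  assumes "R \<subseteq> {x. algebraic_int x}" "1 \<in> R" "\<And>x y. x \<in> R \<Longrightarrow> y \<in> R \<Longrightarrow> x - y \<in> R"
  obtains k where "R = qorder k"
proof -
  have 0: "0 \<in> R" using assms(3)[OF assms(2,2)] by simp
  have neg: "- x \<in> R" if "x \<in> R" for x using assms(3)[OF 0 that] by simp
  have add: "x + y \<in> R" if "x \<in> R" "y \<in> R" for x y using assms(3)[OF that(1) neg[OF that(2)]] by simp
  obtain j :: nat where j: "\<And>n :: int. of_int n * 1 \<in> R \<longleftrightarrow> int j dvd n"
    using multiples_in_subgroup[OF 0 assms(3)] by metis
  have "int j dvd 1" using j[of 1] assms(2) by simp
  then have int: "of_int n \<in> R" for n using j[of n] by simp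
  obtain k :: nat where k: "\<And>n :: int. of_int n * w \<in> R \<longleftrightarrow> int k dvd n"
    using multiples_in_subgroup[OF 0 assms(3)] by metis
  have "x \<in> R \<longleftrightarrow> x \<in> qorder k" for x
  proof
    assume "x \<in> R"
    then have "algebraic_int x" using assms(1) by auto
    then obtain m n where mn: "x = of_int m + of_int n * w" using algebraic_int_iff by blast
    have "x - of_int m \<in> R" using assms(3)[OF \<open>x \<in> R\<close> int] .
    then have "int k dvd n" using mn k by simp
    then obtain i where "n = int k * i" by (elim dvdE)
    then show "x \<in> qorder k" unfolding qorder_iff mn by (intro exI[of _ m] exI[of _ i]) (simp add: mult_ac)
  next
    assume "x \<in> qorder k"
    then obtain m n :: int where mn: "x = of_int m + of_int n * (of_nat k * w)" unfolding qorder_iff by blast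
    have "of_int (n * int k) * w \<in> R" unfolding k by simp
    then show "x \<in> R" using add[OF int] mn by (simp add: mult_ac)
  qed
  then show thesis using that by blast
qed

text \<open>Multiples of \<open>w\<close> represent all cosets, and two of them agree iff the
  coefficients agree modulo \<open>k\<close>. The index later serves to tell the orders
  apart.\<close>

lemma card_a_rcosets_qorder: "card (a_rcosets\<^bsub>integer_ring\<^esub> (qorder k)) = k"
proof -
  define c where "c a = (\<lambda>h. h + a) ` qorder k" for a
  have c_eq: "c a = c b \<longleftrightarrow> a - b \<in> qorder k" for a b
  proof
    assume "c a = c b"
    moreover have "a \<in> c a" using qorder_subring(1) by (force simp: c_def)
    ultimately obtain h where "h \<in> qorder k" "a = h + b" by (auto simp: c_def)
    then show "a - b \<in> qorder k" by simp
  next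
    have sub: "c a \<subseteq> c b" if "a - b \<in> qorder k" for a b
    proof
      fix x assume "x \<in> c a"
      then obtain h where "h \<in> qorder k" "x = h + a" by (auto simp: c_def)
      then show "x \<in> c b" using qorder_subring(5)[OF _ that, of h]
        by (auto simp: c_def algebra_simps intro!: image_eqI[of _ _ "h + (a - b)"])
    qed
    assume "a - b \<in> qorder k"
    moreover from this have "b - a \<in> qorder k" using qorder_subring(4) by fastforce
    ultimately show "c a = c b" using sub by blast
  qed
  have "a_rcosets\<^bsub>integer_ring\<^esub> (qorder k) = c ` {x. algebraic_int x}"
    unfolding A_RCOSETS_def' a_r_coset_def' c_def
    by (auto simp: integer_ring_def ring_of_type_algebra_def)
  also have "\<dots> = range (\<lambda>n :: int. c (of_int n * w))"
  proof -
    have "c (of_int m + of_int n * w) = c (of_int n * w)" for m n :: int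
      unfolding c_eq using qorder_subring(3) by simp
    moreover have "algebraic_int (of_int n * w)" for n :: int
      unfolding algebraic_int_iff by (intro exI[of _ 0] exI[of _ n]) simp
    ultimately show ?thesis by (auto simp: algebraic_int_iff) 
  qed
  finally have eq: "a_rcosets\<^bsub>integer_ring\<^esub> (qorder k) = range (\<lambda>n :: int. c (of_int n * w))" .
  have ceq: "c (of_int m * w) = c (of_int n * w) \<longleftrightarrow> int k dvd m - n" for m n :: int
  proof -
    have "c (of_int m * w) = c (of_int n * w) \<longleftrightarrow> (\<exists>i :: int. (of_int (m - n) :: rat) = of_int (i * int k))"
      unfolding c_eq qorder_iff_coords by simp
    also have "\<dots> \<longleftrightarrow> int k dvd m - n"
      unfolding of_int_eq_iff by (auto simp: mult.commute elim: dvdE)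
    finally show ?thesis .
  qed
  show ?thesis
  proof (cases "k = 0")
    case True
    then have "inj (\<lambda>n :: int. c (of_int n * w))" using ceq by (auto intro!: injI)
    then have "infinite (range (\<lambda>n :: int. c (of_int n * w)))"
      by (simp add: finite_image_iff)
    then show ?thesis using eq True by simp
  next
    case False
    have "range (\<lambda>n :: int. c (of_int n * w)) = (\<lambda>n :: int. c (of_int n * w)) ` {0..<int k}"
    proof -
      have "c (of_int n * w) = c (of_int (n mod int k) * w)" for n :: int
        unfolding ceq by (simp add: minus_mod_eq_mult_div)
      moreover have "n mod int k \<in> {0..<int k}" for n using False by simp
      ultimately show ?thesis by blast
    qed
    moreover have "inj_on (\<lambda>n :: int. c (of_int n * w)) {0..<int k}"
    proof (rule inj_onI)
      fix m n assume "m \<in> {0..<int k}" "n \<in> {0..<int k}" "c (of_int m * w) = c (of_int n * w)"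
      then have "\<bar>m - n\<bar> < int k" "int k dvd m - n" using ceq by auto
      then show "m = n" using dvd_imp_le_int[of "m - n" "int k"] by (cases "m = n") auto
    qed
    ultimately show ?thesis using eq by (simp add: card_image)
  qed
qed

lemma quadratic_order_eq:
  assumes "f > 0"
  shows "quadratic_order f = qorder f"
  unfolding quadratic_order_def
proof (rule the_equality)
  have "qorder f \<subseteq> {x. algebraic_int x}"
  proof
    fix x assume "x \<in> qorder f"
    then obtain m n :: int where "x = of_int m + of_int n * (of_nat f * w)" unfolding qorder_iff by blast
    then have "x = of_int m + of_int (n * int f) * w" by (simp add: mult_ac)
    then show "x \<in> {x. algebraic_int x}" using algebraic_int_iff by blast
  qed
  then show "subring (qorder f) integer_ring \<and> card (a_rcosets\<^bsub>integer_ring\<^esub> (qorder f)) = f"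
    unfolding subring_integer_ring_iff by (auto intro: qorder_subring card_a_rcosets_qorder)
next
  fix R assume R: "subring R (integer_ring :: 'a ring) \<and> card (a_rcosets\<^bsub>integer_ring\<^esub> R) = f"
  then have "x - y \<in> R" if "x \<in> R" "y \<in> R" for x y
    using that unfolding subring_integer_ring_iff by (metis add_uminus_conv_diff)
  then obtain k where "R = qorder k"
    using additive_subgroup_eq_qorder R unfolding subring_integer_ring_iff by metis
  then show "R = qorder f" using R card_a_rcosets_qorder by simp
qed

end

section \<open>Lattices and their multiplier rings\<close>

lemma zlat_closed:
  "0 \<in> zlat a b" "a \<in> zlat a b" "b \<in> zlat a b"
  "x \<in> zlat a b \<Longrightarrow> y \<in> zlat a b \<Longrightarrow> x + y \<in> zlat a b"
  "x \<in> zlat a b \<Longrightarrow> y \<in> zlat a b \<Longrightarrow> x - y \<in> zlat a b"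
  "x \<in> zlat a b \<Longrightarrow> of_int i * x \<in> zlat a b"
proof -
  show "0 \<in> zlat a b" "a \<in> zlat a b" "b \<in> zlat a b"
    by (force simp: zlat_def intro: exI[of _ 0] exI[of _ 1])+
  have I: "of_int m * a + of_int n * b \<in> zlat a b" for m n by (auto simp: zlat_def)
  assume "x \<in> zlat a b"
  then obtain m n where x: "x = of_int m * a + of_int n * b" by (auto simp: zlat_def)
  show "of_int i * x \<in> zlat a b" using I[of "i * m" "i * n"] by (simp add: x algebra_simps)
  assume "y \<in> zlat a b"
  then obtain k l where y: "y = of_int k * a + of_int l * b" by (auto simp: zlat_def)
  show "x + y \<in> zlat a b" using I[of "m + k" "n + l"] by (simp add: x y algebra_simps)
  show "x - y \<in> zlat a b" using I[of "m - k" "n - l"] by (simp add: x y algebra_simps)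
qed

lemma zlat_scale: "(*) c ` zlat a b = zlat (c * a) (c * b)"
proof -
  have "c * (of_int m * a + of_int n * b) = of_int m * (c * a) + of_int n * (c * b)" for m n
    by (simp add: algebra_simps)
  then show ?thesis unfolding zlat_def image_def by (auto; metis)
qed

lemma zlat_subset:
  assumes "a \<in> zlat c d" "b \<in> zlat c d"
  shows "zlat a b \<subseteq> zlat c d"
proof
  fix x assume "x \<in> zlat a b"
  then obtain m n where "x = of_int m * a + of_int n * b" by (auto simp: zlat_def)
  then show "x \<in> zlat c d" by (simp only: zlat_closed assms)
qed

lemma zlat_shift: "zlat a (b + of_int k * a) = zlat a b"
proof
  show "zlat a (b + of_int k * a) \<subseteq> zlat a b"
    by (intro zlat_subset zlat_closed)
  have "b + of_int k * a - of_int k * a \<in> zlat a (b + of_int k * a)"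
    by (intro zlat_closed)
  then have "b \<in> zlat a (b + of_int k * a)" by simp
  then show "zlat a b \<subseteq> zlat a (b + of_int k * a)"
    by (intro zlat_subset zlat_closed)
qed

lemma zlat_commute: "zlat a b = zlat b a"
  by (intro equalityI zlat_subset zlat_closed)

definition multiplier_ring :: "'a :: field_char_0 set \<Rightarrow> 'a set" where
  "multiplier_ring L = {x. \<forall>y\<in>L. x * y \<in> L}"

lemma multiplier_ringD: "x \<in> multiplier_ring L \<Longrightarrow> y \<in> L \<Longrightarrow> x * y \<in> L"
  by (simp add: multiplier_ring_def)

lemma multiplier_ring_scale:
  assumes "c \<noteq> 0"
  shows "multiplier_ring ((*) c ` L) = multiplier_ring L"
proof -
  have "x * (c * y) \<in> (*) c ` L \<longleftrightarrow> x * y \<in> L" for x y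
    using assms by (auto simp: mult.left_commute)
  then show ?thesis by (simp add: multiplier_ring_def)
qed

lemma bezout_int_3:
  fixes p q r :: int
  assumes "gcd p (gcd q r) = 1"
  shows "\<exists>x y z. x * p + y * q + z * r = 1"
proof -
  obtain x v where 1: "x * p + v * gcd q r = 1" using bezout_int[of p "gcd q r"] assms by auto
  obtain y z where 2: "y * q + z * r = gcd q r" using bezout_int by blast
  have "x * p + (v * y) * q + (v * z) * r = x * p + v * (y * q + z * r)"
    by (simp add: algebra_simps)
  then show ?thesis unfolding 2 1 by blast
qed

context quadratic_basis
begin

definition is_lattice :: "'a set \<Rightarrow> bool" where
  "is_lattice L \<longleftrightarrow> (\<exists>a b. det2 a b \<noteq> 0 \<and> L = zlat a b)"

lemma det2_lattice:
  assumes "x \<in> zlat a b" "y \<in> zlat a b"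
  obtains k :: int where "det2 x y = of_int k * det2 a b"
proof -
  obtain m n where x: "x = of_int m * a + of_int n * b" using assms(1) by (auto simp: zlat_def)
  obtain k l where y: "y = of_int k * a + of_int l * b" using assms(2) by (auto simp: zlat_def)
  show thesis by (rule that) (simp only: x y det2_comb_int)
qed

text \<open>A basis in Hermite normal form: \<open>c\<close> generates the integer multiples of
  \<open>a\<close> in \<open>H\<close>, and \<open>d\<close> is an element whose coefficient of
  \<open>b\<close> divides all others that occur. The independent pair \<open>x, y\<close> forces
  \<open>det2 c d\<close> to be nonzero.\<close>

lemma subgroup_is_lattice:
  assumes "0 \<in> H" "\<And>x y. x \<in> H \<Longrightarrow> y \<in> H \<Longrightarrow> x - y \<in> H"
    and "x \<in> H" "y \<in> H" "det2 x y \<noteq> 0" "H \<subseteq> zlat a b"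
  shows "is_lattice H"
proof -
  have neg: "- x \<in> H" if "x \<in> H" for x using assms(2)[OF assms(1) that] by simp
  have add: "x + y \<in> H" if "x \<in> H" "y \<in> H" for x y using assms(2)[OF that(1) neg[OF that(2)]] by simp
  have mult: "of_int i * x \<in> H" if "x \<in> H" for x and i :: int
  proof -
    obtain j :: nat where j: "\<And>n :: int. of_int n * x \<in> H \<longleftrightarrow> int j dvd n"
      using multiples_in_subgroup[OF assms(1,2)] by metis
    have "int j dvd 1" unfolding j[symmetric] using that by simp
    then show ?thesis unfolding j by simp
  qed
  obtain j :: nat where j: "\<And>n :: int. of_int n * a \<in> H \<longleftrightarrow> int j dvd n"
    using multiples_in_subgroup[OF assms(1,2)] by metis
  define Y where "Y = {n :: int. \<exists>m :: int. of_int m * a + of_int n * b \<in> H}"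
  have "0 \<in> Y" unfolding Y_def using assms(1) by (auto intro: exI[of _ 0])
  moreover have "n - n' \<in> Y" if "n \<in> Y" "n' \<in> Y" for n n'
  proof -
    obtain m m' :: int where "of_int m * a + of_int n * b \<in> H" "of_int m' * a + of_int n' * b \<in> H"
      using \<open>n \<in> Y\<close> \<open>n' \<in> Y\<close> by (auto simp: Y_def)
    then have "(of_int m * a + of_int n * b) - (of_int m' * a + of_int n' * b) \<in> H" by (rule assms(2))
    then have "of_int (m - m') * a + of_int (n - n') * b \<in> H" by (simp add: algebra_simps)
    then show ?thesis unfolding Y_def by blast
  qed
  ultimately obtain k :: nat where k: "Y = {n. int k dvd n}"
    using int_subgroup_principal by blast
  then have "int k \<in> Y" by simp
  then obtain m0 :: int where m0: "of_int m0 * a + of_int (int k) * b \<in> H" by (auto simp: Y_def)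
  define c where "c = of_int (int j) * a"
  define d where "d = of_int m0 * a + of_int (int k) * b"
  have "c \<in> H" unfolding c_def j by simp
  have "d \<in> H" unfolding d_def by (rule m0)
  have H: "H = zlat c d"
  proof
    show "zlat c d \<subseteq> H" using add mult \<open>c \<in> H\<close> \<open>d \<in> H\<close> by (auto simp: zlat_def)
    show "H \<subseteq> zlat c d"
    proof
      fix h assume h: "h \<in> H"
      then obtain m n where mn: "h = of_int m * a + of_int n * b" using assms(6) by (auto simp: zlat_def)
      then have "n \<in> Y" using h by (auto simp: Y_def)
      then obtain i where i: "n = int k * i" using k by (auto elim: dvdE)
      have "h - of_int i * d \<in> H" using assms(2)[OF h mult[OF \<open>d \<in> H\<close>]] .
      moreover have eq: "h - of_int i * d = of_int (m - i * m0) * a"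
        by (simp add: mn d_def i algebra_simps)
      ultimately have "int j dvd m - i * m0" by (simp only: j)
      then obtain l where l: "m - i * m0 = int j * l" by (elim dvdE)
      have "h = of_int l * c + of_int i * d"
        using eq unfolding l c_def by (simp add: algebra_simps)
      then show "h \<in> zlat c d" by (auto simp: zlat_def)
    qed
  qed
  obtain i :: int where "det2 x y = of_int i * det2 c d"
    using det2_lattice assms(3,4) unfolding H by blast
  then have "det2 c d \<noteq> 0" using assms(5) by auto
  then show ?thesis using H unfolding is_lattice_def by blast
qed

section \<open>Primitive quadratic forms and multiplier rings\<close>

lemma im_neq_0_unique:
  fixes m n m' n' :: int
  assumes "of_int m + of_int n * t = of_int m' + of_int n' * t" "im t \<noteq> 0"
  shows "m = m' \<and> n = n'"
proof -
  have "im (of_int m + of_int n * t) = im (of_int m' + of_int n' * t)" using assms(1) by simp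
  then have "n = n'" using assms(2) by simp
  then show ?thesis using assms(1) by simp
qed

text \<open>The primitive integral polynomial with root \<open>t\<close>, fixed only up to sign.
  Since \<open>p\<close> may be negative, inverting \<open>t\<close> simply exchanges
  \<open>p\<close> and \<open>r\<close>.\<close>

definition primitive_form :: "'a \<Rightarrow> int \<Rightarrow> int \<Rightarrow> int \<Rightarrow> bool" where
  "primitive_form t p q r \<longleftrightarrow> im t \<noteq> 0 \<and> p \<noteq> 0 \<and> gcd p (gcd q r) = 1 \<and>
     of_int p * (t * t) + of_int q * t + of_int r = 0"

lemma primitive_form_exists:
  assumes "im t \<noteq> 0"
  shows "\<exists>p q r. primitive_form t p q r"
proof -
  \<comment> \<open>This is minus the trace of \<open>t\<close>, so \<open>t\<close> is a root of
    \<open>X^2 + u X + nrm t\<close>.\<close>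
  define u where "u = - (2 * re t + of_int A * im t)"
  have eq: "t * t + of_rat u * t + of_rat (nrm t) = 0"
    unfolding eq_iff by (simp add: u_def nrm_def algebra_simps power2_eq_square)
  obtain p q r :: int where pqr: "p \<noteq> 0" "gcd p (gcd q r) = 1"
    "of_int q = of_int p * u" "of_int r = of_int p * nrm t"
    using primitive_triple_rat by blast
  have "(of_int q :: 'a) = of_rat (of_int q)" "(of_int r :: 'a) = of_rat (of_int r)" by simp_all
  then have qr: "(of_int q :: 'a) = of_int p * of_rat u" "(of_int r :: 'a) = of_int p * of_rat (nrm t)"
    unfolding pqr by (simp_all add: of_rat_mult)
  have "of_int p * (t * t) + of_int q * t + of_int r = of_int p * (t * t + of_rat u * t + of_rat (nrm t))"
    by (simp add: qr algebra_simps)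
  then have "of_int p * (t * t) + of_int q * t + of_int r = 0" unfolding eq by simp
  then show ?thesis unfolding primitive_form_def using assms pqr(1,2) by (intro exI conjI)
qed

text \<open>A multiplier lies in the lattice, as \<open>1\<close> does. If \<open>m + n t\<close>
  also maps \<open>t\<close> into the lattice, then multiplying by \<open>p\<close> and eliminating
  \<open>t * t\<close> shows that \<open>p\<close> divides \<open>n * q\<close> and
  \<open>n * r\<close>; the form being primitive, \<open>p\<close> divides \<open>n\<close>.\<close>

lemma multiplier_ring_lattice_1:
  assumes "primitive_form t p q r"
  shows "multiplier_ring (zlat 1 t) = zlat 1 (of_int p * t)"
proof
  have t: "im t \<noteq> 0" and p0: "p \<noteq> 0" and g: "gcd p (gcd q r) = 1"
    and rel: "of_int p * (t * t) + of_int q * t + of_int r = 0"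
    using assms unfolding primitive_form_def by auto
  have rel': "of_int p * (t * t) = - of_int q * t - of_int r"
  proof -
    have "of_int p * (t * t) = (of_int p * (t * t) + of_int q * t + of_int r) - of_int q * t - of_int r" by simp
    then show ?thesis unfolding rel by simp
  qed
  show "multiplier_ring (zlat 1 t) \<subseteq> zlat 1 (of_int p * t)"
  proof
    fix x assume x: "x \<in> multiplier_ring (zlat 1 t)"
    have "x * 1 \<in> zlat 1 t" using x zlat_closed(2) by (rule multiplier_ringD)
    then obtain m n :: int where mn: "x = of_int m + of_int n * t" by (auto simp: zlat_def)
    have "x * t \<in> zlat 1 t" using x zlat_closed(3) by (rule multiplier_ringD)
    then obtain m' n' :: int where mn': "x * t = of_int m' + of_int n' * t" by (auto simp: zlat_def)
    have "of_int p * (x * t) = of_int (p * m) * t + of_int n * (of_int p * (t * t))"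
      by (simp add: mn algebra_simps)
    also have "\<dots> = of_int (- n * r) + of_int (p * m - n * q) * t"
      unfolding rel' by (simp add: algebra_simps)
    finally have "of_int (- n * r) + of_int (p * m - n * q) * t = of_int (p * m') + of_int (p * n') * t"
      unfolding mn' by (simp add: algebra_simps)
    then have e: "- n * r = p * m' \<and> p * m - n * q = p * n'" by (rule im_neq_0_unique) (rule t)
    then have "p dvd n * r" by (metis dvd_minus_iff dvd_triv_left mult_minus_left)
    moreover have "n * q = p * (m - n')" using e by (simp add: algebra_simps)
    then have "p dvd n * q" by simp
    moreover obtain x' y z where "x' * p + y * q + z * r = 1" using bezout_int_3[OF g] by blast
    then have "n = p * (x' * n) + y * (n * q) + z * (n * r)"
      by (metis mult.right_neutral distrib_left mult.left_commute mult.commute)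
    ultimately have "p dvd n" by (metis dvd_add dvd_mult dvd_triv_left)
    then obtain i where "n = p * i" by (elim dvdE)
    then have "x = of_int m * 1 + of_int i * (of_int p * t)" by (simp add: mn algebra_simps)
    then show "x \<in> zlat 1 (of_int p * t)" unfolding zlat_def by blast
  qed
  show "zlat 1 (of_int p * t) \<subseteq> multiplier_ring (zlat 1 t)"
  proof
    fix x assume "x \<in> zlat 1 (of_int p * t)"
    then obtain m i where x: "x = of_int m + of_int i * (of_int p * t)" by (auto simp: zlat_def)
    have "x * y \<in> zlat 1 t" if "y \<in> zlat 1 t" for y
    proof -
      obtain k l where y: "y = of_int k + of_int l * t" using \<open>y \<in> zlat 1 t\<close> by (auto simp: zlat_def)
      have "x * y = of_int (m * k) + of_int (m * l + i * p * k) * t + of_int (i * l) * (of_int p * (t * t))"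
        by (simp add: x y algebra_simps)
      also have "\<dots> = of_int (m * k - i * l * r) * 1 + of_int (m * l + i * p * k - i * l * q) * t"
        unfolding rel' by (simp add: algebra_simps)
      finally show ?thesis unfolding zlat_def by blast
    qed
    then show "x \<in> multiplier_ring (zlat 1 t)" unfolding multiplier_ring_def by blast
  qed
qed

lemma lattice_eq_scale:
  assumes "det2 a b \<noteq> 0"
  shows "a \<noteq> 0 \<and> im (b / a) \<noteq> 0 \<and> zlat a b = (*) a ` zlat 1 (b / a)"
proof -
  have a: "a \<noteq> 0" using assms by (auto simp: det2_def)
  have "det2 (a * 1) (a * (b / a)) = nrm a * im (b / a)"
    unfolding det2_mult by (simp add: det2_def)
  then have "im (b / a) \<noteq> 0" using a assms by auto
  then show ?thesis using a by (simp add: zlat_scale)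
qed

lemma lattice_1_eq_qorder: "zlat 1 (of_int m + of_int n * w) = qorder (nat \<bar>n\<bar>)"
proof -
  have "zlat 1 (of_int m + of_int n * w) = zlat 1 (of_int n * w)"
    using zlat_shift[of 1 "of_int n * w" m] by (simp add: add.commute)
  also have "\<dots> = zlat 1 (of_int \<bar>n\<bar> * w)"
  proof (cases "n \<ge> 0")
    case False
    have *: "zlat 1 y \<subseteq> zlat 1 (- y)" for y :: 'a
    proof (intro zlat_subset zlat_closed)
      have "of_int (- 1) * - y \<in> zlat 1 (- y)" by (intro zlat_closed)
      then show "y \<in> zlat 1 (- y)" by simp
    qed
    have "zlat 1 y = zlat 1 (- y)" for y :: 'a
      using *[of y] *[of "- y"] by auto
    then show ?thesis using False by (metis abs_of_neg minus_mult_left not_le of_int_minus)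
  qed simp
  also have "\<dots> = qorder (nat \<bar>n\<bar>)" by (simp add: qorder_def)
  finally show ?thesis .
qed

text \<open>The element \<open>p t\<close> is integral, being a root of
  \<open>X^2 + q X + p r\<close>, so it has integer coordinates \<open>m, n\<close>. Neither
  \<open>m\<close> nor the sign of \<open>n\<close> affects the lattice it spans with
  \<open>1\<close>.\<close>

lemma multiplier_ring_lattice_1_qorder:
  assumes "primitive_form t p q r"
  obtains m n where "of_int p * t = of_int m + of_int n * w" "n \<noteq> 0"
    "multiplier_ring (zlat 1 t) = qorder (nat \<bar>n\<bar>)"
proof -
  have t: "im t \<noteq> 0" and p0: "p \<noteq> 0"
    and rel: "of_int p * (t * t) + of_int q * t + of_int r = 0"
    using assms unfolding primitive_form_def by auto
  have "(of_int p * t) * (of_int p * t) = of_int (- q) * (of_int p * t) + of_int (- (p * r))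
     + of_int p * (of_int p * (t * t) + of_int q * t + of_int r)"
    by (simp add: algebra_simps)
  then have "algebraic_int (of_int p * t)" unfolding rel by (intro quadratic_algebraic_int[of _ "- q" "- (p * r)"]) simp
  then obtain m n where mn: "of_int p * t = of_int m + of_int n * w" unfolding algebraic_int_iff by blast
  have "im (of_int p * t) = of_int n" unfolding mn by simp
  then have "n \<noteq> 0" using t p0 by auto
  then show thesis using that[OF mn] multiplier_ring_lattice_1[OF assms] lattice_1_eq_qorder[of m n] mn by simp
qed

lemma multiplier_ring_eq_qorder:
  assumes "is_lattice L"
  obtains n where "n > 0" "multiplier_ring L = qorder n"
proof -
  obtain a b where ab: "det2 a b \<noteq> 0" "L = zlat a b" using assms unfolding is_lattice_def by blast
  note s = lattice_eq_scale[OF ab(1)]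
  obtain p q r where f: "primitive_form (b / a) p q r" using primitive_form_exists[of "b / a"] s by auto
  obtain n where "n \<noteq> 0" "multiplier_ring (zlat 1 (b / a)) = qorder (nat \<bar>n\<bar>)"
    by (rule multiplier_ring_lattice_1_qorder[OF f])
  then show thesis using that[of "nat \<bar>n\<bar>"] s ab(2) by (simp add: multiplier_ring_scale)
qed

text \<open>If \<open>u = b / a\<close> has primitive form \<open>(p, q, r)\<close>, the inverse of the lattice is spanned by \<open>p / a\<close>
  and \<open>(p * u + q) / a\<close>: their products with \<open>a\<close> and \<open>b\<close> yield \<open>p\<close>, \<open>q\<close> and \<open>r\<close>, hence 1 by a Bezout
  relation.\<close>

lemma lattice_inverse:
  assumes "det2 a b \<noteq> 0"
  obtains s t where "s * a + t * b = 1"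
    "\<And>x. x \<in> zlat a b \<Longrightarrow> s * x \<in> multiplier_ring (zlat a b) \<and> t * x \<in> multiplier_ring (zlat a b)"
proof -
  note sc = lattice_eq_scale[OF assms]
  define u where "u = b / a"
  have a: "a \<noteq> 0" and b: "b = a * u" and u: "im u \<noteq> 0" and L: "zlat a b = (*) a ` zlat 1 u"
    using sc by (auto simp: u_def)
  obtain p q r where f: "primitive_form u p q r" using primitive_form_exists[OF u] by blast
  then have p0: "p \<noteq> 0" and g: "gcd p (gcd q r) = 1"
    and rel: "of_int p * (u * u) + of_int q * u + of_int r = 0"
    unfolding primitive_form_def by auto
  define S where "S = multiplier_ring (zlat a b)"
  have S: "S = zlat 1 (of_int p * u)"
    unfolding S_def L by (simp add: multiplier_ring_scale a multiplier_ring_lattice_1[OF f])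
  obtain x y z where xyz: "x * p + y * q + z * r = 1" using bezout_int_3[OF g] by blast
  define j1 where "j1 = of_int p / a"
  define j2 where "j2 = (of_int p * u + of_int q) / a"
  have j1: "j1 * h \<in> S" if "h \<in> zlat a b" for h
  proof -
    obtain y where y: "h = a * y" "y \<in> zlat 1 u" using \<open>h \<in> zlat a b\<close> unfolding L by blast
    obtain m n where "y = of_int m * 1 + of_int n * u" using y(2) unfolding zlat_def by blast
    then have h: "h = a * (of_int m * 1 + of_int n * u)" using y(1) by simp
    have "j1 * h = of_int (p * m) * 1 + of_int n * (of_int p * u)"
      using a by (simp add: h j1_def algebra_simps)
    then show ?thesis unfolding S zlat_def by blast
  qed
  have j2: "j2 * h \<in> S" if "h \<in> zlat a b" for h
  proof -
    obtain y where y: "h = a * y" "y \<in> zlat 1 u" using \<open>h \<in> zlat a b\<close> unfolding L by blast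
    obtain m n where "y = of_int m * 1 + of_int n * u" using y(2) unfolding zlat_def by blast
    then have h: "h = a * (of_int m * 1 + of_int n * u)" using y(1) by simp
    have "j2 * h = (of_int p * u + of_int q) * (of_int m + of_int n * u)"
      using a by (simp add: h j2_def)
    also have "\<dots> = of_int (q * m - n * r) * 1 + of_int m * (of_int p * u)
       + of_int n * (of_int p * (u * u) + of_int q * u + of_int r)" by (simp add: algebra_simps)
    finally have "j2 * h = of_int (q * m - n * r) * 1 + of_int m * (of_int p * u)" unfolding rel by simp
    then show ?thesis unfolding S zlat_def by blast
  qed
  \<comment> \<open>As \<open>p = j1 * a\<close>, \<open>q = j2 * a - j1 * b\<close> and
    \<open>r = - j2 * b\<close>, the Bezout relation \<open>x * p + y * q + z * r = 1\<close>
    dictates \<open>s\<close> and \<open>t\<close>.\<close>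
  define s where "s = of_int x * j1 + of_int y * j2"
  define t where "t = - of_int z * j2 - of_int y * j1"
  have "s * a + t * b = (of_int x * of_int p + of_int y * (of_int p * u + of_int q))
      + (- of_int z * (of_int p * u + of_int q) - of_int y * of_int p) * u"
    using a by (simp add: s_def t_def j1_def j2_def b field_simps)
  also have "\<dots> = of_int (x * p + y * q + z * r) - of_int z * (of_int p * (u * u) + of_int q * u + of_int r)"
    by (simp add: algebra_simps)
  also have "\<dots> = 1" unfolding rel xyz by simp
  finally have 1: "s * a + t * b = 1" .
  have "s * h \<in> S \<and> t * h \<in> S" if "h \<in> zlat a b" for h
  proof -
    have "s * h = of_int x * (j1 * h) + of_int y * (j2 * h)" by (simp add: s_def algebra_simps)
    moreover have "t * h = of_int (- z) * (j2 * h) - of_int y * (j1 * h)" by (simp add: t_def algebra_simps)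
    ultimately show ?thesis using j1[OF that] j2[OF that] unfolding S by (simp only: zlat_closed simp_thms)
  qed
  then show thesis using that[OF 1] S_def by blast
qed

end

section \<open>Picard groups\<close>

lemma ideal_prod_memI: "i \<in> I \<Longrightarrow> j \<in> J \<Longrightarrow> i * j \<in> ideal_prod field_ring I J"
  using ideal_prod.prod[of i I j J field_ring] by (simp add: ring_of_type_algebra_def)

lemma ideal_prod_add:
  "x \<in> ideal_prod field_ring I J \<Longrightarrow> y \<in> ideal_prod field_ring I J \<Longrightarrow> x + y \<in> ideal_prod field_ring I J"
  using ideal_prod.sum[of x field_ring I J y] by (simp add: ring_of_type_algebra_def)

lemma ideal_prod_subsetI:
  assumes "\<And>i j. i \<in> I \<Longrightarrow> j \<in> J \<Longrightarrow> i * j \<in> H" "\<And>x y. x \<in> H \<Longrightarrow> y \<in> H \<Longrightarrow> x + y \<in> H"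
  shows "ideal_prod field_ring I J \<subseteq> H"
proof
  fix x assume "x \<in> ideal_prod field_ring I J"
  then show "x \<in> H"
    by (induction rule: ideal_prod.induct) (use assms in \<open>simp_all add: ring_of_type_algebra_def\<close>)
qed

lemma ideal_prod_commute: "ideal_prod field_ring I J = ideal_prod field_ring J (I :: 'a :: field_char_0 set)"
proof (intro equalityI ideal_prod_subsetI)
  fix i j :: 'a assume "i \<in> I" "j \<in> J"
  then show "i * j \<in> ideal_prod field_ring J I" using ideal_prod_memI[of j J i I] by (simp add: mult.commute)
next
  fix i j :: 'a assume "i \<in> J" "j \<in> I"
  then show "i * j \<in> ideal_prod field_ring I J" using ideal_prod_memI[of j I i J] by (simp add: mult.commute)
qed (rule ideal_prod_add; assumption)+

text \<open>For a lattice invertible over an order this is its class in the Picard group, see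
  \<open>carrier_Pic\<close>. The order itself is recovered as the multiplier ring.\<close>

definition homothety_class :: "'a :: field_char_0 set \<Rightarrow> 'a set set" where
  "homothety_class L = {(*) c ` L | c. c \<noteq> 0}"

lemma scale_scale: "(*) c ` (*) d ` L = (*) (c * d) ` (L :: 'a :: field_char_0 set)"
  by (simp add: image_image mult.assoc)

lemma scale_inverse: "c \<noteq> 0 \<Longrightarrow> (*) (inverse c) ` (*) c ` L = (L :: 'a :: field_char_0 set)"
  by (simp add: image_image flip: mult.assoc)

lemma homothety_class_self: "L \<in> homothety_class L"
  unfolding homothety_class_def by (auto intro!: exI[of _ 1])

lemma homothety_class_scale:
  fixes L :: "'a :: field_char_0 set"
  assumes "c \<noteq> 0"
  shows "homothety_class ((*) c ` L) = homothety_class L"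
proof -
  have eq: "(*) d ` L = (*) (d * inverse c) ` (*) c ` L" for d :: 'a
    unfolding scale_scale using assms by (simp add: mult.assoc)
  have "(*) d ` L \<in> homothety_class ((*) c ` L)" if "d \<noteq> 0" for d :: 'a
    unfolding homothety_class_def
  proof (intro CollectI exI conjI)
    show "(*) d ` L = (*) (d * inverse c) ` (*) c ` L" by (rule eq)
    show "d * inverse c \<noteq> 0" using that assms by simp
  qed
  moreover have "(*) d ` (*) c ` L \<in> homothety_class L" if "d \<noteq> 0" for d :: 'a
    unfolding homothety_class_def
  proof (intro CollectI exI conjI)
    show "(*) d ` (*) c ` L = (*) (d * c) ` L" by (rule scale_scale)
    show "d * c \<noteq> 0" using that assms by simp
  qed
  ultimately show ?thesis by (auto simp: homothety_class_def)
qed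

context quadratic_basis
begin

section \<open>Fractional ideals as lattices\<close>

lemma denominator:
  assumes "f > 0"
  obtains d :: int where "d > 0" "of_int d * z \<in> qorder f"
proof -
  obtain a b where "quotient_of (re z) = (a, b)" by force
  then have ab: "b > 0" "re z = of_int a / of_int b"
    using quotient_of_denom_pos quotient_of_div by auto
  obtain c d where "quotient_of (im z) = (c, d)" by force
  then have cd: "d > 0" "im z = of_int c / of_int d"
    using quotient_of_denom_pos quotient_of_div by auto
  have "of_int (b * d * int f) * z \<in> qorder f"
    unfolding qorder_iff_coords using ab cd by (auto intro!: exI[of _ "b * c"])
  moreover have "b * d * int f > 0" using ab cd assms by simp
  ultimately show thesis using that by blast
qed

lemma frac_field_qorder: "f > 0 \<Longrightarrow> frac_field (qorder f) = UNIV"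
proof -
  assume f: "f > 0"
  have "z \<in> frac_field (qorder f)" for z
  proof -
    obtain d :: int where "d > 0" "of_int d * z \<in> qorder f" using denominator[OF f] by blast
    moreover have "z = of_int d * z / of_int d" using \<open>d > 0\<close> by simp
    ultimately show ?thesis unfolding frac_field_def using qorder_subring(3)
      by (metis (mono_tags, lifting) CollectI less_irrefl of_int_eq_0_iff)
  qed
  then show ?thesis by auto
qed

lemma lattice_module:
  assumes "is_lattice L"
  shows "0 \<in> L" "x \<in> L \<Longrightarrow> y \<in> L \<Longrightarrow> x + y \<in> L" "x \<in> L \<Longrightarrow> y \<in> L \<Longrightarrow> x - y \<in> L"
    "x \<in> L \<Longrightarrow> of_int i * x \<in> L"
proof -
  obtain a b where L: "L = zlat a b" using assms unfolding is_lattice_def by blast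
  show "0 \<in> L" "x \<in> L \<Longrightarrow> y \<in> L \<Longrightarrow> x + y \<in> L" "x \<in> L \<Longrightarrow> y \<in> L \<Longrightarrow> x - y \<in> L"
    "x \<in> L \<Longrightarrow> of_int i * x \<in> L"
    unfolding L by (fact zlat_closed)+
qed

lemma lattice_common_denominator:
  assumes "is_lattice L" "f > 0"
  obtains d :: int where "d > 0" "\<And>x. x \<in> L \<Longrightarrow> of_int d * x \<in> qorder f"
proof -
  obtain a b where L: "L = zlat a b" using assms(1) unfolding is_lattice_def by blast
  obtain d :: int where d: "d > 0" "of_int d * a \<in> qorder f" using denominator[OF assms(2)] by blast
  obtain e :: int where e: "e > 0" "of_int e * b \<in> qorder f" using denominator[OF assms(2)] by blast
  have "of_int (d * e) * x \<in> qorder f" if "x \<in> L" for x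
  proof -
    obtain m n where "x = of_int m * a + of_int n * b" using \<open>x \<in> L\<close> unfolding L zlat_def by blast
    then have "of_int (d * e) * x = of_int (e * m) * (of_int d * a) + of_int (d * n) * (of_int e * b)"
      by (simp add: algebra_simps)
    then show ?thesis using d e by (simp only: qorder_subring)
  qed
  then show thesis using that[of "d * e"] d e by simp
qed

text \<open>The elements \<open>x\<close> and \<open>f w x\<close> of \<open>I\<close> are
  independent, with \<open>det2\<close> equal to \<open>f\<close> times \<open>nrm x\<close>, and
  \<open>d\<close> bounds the denominators, so \<open>subgroup_is_lattice\<close> applies. Both
  fractional ideals and modules generated by a pair fall under this criterion.\<close>

lemma qorder_module_is_lattice:
  assumes f: "f > 0" and "0 \<in> I" "\<And>x y. x \<in> I \<Longrightarrow> y \<in> I \<Longrightarrow> x + y \<in> I"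
    and I: "\<And>r x. r \<in> qorder f \<Longrightarrow> x \<in> I \<Longrightarrow> r * x \<in> I"
    and "d \<noteq> 0" "\<And>x. x \<in> I \<Longrightarrow> d * x \<in> qorder f" "x \<in> I" "x \<noteq> 0"
  shows "is_lattice I"
proof (rule subgroup_is_lattice)
  show "0 \<in> I" by fact
  show "y - z \<in> I" if "y \<in> I" "z \<in> I" for y z
    using assms(3)[OF that(1) I[OF qorder_subring(3)[of "-1"] that(2)]] by simp
  show "x \<in> I" by fact
  have "of_nat f * w \<in> qorder f" unfolding qorder_def by (rule zlat_closed)
  then show "(of_nat f * w) * x \<in> I" using I \<open>x \<in> I\<close> by blast
  have "det2 (x * 1) (x * (of_nat f * w)) = nrm x * of_nat f"
    unfolding det2_mult by (simp add: det2_def)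
  then show "det2 x ((of_nat f * w) * x) \<noteq> 0" using assms by (simp add: mult_ac)
  show "I \<subseteq> zlat (inverse d * 1) (inverse d * (of_nat f * w))"
  proof
    fix y assume "y \<in> I"
    then have "d * y \<in> zlat 1 (of_nat f * w)" using assms(6) qorder_def by blast
    then have "inverse d * (d * y) \<in> (*) (inverse d) ` zlat 1 (of_nat f * w)" by blast
    then show "y \<in> zlat (inverse d * 1) (inverse d * (of_nat f * w))"
      unfolding zlat_scale using \<open>d \<noteq> 0\<close> by (simp flip: mult.assoc)
  qed
qed

lemma fractional_ideal_imp_lattice:
  assumes f: "f > 0" and I: "fractional_ideal (qorder f) I" and "x \<in> I" "x \<noteq> 0"
  shows "is_lattice I"
proof -
  obtain d where "d \<in> qorder f" "d \<noteq> 0" "\<forall>x\<in>I. d * x \<in> qorder f"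
    using I unfolding fractional_ideal_def by blast
  note d = this
  show ?thesis
  proof (rule qorder_module_is_lattice[OF f _ _ _ d(2) _ assms(3,4)])
    show "0 \<in> I" "\<And>x y. x \<in> I \<Longrightarrow> y \<in> I \<Longrightarrow> x + y \<in> I"
      "\<And>r x. r \<in> qorder f \<Longrightarrow> x \<in> I \<Longrightarrow> r * x \<in> I"
      using I unfolding fractional_ideal_def by simp_all
    show "\<And>x. x \<in> I \<Longrightarrow> d * x \<in> qorder f" using d(3) by simp
  qed
qed

lemma lattice_imp_fractional_ideal:
  assumes f: "f > 0" and L: "is_lattice L" and sub: "qorder f \<subseteq> multiplier_ring L"
  shows "fractional_ideal (qorder f) L"
proof -
  obtain d :: int where d: "d > 0" "\<And>x. x \<in> L \<Longrightarrow> of_int d * x \<in> qorder f"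
    using lattice_common_denominator[OF L f] by blast
  have "\<exists>d\<in>qorder f. d \<noteq> 0 \<and> (\<forall>x\<in>L. d * x \<in> qorder f)"
    using d by (intro bexI[of _ "of_int d"] conjI ballI) (simp_all add: qorder_subring)
  moreover have "r * x \<in> L" if "r \<in> qorder f" "x \<in> L" for r x
    using multiplier_ringD[of r L x] that sub by auto
  ultimately show ?thesis unfolding fractional_ideal_def frac_field_qorder[OF f]
    by (intro conjI ballI) (simp_all add: lattice_module[OF L])
qed

text \<open>If \<open>I J\<close> is the order, it contains \<open>1\<close>, and a multiplier of
  \<open>I\<close> maps \<open>1\<close> into \<open>I J\<close>; so it lies in the order.
  Conversely, the inverse of \<open>L\<close> is the set \<open>J\<close> of all \<open>t\<close>
  with \<open>t L\<close> in the order, and \<open>lattice_inverse\<close> puts \<open>1\<close>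
  into \<open>L J\<close>.\<close>

lemma Units_fractional_ideal_monoid:
  assumes f: "f > 0"
  shows "Units (fractional_ideal_monoid (qorder f)) = {L. is_lattice L \<and> multiplier_ring L = qorder f}"
proof (intro equalityI subsetI)
  fix I assume "I \<in> Units (fractional_ideal_monoid (qorder f))"
  then obtain J where I: "fractional_ideal (qorder f) I" and J: "fractional_ideal (qorder f) J"
    and IJ: "ideal_prod field_ring I J = qorder f"
    unfolding Units_def fractional_ideal_monoid_def by auto
  have "\<exists>x\<in>I. x \<noteq> 0"
  proof (rule ccontr)
    assume "\<not> ?thesis"
    then have "ideal_prod field_ring I J \<subseteq> {0}" by (intro ideal_prod_subsetI) auto
    then have "1 \<in> {0 :: 'a}" unfolding IJ using qorder_subring(2) by blast
    then show False by simp
  qed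
  then have lat: "is_lattice I" using fractional_ideal_imp_lattice[OF f I] by blast
  have "multiplier_ring I = qorder f"
  proof
    show "qorder f \<subseteq> multiplier_ring I"
      using I unfolding fractional_ideal_def multiplier_ring_def by blast
    show "multiplier_ring I \<subseteq> qorder f"
    proof
      fix x assume x: "x \<in> multiplier_ring I"
      have "ideal_prod field_ring I J \<subseteq> {z. x * z \<in> qorder f}"
      proof (rule ideal_prod_subsetI)
        fix i j assume "i \<in> I" "j \<in> J"
        then have "(x * i) * j \<in> ideal_prod field_ring I J"
          using multiplier_ringD[OF x] by (intro ideal_prod_memI)
        then show "i * j \<in> {z. x * z \<in> qorder f}" unfolding IJ by (simp add: mult.assoc)
      qed (simp add: distrib_left qorder_subring)
      then have "1 \<in> {z. x * z \<in> qorder f}" unfolding IJ using qorder_subring(2) by blast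
      then show "x \<in> qorder f" by simp
    qed
  qed
  with lat show "I \<in> {L. is_lattice L \<and> multiplier_ring L = qorder f}" by simp
next
  fix L assume "L \<in> {L. is_lattice L \<and> multiplier_ring L = qorder f}"
  then have L: "is_lattice L" and R: "multiplier_ring L = qorder f" by auto
  then obtain a b where ab: "det2 a b \<noteq> 0" "L = zlat a b" unfolding is_lattice_def by blast
  have mem: "a \<in> L" "b \<in> L" unfolding ab(2) by (rule zlat_closed)+
  define J where "J = {t. \<forall>x\<in>L. t * x \<in> qorder f}"
  have fL: "fractional_ideal (qorder f) L" using lattice_imp_fractional_ideal[OF f L] R by simp
  have a0: "a \<noteq> 0" using ab(1) by (auto simp: det2_def)
  \<comment> \<open>A common denominator for \<open>J\<close>: each \<open>t\<close> in
    \<open>J\<close> has \<open>t * a\<close> in the order, so an integer multiple of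
    \<open>a\<close> that lies in the order serves.\<close>
  obtain d :: int where d: "d > 0" "of_int d * a \<in> qorder f" using denominator[OF f] by blast
  have "(of_int d * a) * t \<in> qorder f" if "t \<in> J" for t
  proof -
    have "t * a \<in> qorder f" using that mem by (auto simp: J_def)
    then have "of_int d * (t * a) \<in> qorder f" by (rule qorder_subring(7)[OF qorder_subring(3)])
    then show ?thesis by (simp add: mult_ac)
  qed
  then have "\<exists>d\<in>qorder f. d \<noteq> 0 \<and> (\<forall>x\<in>J. d * x \<in> qorder f)"
    using d a0 by (intro bexI[of _ "of_int d * a"]) auto
  then have fJ: "fractional_ideal (qorder f) J"
    unfolding fractional_ideal_def frac_field_qorder[OF f]
    by (intro conjI) (auto simp: J_def distrib_right mult.assoc intro: qorder_subring(1,5,7))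
  have "ideal_prod field_ring L J = qorder f"
  proof
    show "ideal_prod field_ring L J \<subseteq> qorder f"
      by (rule ideal_prod_subsetI) (auto simp: J_def mult.commute intro: qorder_subring(5))
    obtain s t where st: "s * a + t * b = 1"
      "\<And>x. x \<in> zlat a b \<Longrightarrow> s * x \<in> multiplier_ring (zlat a b) \<and> t * x \<in> multiplier_ring (zlat a b)"
      using lattice_inverse[OF ab(1)] by blast
    then have "s \<in> J" "t \<in> J" using R ab(2) by (auto simp: J_def)
    show "qorder f \<subseteq> ideal_prod field_ring L J"
    proof
      fix r assume "r \<in> qorder f"
      then have "r * a \<in> L" "r * b \<in> L" using mem multiplier_ringD R by blast+
      then have "(r * a) * s + (r * b) * t \<in> ideal_prod field_ring L J"
        using \<open>s \<in> J\<close> \<open>t \<in> J\<close> by (intro ideal_prod_add ideal_prod_memI)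
      moreover have "(r * a) * s + (r * b) * t = r * (s * a + t * b)" by (simp add: algebra_simps)
      ultimately show "r \<in> ideal_prod field_ring L J" unfolding st(1) by simp
    qed
  qed
  then show "L \<in> Units (fractional_ideal_monoid (qorder f))"
    unfolding Units_def fractional_ideal_monoid_def using fL fJ ideal_prod_commute[of J L]
    by (simp, intro exI[of _ J]) simp
qed

text \<open>The coset of \<open>L\<close> consists of its products with the principal ideals
  \<open>c R\<close>, and these products are the multiples \<open>c L\<close>. Every nonzero
  \<open>c\<close> of the field occurs, as the field of fractions is \<open>UNIV\<close>.\<close>

lemma carrier_Pic:
  assumes f: "f > 0"
  shows "carrier (Pic (qorder f)) = homothety_class ` {L. is_lattice L \<and> multiplier_ring L = qorder f}"
proof -
  have prod: "ideal_prod field_ring ((\<lambda>a. c * a) ` qorder f) L = (*) c ` L"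
    if L: "is_lattice L" "multiplier_ring L = qorder f" for L c
  proof
    show "ideal_prod field_ring ((\<lambda>a. c * a) ` qorder f) L \<subseteq> (*) c ` L"
    proof (rule ideal_prod_subsetI)
      fix i j assume "i \<in> (\<lambda>a. c * a) ` qorder f" "j \<in> L"
      then obtain r where r: "i = c * r" "r \<in> qorder f" by blast
      then have "r * j \<in> L" using \<open>j \<in> L\<close> L multiplier_ringD by blast
      then show "i * j \<in> (*) c ` L" unfolding r mult.assoc by blast
    next
      fix x y assume "x \<in> (*) c ` L" "y \<in> (*) c ` L"
      then obtain x' y' where "x = c * x'" "y = c * y'" "x' \<in> L" "y' \<in> L" by blast
      then show "x + y \<in> (*) c ` L" using lattice_module(2)[OF L(1)]
        by (auto simp flip: distrib_left)
    qed
    show "(*) c ` L \<subseteq> ideal_prod field_ring ((\<lambda>a. c * a) ` qorder f) L"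
    proof
      fix x assume "x \<in> (*) c ` L"
      then obtain y where y: "x = c * 1 * y" "y \<in> L" by auto
      show "x \<in> ideal_prod field_ring ((\<lambda>a. c * a) ` qorder f) L"
        unfolding y(1) using y(2) qorder_subring(2) by (intro ideal_prod_memI) auto
    qed
  qed
  have "carrier (Pic (qorder f)) =
     (\<lambda>L. \<Union>H\<in>principal_fractional_ideals (qorder f). {ideal_prod field_ring H L}) ` Units (fractional_ideal_monoid (qorder f))"
    by (auto simp: Pic_def FactGroup_def RCOSETS_def r_coset_def units_of_carrier units_of_mult)
      (auto simp: fractional_ideal_monoid_def)
  also have "\<dots> = homothety_class ` {L. is_lattice L \<and> multiplier_ring L = qorder f}"
    unfolding Units_fractional_ideal_monoid[OF f]
  proof (rule image_cong[OF refl])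
    fix L assume "L \<in> {L. is_lattice L \<and> multiplier_ring L = qorder f}"
    then show "(\<Union>H\<in>principal_fractional_ideals (qorder f). {ideal_prod field_ring H L}) = homothety_class L"
      unfolding principal_fractional_ideals_def homothety_class_def frac_field_qorder[OF f]
      using prod by fastforce
  qed
  finally show ?thesis .
qed

section \<open>Reduction of forms and finiteness of the Picard group\<close>

lemma primitive_form_shift:
  assumes "primitive_form t p q r"
  shows "primitive_form (t + of_int k) p (q - 2 * p * k) (p * k ^ 2 - q * k + r)"
proof -
  have t: "im t \<noteq> 0" and p0: "p \<noteq> 0" and g: "gcd p (gcd q r) = 1"
    and rel: "of_int p * (t * t) + of_int q * t + of_int r = 0"
    using assms unfolding primitive_form_def by auto
  define q' where "q' = q - 2 * p * k"
  define r' where "r' = p * k ^ 2 - q * k + r"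
  have "gcd p (gcd q' r') dvd p" "gcd p (gcd q' r') dvd q'" "gcd p (gcd q' r') dvd r'"
    by (meson gcd_dvd1 gcd_dvd2 dvd_trans)+
  moreover have qq: "q = q' + p * (2 * k)" "r = r' + q' * k + p * k ^ 2"
    by (auto simp: q'_def r'_def algebra_simps power2_eq_square)
  ultimately have "gcd p (gcd q' r') dvd q" "gcd p (gcd q' r') dvd r"
    by (simp_all only: qq) (intro dvd_add dvd_mult2; assumption)+
  then have "gcd p (gcd q' r') dvd gcd p (gcd q r)" using \<open>gcd p (gcd q' r') dvd p\<close> by simp
  then have g': "gcd p (gcd q' r') = 1" using g by simp
  have "of_int p * ((t + of_int k) * (t + of_int k)) + of_int q' * (t + of_int k) + of_int r'
     = of_int p * (t * t) + of_int q * t + of_int r"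
    by (simp add: q'_def r'_def algebra_simps power2_eq_square)
  then show ?thesis unfolding primitive_form_def using t p0 g' rel by (simp add: q'_def r'_def)
qed

lemma primitive_form_inverse:
  assumes "primitive_form t p q r"
  shows "primitive_form (inverse t) r q p \<and> t \<noteq> 0"
proof -
  have t: "im t \<noteq> 0" and p0: "p \<noteq> 0" and g: "gcd p (gcd q r) = 1"
    and rel: "of_int p * (t * t) + of_int q * t + of_int r = 0"
    using assms unfolding primitive_form_def by auto
  have t0: "t \<noteq> 0" using t by auto
  have "r \<noteq> 0"
  proof
    assume "r = 0"
    then have "t * (of_int p * t + of_int q) = 0" using rel by (simp add: algebra_simps)
    then have "of_int q + of_int p * t = of_int 0 + of_int 0 * t" using t0 by (simp add: add.commute)
    then have "q = 0 \<and> p = 0" by (rule im_neq_0_unique) (rule t)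
    then show False using p0 by simp
  qed
  moreover have "im (inverse t) \<noteq> 0"
  proof
    assume "im (inverse t) = 0"
    moreover have "im (t * inverse t) = 0" "re (t * inverse t) = 1" using t0 by simp_all
    ultimately show False using t by simp
  qed
  moreover have "of_int r * (inverse t * inverse t) + of_int q * inverse t + of_int p
      = inverse t * inverse t * (of_int p * (t * t) + of_int q * t + of_int r)"
    using t0 by (simp add: field_simps)
  moreover have "gcd r (gcd q p) = 1" using g by (simp add: gcd.commute gcd.left_commute)
  ultimately show ?thesis unfolding primitive_form_def rel using t0 by simp
qed

lemma zlat_inverse: "t \<noteq> 0 \<Longrightarrow> zlat 1 (inverse t) = (*) (inverse t) ` zlat 1 t"
  by (simp add: zlat_scale zlat_commute[of 1])

text \<open>The square of \<open>u = 2 p t + q\<close> is the discriminant of the form. On the other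
  hand \<open>u\<close> equals \<open>n * (2 * w - A)\<close>, where \<open>n\<close> is the index
  \<open>f\<close> up to sign, and \<open>2 * w - A\<close> squares to the discriminant of the
  field.\<close>

lemma primitive_form_discriminant:
  assumes "primitive_form t p q r" "multiplier_ring (zlat 1 t) = qorder f" "f > 0"
  shows "q ^ 2 - 4 * p * r = int f ^ 2 * (A ^ 2 + 4 * B)"
proof -
  have rel: "of_int p * (t * t) + of_int q * t + of_int r = 0"
    using assms(1) unfolding primitive_form_def by auto
  obtain m n where mn: "of_int p * t = of_int m + of_int n * w" "n \<noteq> 0"
    "multiplier_ring (zlat 1 t) = qorder (nat \<bar>n\<bar>)"
    using multiplier_ring_lattice_1_qorder[OF assms(1)] by blast
  have "card (a_rcosets\<^bsub>integer_ring\<^esub> (qorder f)) = card (a_rcosets\<^bsub>integer_ring\<^esub> (qorder (nat \<bar>n\<bar>)))"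
    using mn(3) assms(2) by simp
  then have "nat \<bar>n\<bar> = f" unfolding card_a_rcosets_qorder by simp
  then have n2: "n ^ 2 = int f ^ 2" by (metis abs_ge_zero int_nat_eq power2_abs)
  define u where "u = 2 * (of_int m + of_int n * w) + of_int q"
  have "u = 2 * (of_int p * t) + of_int q" unfolding u_def mn(1) ..
  then have "u * u = of_int (q ^ 2 - 4 * p * r) + 4 * of_int p * (of_int p * (t * t) + of_int q * t + of_int r)"
    by (simp add: algebra_simps power2_eq_square)
  then have uu: "u * u = of_int (q ^ 2 - 4 * p * r)" unfolding rel by simp
  have re_u: "re u = of_int (2 * m + q)" and im_u: "im u = of_int (2 * n)"
    using coords_simps(19,20)[of 2 "of_int m + of_int n * w"] coords_simps(15,16)[of 2]
    by (simp_all add: u_def)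
  have "im (u * u) = 0" unfolding uu by (simp only: coords_simps)
  \<comment> \<open>The square of \<open>u\<close> is rational although \<open>u\<close> is not, so
    the trace of \<open>u\<close> vanishes.\<close>
  then have "im u * (2 * re u + of_int A * im u) = 0" by (simp add: algebra_simps)
  then have "2 * re u + of_int A * im u = 0" using im_u mn(2) by simp
  then have reu: "re u = - of_int A * of_int n" using im_u by simp
  have "of_int (q ^ 2 - 4 * p * r) = re (u * u)" unfolding uu by (simp only: coords_simps)
  also have "\<dots> = (of_int (n ^ 2 * (A ^ 2 + 4 * B)) :: rat)"
    by (simp add: reu im_u algebra_simps power2_eq_square)
  finally have "q ^ 2 - 4 * p * r = n ^ 2 * (A ^ 2 + 4 * B)" by (simp only: of_int_eq_iff)
  then show ?thesis unfolding n2 .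
qed

text \<open>Gauss reduction: \<open>t\<close> is chosen in the homothety class so that \<open>\<bar>p\<bar>\<close> is minimal. Translating \<open>t\<close> reduces
  \<open>q\<close> modulo \<open>2 * p\<close>, and \<open>\<bar>p\<bar> \<le> \<bar>r\<bar>\<close> because inverting \<open>t\<close> exchanges \<open>p\<close> and \<open>r\<close>.\<close>

lemma reduced_form:
  assumes L: "is_lattice L" "multiplier_ring L = qorder f" and f: "f > 0"
  obtains t p q r c where "primitive_form t p q r" "c \<noteq> 0" "zlat 1 t = (*) c ` L" "\<bar>q\<bar> \<le> \<bar>p\<bar>" "\<bar>p\<bar> \<le> \<bar>r\<bar>"
proof -
  define P where "P k \<longleftrightarrow> (\<exists>t p q r c. primitive_form t p q r \<and> c \<noteq> 0 \<and> zlat 1 t = (*) c ` L \<and> k = nat \<bar>p\<bar>)" for k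
  obtain a b where ab: "det2 a b \<noteq> 0" "L = zlat a b" using L(1) unfolding is_lattice_def by blast
  note s = lattice_eq_scale[OF ab(1)]
  obtain p0 q0 r0 where "primitive_form (b / a) p0 q0 r0" using primitive_form_exists[of "b / a"] s by auto
  moreover have "zlat 1 (b / a) = (*) (inverse a) ` L" using s ab(2) scale_inverse by metis
  ultimately have "P (nat \<bar>p0\<bar>)" unfolding P_def using s by (metis inverse_zero_imp_zero)
  define k where "k = (LEAST k. P k)"
  have Pk: "P k" unfolding k_def using \<open>P (nat \<bar>p0\<bar>)\<close> by (rule LeastI)
  have min: "k \<le> j" if "P j" for j unfolding k_def using that by (rule Least_le)
  obtain t p q r c where t: "primitive_form t p q r" "c \<noteq> 0" "zlat 1 t = (*) c ` L" "k = nat \<bar>p\<bar>"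
    using Pk unfolding P_def by blast
  have p0: "p \<noteq> 0" using t(1) unfolding primitive_form_def by simp
  obtain i where i: "\<bar>q - 2 * p * i\<bar> \<le> \<bar>p\<bar>"
  proof -
    define m where "m = 2 * \<bar>p\<bar>"
    \<comment> \<open>Adding \<open>\<bar>p\<bar>\<close> before the reduction and subtracting it
      afterwards gives a remainder of \<open>q\<close> in the symmetric interval from
      \<open>- \<bar>p\<bar>\<close> to \<open>\<bar>p\<bar>\<close>.\<close>
    define x where "x = (q + \<bar>p\<bar>) mod m"
    have "m > 0" using p0 m_def by simp
    then have "0 \<le> x" "x < m" by (simp_all add: x_def)
    then have "\<bar>x - \<bar>p\<bar>\<bar> \<le> \<bar>p\<bar>" unfolding m_def by linarith
    moreover have "x - \<bar>p\<bar> = q - 2 * p * (sgn p * ((q + \<bar>p\<bar>) div m))"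
    proof -
      have "x = q + \<bar>p\<bar> - m * ((q + \<bar>p\<bar>) div m)" unfolding x_def by (simp add: minus_mult_div_eq_mod)
      moreover have "m = 2 * (p * sgn p)" by (simp add: m_def abs_sgn)
      ultimately show ?thesis by (simp add: mult_ac)
    qed
    ultimately show thesis using that by metis
  qed
  define t' q' r' where "t' = t + of_int i" and "q' = q - 2 * p * i" and "r' = p * i ^ 2 - q * i + r"
  have t': "primitive_form t' p q' r'" unfolding t'_def q'_def r'_def by (rule primitive_form_shift[OF t(1)])
  have lt': "zlat 1 t' = (*) c ` L" unfolding t(3)[symmetric] t'_def using zlat_shift[of 1 t i] by simp
  have inv: "primitive_form (inverse t') r' q' p" "t' \<noteq> 0" using primitive_form_inverse[OF t'] by auto
  have "zlat 1 (inverse t') = (*) (inverse t' * c) ` L"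
    using zlat_inverse[OF inv(2)] lt' by (simp add: scale_scale)
  then have "P (nat \<bar>r'\<bar>)" unfolding P_def using inv t(2)
    by (metis inverse_zero_imp_zero mult_eq_0_iff)
  then have "nat \<bar>p\<bar> \<le> nat \<bar>r'\<bar>" using min t(4) by simp
  then have "\<bar>p\<bar> \<le> \<bar>r'\<bar>" by simp
  moreover have "\<bar>q'\<bar> \<le> \<bar>p\<bar>" using i q'_def by simp
  ultimately show thesis using that t' t(2) lt' by blast
qed

text \<open>For a reduced form of discriminant \<open>D\<close> the bounds yield
  \<open>3 * (\<bar>p\<bar> * \<bar>r\<bar>) \<le> \<bar>D\<bar>\<close>, whatever the sign of
  \<open>D\<close>. So finitely many triples arise, each with finitely many roots, and a root
  \<open>t\<close> determines the class through \<open>zlat 1 t\<close>.\<close>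

lemma finite_Pic:
  assumes f: "f > 0"
  shows "finite (carrier (Pic (qorder f)))"
proof -
  define N where "N = int f ^ 2 * \<bar>A ^ 2 + 4 * B\<bar>"
  define T where "T = (\<Union>(p, q, r)\<in>({-N..N} - {0}) \<times> {-N..N} \<times> {-N..N}.
     {t :: 'a. of_int p * (t * t) + of_int q * t + of_int r = 0})"
  have "finite {t :: 'a. of_int p * (t * t) + of_int q * t + of_int r = 0}" if "p \<noteq> 0" for p q r :: int
  proof -
    have "[:of_int r, of_int q, of_int p:] \<noteq> (0 :: 'a poly)" using that by simp
    then have "finite {t :: 'a. poly [:of_int r, of_int q, of_int p:] t = 0}" by (rule poly_roots_finite)
    moreover have "poly [:of_int r, of_int q, of_int p:] t = of_int p * (t * t) + of_int q * t + of_int r" for t :: 'a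
      by (simp add: algebra_simps)
    ultimately show ?thesis by (simp only:)
  qed
  then have "finite T" unfolding T_def by (intro finite_UN_I) auto
  have "homothety_class L \<in> (\<lambda>t. homothety_class (zlat 1 t)) ` T"
    if L: "is_lattice L" "multiplier_ring L = qorder f" for L
  proof -
    obtain t p q r c where t: "primitive_form t p q r" "c \<noteq> 0" "zlat 1 t = (*) c ` L"
      and red: "\<bar>q\<bar> \<le> \<bar>p\<bar>" "\<bar>p\<bar> \<le> \<bar>r\<bar>"
      using reduced_form[OF L f] by blast
    have p0: "p \<noteq> 0" and rel: "of_int p * (t * t) + of_int q * t + of_int r = 0"
      using t(1) unfolding primitive_form_def by auto
    have "multiplier_ring (zlat 1 t) = qorder f" unfolding t(3) using L(2) t(2) by (simp add: multiplier_ring_scale)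
    then have D: "q ^ 2 - 4 * p * r = int f ^ 2 * (A ^ 2 + 4 * B)"
      using primitive_form_discriminant[OF t(1) _ f] by blast
    have "q ^ 2 \<le> \<bar>p\<bar> * \<bar>r\<bar>"
    proof -
      have "q ^ 2 = \<bar>q\<bar> * \<bar>q\<bar>" by (simp add: power2_eq_square)
      also have "\<dots> \<le> \<bar>p\<bar> * \<bar>r\<bar>" using red by (intro mult_mono) auto
      finally show ?thesis .
    qed
    moreover have "4 * (\<bar>p\<bar> * \<bar>r\<bar>) \<le> N + q ^ 2"
    proof -
      have "4 * (\<bar>p\<bar> * \<bar>r\<bar>) = \<bar>q ^ 2 - int f ^ 2 * (A ^ 2 + 4 * B)\<bar>"
        unfolding D[symmetric] by (simp add: abs_mult)
      also have "\<dots> \<le> q ^ 2 + N" unfolding N_def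
        by (rule order_trans[OF abs_triangle_ineq4]) (simp add: abs_mult)
      finally show ?thesis by simp
    qed
    ultimately have "3 * (\<bar>p\<bar> * \<bar>r\<bar>) \<le> N" by linarith
    moreover have "\<bar>r\<bar> \<le> \<bar>p\<bar> * \<bar>r\<bar>" using p0 mult_right_mono[of 1 "\<bar>p\<bar>" "\<bar>r\<bar>"] by simp
    ultimately have "\<bar>r\<bar> \<le> N" by linarith
    then have "(p, q, r) \<in> ({-N..N} - {0}) \<times> {-N..N} \<times> {-N..N}" using red p0 by auto
    then have "t \<in> T" unfolding T_def using rel by blast
    moreover have "homothety_class L = homothety_class (zlat 1 t)"
      unfolding t(3) using t(2) by (simp add: homothety_class_scale)
    ultimately show ?thesis by blast
  qed
  then have "carrier (Pic (qorder f)) \<subseteq> (\<lambda>t. homothety_class (zlat 1 t)) ` T"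
    unfolding carrier_Pic[OF f] by blast
  then show ?thesis using \<open>finite T\<close> finite_surj by blast
qed

end

section \<open>Generating pairs of a lattice\<close>

text \<open>The factor \<open>a\<close> collects the part of \<open>n\<close> at primes dividing
  \<open>g\<close>; repeatedly splitting off \<open>gcd n g\<close> produces it without
  factorisation.\<close>

lemma coprime_split:
  fixes n g :: nat
  assumes "n > 0"
  shows "\<exists>a b. n = a * b \<and> coprime b g \<and> (\<forall>x. coprime x g \<longrightarrow> coprime x a)"
  using assms
proof (induction n rule: less_induct)
  case (less n)
  show ?case
  proof (cases "coprime n g")
    case True
    then show ?thesis by (intro exI[of _ 1] exI[of _ n]) simp
  next
    case False
    define h where "h = gcd n g"
    have h: "h > 1" using False less.prems unfolding h_def
      by (metis coprime_iff_gcd_eq_1 gcd_nat.eq_neutr_iff less_one linorder_neqE_nat not_gr0)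
    obtain m where m: "n = h * m" unfolding h_def by (metis gcd_dvd1 dvdE)
    then have "m < n" "m > 0" using h less.prems by auto
    then obtain a b where ab: "m = a * b" "coprime b g" "\<And>x. coprime x g \<Longrightarrow> coprime x a"
      using less.IH by blast
    have "coprime x (h * a)" if "coprime x g" for x
    proof -
      have "coprime x h" using that unfolding h_def
        by (meson coprime_divisors dvd_refl gcd_dvd2)
      then show ?thesis using ab(3)[OF that] by simp
    qed
    then show ?thesis using ab m by (intro exI[of _ "h * a"] exI[of _ b]) (simp add: mult.assoc)
  qed
qed

text \<open>At primes of \<open>g\<close> the residue \<open>d\<close> already ensures coprimality;
  for the remaining part \<open>b\<close> of \<open>n\<close> the Chinese remainder theorem allows
  \<open>e = 1\<close> modulo \<open>b\<close>.\<close>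

lemma coprime_in_residue_class:
  fixes d g n :: nat
  assumes "coprime d g" "n > 0"
  obtains e :: nat where "[e = d] (mod g)" "coprime e n"
proof -
  obtain a b where ab: "n = a * b" "coprime b g" "\<And>x. coprime x g \<Longrightarrow> coprime x a"
    using coprime_split[OF assms(2)] by blast
  obtain e where e: "[e = d] (mod g)" "[e = 1] (mod b)"
    using binary_chinese_remainder_nat[of g b d 1] ab(2) by (auto simp: coprime_commute)
  have "coprime e g" using e(1) assms(1) by (metis cong_imp_coprime cong_sym)
  moreover have "coprime e b" using e(2) by (metis cong_imp_coprime cong_sym coprime_1_left)
  ultimately have "coprime e n" using ab by simp
  then show thesis using that e(1) by blast
qed

context quadratic_basis
begin

definition gen :: "nat \<Rightarrow> 'a \<Rightarrow> 'a \<Rightarrow> 'a set" where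
  "gen f r s = {x * r + y * s | x y. x \<in> qorder f \<and> y \<in> qorder f}"

lemma genI: "x \<in> qorder f \<Longrightarrow> y \<in> qorder f \<Longrightarrow> x * r + y * s \<in> gen f r s"
  unfolding gen_def by blast

lemma genE:
  assumes "z \<in> gen f r s"
  obtains x y where "x \<in> qorder f" "y \<in> qorder f" "z = x * r + y * s"
  using assms unfolding gen_def by blast

lemma gen_mem: "r \<in> gen f r s" "s \<in> gen f r s"
  using genI[of 1 f 0 r s] genI[of 0 f 1 r s] qorder_subring(1,2) by simp_all

lemma gen_scale: "gen f (c * r) (c * s) = (*) c ` gen f r s"
proof -
  have "x * (c * r) + y * (c * s) = c * (x * r + y * s)" for x y by (simp add: algebra_simps)
  then show ?thesis unfolding gen_def by (auto; metis)
qed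

lemma gen_closed:
  assumes "u \<in> gen f r s"
  shows "v \<in> gen f r s \<Longrightarrow> u + v \<in> gen f r s" "x \<in> qorder f \<Longrightarrow> x * u \<in> gen f r s"
proof -
  obtain a b where u: "u = a * r + b * s" "a \<in> qorder f" "b \<in> qorder f" using assms by (elim genE)
  have "x * u = (x * a) * r + (x * b) * s" by (simp add: u algebra_simps)
  then show "x \<in> qorder f \<Longrightarrow> x * u \<in> gen f r s" using u by (simp add: genI qorder_subring)
  assume "v \<in> gen f r s"
  then obtain c d where v: "v = c * r + d * s" "c \<in> qorder f" "d \<in> qorder f" by (elim genE)
  have "u + v = (a + c) * r + (b + d) * s" by (simp add: u v algebra_simps)
  then show "u + v \<in> gen f r s" using u v by (simp add: genI qorder_subring)
qed

lemma gen_subset: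
  assumes "r' \<in> gen f r s" "s' \<in> gen f r s"
  shows "gen f r' s' \<subseteq> gen f r s"
proof
  fix z assume "z \<in> gen f r' s'"
  then obtain x y where "x \<in> qorder f" "y \<in> qorder f" "z = x * r' + y * s'" by (elim genE)
  then show "z \<in> gen f r s" using assms by (simp add: gen_closed)
qed

lemma gen_is_lattice:
  assumes f: "f > 0" and "r \<noteq> 0 \<or> s \<noteq> 0"
  shows "is_lattice (gen f r s)"
proof -
  obtain d :: int where d: "d > 0" "of_int d * r \<in> qorder f" using denominator[OF f] by blast
  obtain e :: int where e: "e > 0" "of_int e * s \<in> qorder f" using denominator[OF f] by blast
  obtain z where z: "z \<in> gen f r s" "z \<noteq> 0" using assms(2) gen_mem by blast
  show ?thesis
  proof (rule qorder_module_is_lattice[OF f _ _ _ _ _ z])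
    show "0 \<in> gen f r s" using genI[of 0 f 0 r s] qorder_subring(1) by simp
    show "of_int (d * e) \<noteq> (0 :: 'a)" using d(1) e(1) by simp
    show "of_int (d * e) * x \<in> qorder f" if "x \<in> gen f r s" for x
    proof -
      obtain a b where ab: "a \<in> qorder f" "b \<in> qorder f" "x = a * r + b * s" using \<open>x \<in> gen f r s\<close> by (rule genE)
      then have "of_int (d * e) * x = of_int e * a * (of_int d * r) + of_int d * b * (of_int e * s)"
        by (simp add: algebra_simps)
      then show ?thesis using ab d e by (simp only: qorder_subring)
    qed
  qed (auto simp: gen_closed)
qed

lemma qorder_subset_iff:
  assumes "f > 0"
  shows "qorder f \<subseteq> qorder k \<longleftrightarrow> k dvd f"
proof
  assume "qorder f \<subseteq> qorder k"
  moreover have "of_nat f * w \<in> qorder f" unfolding qorder_def by (rule zlat_closed)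
  ultimately have "of_nat f * w \<in> qorder k" by blast
  then obtain n where "im (of_nat f * w) = of_int n * of_nat k" unfolding qorder_iff_coords by blast
  then have "(of_int (int f) :: rat) = of_int (n * int k)" by simp
  then have "int f = n * int k" by (simp only: of_int_eq_iff)
  then have "int k dvd int f" by simp
  then show "k dvd f" by (simp only: int_dvd_int_iff)
next
  assume "k dvd f"
  then obtain j where j: "f = k * j" by (elim dvdE)
  show "qorder f \<subseteq> qorder k"
  proof
    fix x assume "x \<in> qorder f"
    then obtain m n where "x = of_int m + of_int n * (of_nat f * w)" unfolding qorder_iff by blast
    then have "x = of_int m + of_int (n * int j) * (of_nat k * w)" by (simp add: j mult_ac)
    then show "x \<in> qorder k" unfolding qorder_iff by blast
  qed
qed

lemma qorder_inject: "qorder f = qorder k \<longleftrightarrow> f = k"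
  using card_a_rcosets_qorder by metis

lemma gen_multiplier_ring:
  assumes f: "f > 0" and "r \<noteq> 0 \<or> s \<noteq> 0"
  obtains k where "k dvd f" "multiplier_ring (gen f r s) = qorder k"
proof -
  obtain k where k: "k > 0" "multiplier_ring (gen f r s) = qorder k"
    using multiplier_ring_eq_qorder[OF gen_is_lattice[OF assms]] by blast
  have "qorder f \<subseteq> multiplier_ring (gen f r s)"
    unfolding multiplier_ring_def using gen_closed(2) by blast
  then have "k dvd f" using k qorder_subset_iff[OF f] by simp
  then show thesis using that k by blast
qed

lemma qorder_mult_iff:
  "x \<in> qorder (g * k) \<longleftrightarrow> (\<exists>(m :: int) y. y \<in> qorder k \<and> x = of_int m + of_nat g * y)"
proof
  assume "x \<in> qorder (g * k)"
  then obtain m n where "x = of_int m + of_int n * (of_nat (g * k) * w)" unfolding qorder_iff by blast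
  then have "x = of_int m + of_nat g * (of_int 0 + of_int n * (of_nat k * w))" by (simp add: mult_ac)
  then show "\<exists>(m :: int) y. y \<in> qorder k \<and> x = of_int m + of_nat g * y" unfolding qorder_iff by blast
next
  assume "\<exists>(m :: int) y. y \<in> qorder k \<and> x = of_int m + of_nat g * y"
  then obtain m y where y: "y \<in> qorder k" "x = of_int m + of_nat g * y" by blast
  then obtain i j where "y = of_int i + of_int j * (of_nat k * w)" unfolding qorder_iff by blast
  then have "x = of_int (m + int g * i) + of_int j * (of_nat (g * k) * w)" using y by (simp add: algebra_simps)
  then show "x \<in> qorder (g * k)" unfolding qorder_iff by blast
qed

lemma det2_add_multiple:
  assumes "u \<in> zlat a b" "v \<in> zlat a b" "i \<in> zlat a b" "j \<in> zlat a b"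
  obtains k :: int where
    "det2 (u + of_nat g * i) (v + of_nat g * j) = det2 u v + of_int (int g * k) * det2 a b"
proof -
  obtain k1 :: int where 1: "det2 i v = of_int k1 * det2 a b" using assms det2_lattice by blast
  obtain k2 :: int where 2: "det2 u j = of_int k2 * det2 a b" using assms det2_lattice by blast
  obtain k3 :: int where 3: "det2 i j = of_int k3 * det2 a b" using assms det2_lattice by blast
  have "det2 (u + of_nat g * i) (v + of_nat g * j)
     = det2 u v + of_nat g * det2 i v + of_nat g * det2 u j + of_nat g * of_nat g * det2 i j"
    by (simp add: det2_def algebra_simps)
  also have "\<dots> = det2 u v + of_int (int g * (k1 + k2 + int g * k3)) * det2 a b"
    unfolding 1 2 3 by (simp add: algebra_simps)
  finally show thesis by (rule that)
qed

text \<open>Both the invariance and the completeness of the residue of \<open>det2 r s / det2 a b\<close> modulo \<open>g\<close> rest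
  on the next lemma: elements of \<open>qorder (g * k)\<close> are integers modulo \<open>g\<close> times \<open>qorder k\<close>.\<close>

lemma det2_qorder_comb:
  assumes L: "multiplier_ring (zlat a b) = qorder k" and r: "r \<in> zlat a b" and s: "s \<in> zlat a b"
    and x: "x \<in> qorder (g * k)" "y \<in> qorder (g * k)" "z \<in> qorder (g * k)" "t \<in> qorder (g * k)"
  obtains (comb) m i :: int and e where "e \<in> qorder k" "x * t - y * z = of_int m + of_nat g * e"
    "det2 (x * r + y * s) (z * r + t * s) = of_int m * det2 r s + of_int (int g * i) * det2 a b"
proof -
  obtain x0 x1 where x0: "x1 \<in> qorder k" "x = of_int x0 + of_nat g * x1" using x(1) unfolding qorder_mult_iff by blast
  obtain y0 y1 where y0: "y1 \<in> qorder k" "y = of_int y0 + of_nat g * y1" using x(2) unfolding qorder_mult_iff by blast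
  obtain z0 z1 where z0: "z1 \<in> qorder k" "z = of_int z0 + of_nat g * z1" using x(3) unfolding qorder_mult_iff by blast
  obtain t0 t1 where t0: "t1 \<in> qorder k" "t = of_int t0 + of_nat g * t1" using x(4) unfolding qorder_mult_iff by blast
  define e where "e = of_int x0 * t1 + x1 * t - of_int y0 * z1 - y1 * z"
  have k: "qorder (g * k) \<subseteq> qorder k"
    using qorder_mult_iff qorder_subring(3,5,7) by (metis of_int_of_nat_eq subsetI)
  have e: "e \<in> qorder k" unfolding e_def using x0 y0 z0 t0 k x by (intro qorder_subring(5-7)) (auto simp: qorder_subring(3))
  have "x * t - y * z = of_int (x0 * t0 - y0 * z0) + of_nat g * e"
    by (simp add: e_def x0 y0 z0 t0 algebra_simps)
  moreover have mem: "c * r + d * s \<in> zlat a b" if "c \<in> qorder k" "d \<in> qorder k" for c d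
    using that r s L by (metis multiplier_ringD zlat_closed(4))
  have "of_int x0 * r + of_int y0 * s \<in> zlat a b" "of_int z0 * r + of_int t0 * s \<in> zlat a b"
    using r s by (simp_all only: zlat_closed)
  from det2_add_multiple[OF this mem[OF x0(1) y0(1)] mem[OF z0(1) t0(1)], of g]
  obtain i :: int where "det2 (of_int x0 * r + of_int y0 * s + of_nat g * (x1 * r + y1 * s))
      (of_int z0 * r + of_int t0 * s + of_nat g * (z1 * r + t1 * s))
     = det2 (of_int x0 * r + of_int y0 * s) (of_int z0 * r + of_int t0 * s) + of_int (int g * i) * det2 a b"
    by blast
  moreover have "of_int x0 * r + of_int y0 * s + of_nat g * (x1 * r + y1 * s) = x * r + y * s"
    "of_int z0 * r + of_int t0 * s + of_nat g * (z1 * r + t1 * s) = z * r + t * s"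
    by (simp_all add: x0 y0 z0 t0 algebra_simps)
  ultimately show thesis using comb[OF e, of "x0 * t0 - y0 * z0" i] by (simp add: det2_comb_int)
qed

text \<open>Turns an equation \<open>1 = m + g e\<close> for the determinant of a matrix into the
  congruence \<open>m = 1\<close> modulo \<open>g\<close>.\<close>

lemma of_int_eq_multiple:
  assumes "of_int m = of_nat g * e" "e \<in> qorder k"
  shows "int g dvd m"
proof -
  obtain i j where e: "e = of_int i + of_int j * (of_nat k * w)" using assms(2) unfolding qorder_iff by blast
  have "re (of_int m) = re (of_nat g * e)" using assms(1) by simp
  then have "(of_int m :: rat) = of_int (int g * i)" by (simp add: e)
  then have "m = int g * i" by (simp only: of_int_eq_iff)
  then show ?thesis by simp
qed

text \<open>The matrix expressing \<open>a, b\<close> through \<open>r, s\<close> has a determinant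
  that is an integer \<open>m\<close> modulo \<open>g\<close> times \<open>qorder k\<close>, and
  this \<open>m\<close> inverts \<open>n\<close> modulo \<open>g\<close>.\<close>

lemma coprime_det2:
  assumes ab: "det2 a b \<noteq> 0" and L: "multiplier_ring (zlat a b) = qorder k"
    and gen: "gen (g * k) r s = zlat a b" and det: "det2 r s = of_int n * det2 a b"
  shows "coprime n (int g)"
proof -
  have rs: "r \<in> zlat a b" "s \<in> zlat a b" using gen_mem gen by blast+
  have "a \<in> gen (g * k) r s" "b \<in> gen (g * k) r s" unfolding gen by (rule zlat_closed)+
  then obtain x y z t where x: "x \<in> qorder (g * k)" "y \<in> qorder (g * k)" "z \<in> qorder (g * k)" "t \<in> qorder (g * k)"
    and eq: "a = x * r + y * s" "b = z * r + t * s" by (elim genE) blast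
  from det2_qorder_comb[OF L rs x] obtain m i :: int
    where "det2 (x * r + y * s) (z * r + t * s) = of_int m * det2 r s + of_int (int g * i) * det2 a b" by blast
  then have "det2 a b = of_int (m * n + int g * i) * det2 a b"
    unfolding eq[symmetric] det by (simp add: algebra_simps)
  then have "(of_int (m * n + int g * i) :: rat) = of_int 1" using ab by simp
  then have "m * n + int g * i = 1" by (simp only: of_int_eq_iff)
  then show ?thesis by (metis coprime_iff_gcd_eq_1 mult.commute gcd_add_mult coprime_def dvd_add dvd_mult dvd_mult2)
qed

text \<open>The pair is a column acted on from the left, which is the transpose of the action on row
  vectors in \<open>cusps\<close>; \<open>unimodular_equiv_iff_SL2\<close> translates.\<close>

definition unimodular_equiv :: "nat \<Rightarrow> 'a \<Rightarrow> 'a \<Rightarrow> 'a \<Rightarrow> 'a \<Rightarrow> bool" where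
  "unimodular_equiv f r s r' s' \<longleftrightarrow>
     (\<exists>x\<in>qorder f. \<exists>y\<in>qorder f. \<exists>z\<in>qorder f. \<exists>t\<in>qorder f.
        x * t - y * z = 1 \<and> r' = x * r + y * s \<and> s' = z * r + t * s)"

lemma unimodular_equiv_refl: "unimodular_equiv f r s r s"
  unfolding unimodular_equiv_def using qorder_subring(1,2)
  by (intro bexI[of _ 1] bexI[of _ 0]) simp_all

lemma unimodular_equiv_sym:
  assumes "unimodular_equiv f r s r' s'"
  shows "unimodular_equiv f r' s' r s"
proof -
  obtain x y z t where x: "x \<in> qorder f" "y \<in> qorder f" "z \<in> qorder f" "t \<in> qorder f"
    and det: "x * t - y * z = 1" and eq: "r' = x * r + y * s" "s' = z * r + t * s"
    using assms unfolding unimodular_equiv_def by blast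
  have "t * r' + (- y) * s' = (x * t - y * z) * r" "(- z) * r' + x * s' = (x * t - y * z) * s"
    by (simp_all add: eq algebra_simps)
  then have "r = t * r' + (- y) * s'" "s = (- z) * r' + x * s'" unfolding det by simp_all
  moreover have "t * x - (- y) * (- z) = 1" using det by (simp add: mult.commute)
  ultimately show ?thesis unfolding unimodular_equiv_def using x qorder_subring(4) by blast
qed

lemma unimodular_equiv_trans:
  assumes "unimodular_equiv f r s r' s'" "unimodular_equiv f r' s' r'' s''"
  shows "unimodular_equiv f r s r'' s''"
proof -
  obtain x y z t where x: "x \<in> qorder f" "y \<in> qorder f" "z \<in> qorder f" "t \<in> qorder f"
    and det: "x * t - y * z = 1" and eq: "r' = x * r + y * s" "s' = z * r + t * s"
    using assms(1) unfolding unimodular_equiv_def by blast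
  obtain x' y' z' t' where x': "x' \<in> qorder f" "y' \<in> qorder f" "z' \<in> qorder f" "t' \<in> qorder f"
    and det': "x' * t' - y' * z' = 1" and eq': "r'' = x' * r' + y' * s'" "s'' = z' * r' + t' * s'"
    using assms(2) unfolding unimodular_equiv_def by blast
  have "(x' * x + y' * z) * (z' * y + t' * t) - (x' * y + y' * t) * (z' * x + t' * z)
      = (x' * t' - y' * z') * (x * t - y * z)" by (simp add: algebra_simps)
  then have "(x' * x + y' * z) * (z' * y + t' * t) - (x' * y + y' * t) * (z' * x + t' * z) = 1"
    unfolding det det' by simp
  moreover have "r'' = (x' * x + y' * z) * r + (x' * y + y' * t) * s"
    "s'' = (z' * x + t' * z) * r + (z' * y + t' * t) * s" by (simp_all add: eq eq' algebra_simps)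
  moreover have "x' * x + y' * z \<in> qorder f" "x' * y + y' * t \<in> qorder f"
    "z' * x + t' * z \<in> qorder f" "z' * y + t' * t \<in> qorder f"
    using x x' by (simp_all only: qorder_subring)
  ultimately show ?thesis unfolding unimodular_equiv_def by blast
qed

lemma unimodular_equiv_scale:
  assumes "unimodular_equiv f r s r' s'"
  shows "unimodular_equiv f (c * r) (c * s) (c * r') (c * s')"
proof -
  obtain x y z t where x: "x \<in> qorder f" "y \<in> qorder f" "z \<in> qorder f" "t \<in> qorder f"
    and det: "x * t - y * z = 1" and eq: "r' = x * r + y * s" "s' = z * r + t * s"
    using assms unfolding unimodular_equiv_def by blast
  have "c * r' = x * (c * r) + y * (c * s)" "c * s' = z * (c * r) + t * (c * s)"
    by (simp_all add: eq algebra_simps)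
  then show ?thesis unfolding unimodular_equiv_def using x det by blast
qed

lemma unimodular_equiv_gen:
  assumes "unimodular_equiv f r s r' s'"
  shows "gen f r' s' = gen f r s"
proof -
  have "gen f r' s' \<subseteq> gen f r s" if "unimodular_equiv f r s r' s'" for r s r' s'
  proof (rule gen_subset)
    show "r' \<in> gen f r s" "s' \<in> gen f r s"
      using that genI unfolding unimodular_equiv_def by blast+
  qed
  then show ?thesis using assms unimodular_equiv_sym by blast
qed

text \<open>For a matrix of determinant 1, the integer \<open>m\<close> of
  \<open>det2_qorder_comb\<close> is 1 modulo \<open>g\<close>, so the residue of \<open>n\<close>
  is preserved.\<close>

lemma unimodular_equiv_det2:
  assumes L: "multiplier_ring (zlat a b) = qorder k" and gen: "gen (g * k) r s = zlat a b"
    and det: "det2 r s = of_int n * det2 a b" and eqv: "unimodular_equiv (g * k) r s r' s'"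
  shows "\<exists>n'. det2 r' s' = of_int n' * det2 a b \<and> [n' = n] (mod int g)"
proof -
  have rs: "r \<in> zlat a b" "s \<in> zlat a b" using gen_mem gen by blast+
  obtain x y z t where x: "x \<in> qorder (g * k)" "y \<in> qorder (g * k)" "z \<in> qorder (g * k)" "t \<in> qorder (g * k)"
    and d: "x * t - y * z = 1" and eq: "r' = x * r + y * s" "s' = z * r + t * s"
    using eqv unfolding unimodular_equiv_def by blast
  from det2_qorder_comb[OF L rs x] obtain m i :: int and e where e: "e \<in> qorder k"
    "x * t - y * z = of_int m + of_nat g * e"
    "det2 (x * r + y * s) (z * r + t * s) = of_int m * det2 r s + of_int (int g * i) * det2 a b" by blast
  have "of_int (1 - m) = of_nat g * e" using e(2) unfolding d by (simp add: algebra_simps)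
  then have "int g dvd 1 - m" using e(1) by (rule of_int_eq_multiple)
  then obtain j where j: "1 - m = int g * j" by (elim dvdE)
  have "det2 r' s' = of_int (m * n + int g * i) * det2 a b"
    using e(3) unfolding eq det by (simp add: algebra_simps)
  moreover have "m * n + int g * i - n = - (1 - m) * n + int g * i" by (simp add: algebra_simps)
  then have "m * n + int g * i - n = int g * (i - j * n)" unfolding j by (simp add: algebra_simps)
  then have "[m * n + int g * i = n] (mod int g)" by (simp add: cong_iff_dvd_diff)
  ultimately show ?thesis by blast
qed

text \<open>Writing \<open>a, b\<close> in terms of \<open>r, s\<close> carries the relation of
  \<open>lattice_inverse\<close> over to any pair of generators over
  \<open>qorder k\<close>.\<close>

lemma gen_eq_lattice_inverse:
  assumes ab: "det2 a b \<noteq> 0" and L: "multiplier_ring (zlat a b) = qorder k"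
    and gen: "gen k r s = zlat a b"
  obtains p q where "p * r + q * s = 1" "\<And>x. x \<in> zlat a b \<Longrightarrow> p * x \<in> qorder k \<and> q * x \<in> qorder k"
proof -
  obtain u v where uv: "u * a + v * b = 1"
    "\<And>x. x \<in> zlat a b \<Longrightarrow> u * x \<in> multiplier_ring (zlat a b) \<and> v * x \<in> multiplier_ring (zlat a b)"
    using lattice_inverse[OF ab] by blast
  have "a \<in> gen k r s" "b \<in> gen k r s" unfolding gen by (rule zlat_closed)+
  then obtain x y z t where x: "x \<in> qorder k" "y \<in> qorder k" "z \<in> qorder k" "t \<in> qorder k"
    and eq: "a = x * r + y * s" "b = z * r + t * s" by (elim genE) blast
  have "(u * x + v * z) * r + (u * y + v * t) * s = 1"
    using uv(1) unfolding eq by (simp add: algebra_simps)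
  moreover have "(u * x + v * z) * h \<in> qorder k \<and> (u * y + v * t) * h \<in> qorder k" if "h \<in> zlat a b" for h
  proof -
    have uvh: "u * h \<in> qorder k" "v * h \<in> qorder k" using uv(2)[OF that] L by auto
    have "(u * x + v * z) * h = x * (u * h) + z * (v * h)" "(u * y + v * t) * h = y * (u * h) + t * (v * h)"
      by (simp_all add: algebra_simps)
    then show ?thesis using uvh x by (simp only: qorder_subring simp_thms)
  qed
  ultimately show thesis using that by blast
qed

text \<open>A matrix over \<open>qorder (g * k)\<close> taking \<open>(r, s)\<close> to \<open>(r', s')\<close> may be altered by adding multiples
  of \<open>(- s, r)\<close> to its columns. Adding \<open>t\<^sub>1\<close> and \<open>t\<^sub>2\<close> times this vector changes the determinant by
  \<open>t\<^sub>2 * r' - t\<^sub>1 * s'\<close>, and invertibility of the lattice lets this take any value in \<open>g\<close> times \<open>qorder k\<close>.\<close>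

lemma unimodular_equivI_det2:
  assumes ab: "det2 a b \<noteq> 0" and L: "multiplier_ring (zlat a b) = qorder k" and pos: "g * k > 0"
    and gen: "gen (g * k) r s = zlat a b" and gen': "gen (g * k) r' s' = zlat a b"
    and det: "det2 r s = of_int n * det2 a b" and det': "det2 r' s' = of_int n' * det2 a b"
    and cong: "[n' = n] (mod int g)"
  shows "unimodular_equiv (g * k) r s r' s'"
proof -
  have rs: "r \<in> zlat a b" "s \<in> zlat a b" using gen_mem gen by blast+
  have "r' \<in> gen (g * k) r s" "s' \<in> gen (g * k) r s" using gen_mem gen gen' by blast+
  then obtain x y z t where x: "x \<in> qorder (g * k)" "y \<in> qorder (g * k)" "z \<in> qorder (g * k)" "t \<in> qorder (g * k)"
    and eq: "r' = x * r + y * s" "s' = z * r + t * s" by (elim genE) blast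
  from det2_qorder_comb[OF L rs x] obtain m i :: int and e where e: "e \<in> qorder k"
    "x * t - y * z = of_int m + of_nat g * e"
    "det2 (x * r + y * s) (z * r + t * s) = of_int m * det2 r s + of_int (int g * i) * det2 a b" by blast
  have "of_int n' * det2 a b = of_int (m * n + int g * i) * det2 a b"
    using e(3) unfolding eq[symmetric] det det' by (simp add: algebra_simps)
  then have "(of_int n' :: rat) = of_int (m * n + int g * i)" using ab by simp
  then have n': "n' = m * n + int g * i" by (simp only: of_int_eq_iff)
  have "int g dvd n' - n" using cong by (simp add: cong_iff_dvd_diff)
  then have "int g dvd (n' - n) - int g * i" by simp
  also have "(n' - n) - int g * i = (m - 1) * n" by (simp add: n' algebra_simps)
  \<comment> \<open>As \<open>n\<close> is a unit modulo \<open>g\<close>, it can be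
    cancelled.\<close>
  finally have "int g dvd m - 1"
    using coprime_det2[OF ab L gen det] by (metis coprime_commute coprime_dvd_mult_left_iff)
  then obtain j where j: "m - 1 = int g * j" by (elim dvdE)
  define h where "h = e + of_int j"
  have h: "h \<in> qorder k" unfolding h_def using e(1) by (simp only: qorder_subring)
  have "of_int m = 1 + of_nat g * (of_int j :: 'a)" using j
    by (metis add.commute diff_add_cancel of_int_1 of_int_add of_int_mult of_int_of_nat_eq)
  then have D: "x * t - y * z = 1 + of_nat g * h"
    unfolding e(2) h_def by (simp add: algebra_simps)
  have sub: "qorder (g * k) \<subseteq> qorder k" using qorder_subset_iff[OF pos] by simp
  \<comment> \<open>The lattice is a module over the larger order \<open>qorder k\<close>, so
    \<open>r', s'\<close> generate it over that order too, where an inverse is available.\<close>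
  have gen_k: "gen k r' s' = zlat a b"
  proof
    show "zlat a b \<subseteq> gen k r' s'" using sub unfolding gen'[symmetric] gen_def by blast
    have "r' \<in> zlat a b" "s' \<in> zlat a b" using gen_mem gen' by blast+
    then show "gen k r' s' \<subseteq> zlat a b" unfolding gen_def L[symmetric]
      by (auto intro!: zlat_closed(4) multiplier_ringD)
  qed
  obtain p q where pq: "p * r' + q * s' = 1" "\<And>x. x \<in> zlat a b \<Longrightarrow> p * x \<in> qorder k \<and> q * x \<in> qorder k"
    by (rule gen_eq_lattice_inverse[OF ab L gen_k]) blast
  \<comment> \<open>With these factors the determinant changes by
    \<open>- g h (p r' + q s') = - g h\<close>, which cancels its excess over 1.\<close>
  define t1 where "t1 = of_nat g * h * q"
  define t2 where "t2 = - (of_nat g * h * p)"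
  have mem: "of_nat g * u \<in> qorder (g * k)" if "u \<in> qorder k" for u
    unfolding qorder_mult_iff using that by (intro exI[of _ 0] exI[of _ u]) simp
  have T: "t1 * u \<in> qorder (g * k)" "t2 * u \<in> qorder (g * k)" if u: "u \<in> zlat a b" for u
  proof -
    have "t1 * u = of_nat g * (h * (q * u))" "t2 * u = of_nat g * - (h * (p * u))"
      by (simp_all add: t1_def t2_def mult_ac)
    moreover have "h * (q * u) \<in> qorder k" "- (h * (p * u)) \<in> qorder k"
      using h pq(2)[OF u] by (simp_all only: qorder_subring)
    ultimately show "t1 * u \<in> qorder (g * k)" "t2 * u \<in> qorder (g * k)" by (simp_all only: mem)
  qed
  define x' y' z' t' where "x' = x - t1 * s" and "y' = y + t1 * r" and "z' = z - t2 * s" and "t' = t + t2 * r"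
  have "x' \<in> qorder (g * k)" "y' \<in> qorder (g * k)" "z' \<in> qorder (g * k)" "t' \<in> qorder (g * k)"
    unfolding x'_def y'_def z'_def t'_def using x T rs by (simp_all only: qorder_subring)
  moreover have "r' = x' * r + y' * s" "s' = z' * r + t' * s"
    by (simp_all add: eq x'_def y'_def z'_def t'_def algebra_simps)
  moreover have "x' * t' - y' * z' = (x * t - y * z) + t2 * r' - t1 * s'"
    by (simp add: eq x'_def y'_def z'_def t'_def algebra_simps)
  then have "x' * t' - y' * z' = 1 + of_nat g * h - of_nat g * h * (p * r' + q * s')"
    unfolding D t1_def t2_def by (simp add: algebra_simps)
  then have "x' * t' - y' * z' = 1" unfolding pq(1) by simp
  ultimately show ?thesis unfolding unimodular_equiv_def by blast
qed

text \<open>The pair is \<open>a, e b\<close>, of determinant \<open>e\<close>. Taking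
  \<open>e\<close> coprime to an \<open>l\<close> with \<open>l b\<close> in \<open>qorder k\<close>
  times \<open>a\<close> makes the pair generate the lattice over \<open>qorder k\<close>. To
  descend to \<open>qorder (g * k)\<close>, an element \<open>u\<close> is combined from
  \<open>e u\<close>, an integer combination of the pair, and \<open>g u\<close>, whose coefficients
  lie in \<open>g\<close> times \<open>qorder k\<close>.\<close>

lemma exists_gen_with_det2:
  assumes ab: "det2 a b \<noteq> 0" and L: "multiplier_ring (zlat a b) = qorder k" and k: "k > 0"
    and d: "coprime d g"
  obtains r s and n :: int where "gen (g * k) r s = zlat a b" "det2 r s = of_int n * det2 a b" "[n = int d] (mod int g)"
proof -
  have a0: "a \<noteq> 0" using ab by (auto simp: det2_def)
  obtain l :: int where l: "l > 0" "of_int l * (b / a) \<in> qorder k" using denominator[OF k] by blast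
  obtain e where e: "[e = d] (mod g)" "coprime e (nat l)"
    using coprime_in_residue_class[OF d, of "nat l"] l(1) by auto
  have eg: "coprime e g" using e(1) d by (metis cong_imp_coprime cong_sym)
  define s where "s = of_nat e * b"
  have s: "s \<in> zlat a b" unfolding s_def using zlat_closed(6)[OF zlat_closed(3), of "int e"] by simp
  have gen_k: "\<exists>x\<in>qorder k. \<exists>y\<in>qorder k. u = x * a + y * s" if u: "u \<in> zlat a b" for u
  proof -
    obtain c1 c2 where "c1 * int e + c2 * l = gcd (int e) l" using bezout_int by blast
    moreover have "gcd (int e) l = 1" using e(2) l(1)
      by (metis coprime_iff_gcd_eq_1 coprime_int_iff int_nat_eq less_imp_le nat_0_le)
    ultimately have c: "c1 * int e + c2 * l = 1" by simp
    obtain m n where u: "u = of_int m * a + of_int n * b" using u by (auto simp: zlat_def)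
    define v where "v = of_int l * (b / a)"
    have va: "v * a = of_int l * b" using a0 by (simp add: v_def)
    have "of_int c1 * s + of_int c2 * (v * a) = of_int (c1 * int e + c2 * l) * b"
      unfolding va by (simp add: s_def algebra_simps)
    then have b: "of_int c1 * s + of_int c2 * (v * a) = b" unfolding c by simp
    have "u = of_int m * a + of_int n * (of_int c1 * s + of_int c2 * (v * a))"
      unfolding b by (rule u)
    then have "u = (of_int m + of_int n * (of_int c2 * v)) * a + (of_int n * of_int c1) * s"
      by (simp add: algebra_simps)
    moreover have "of_int m + of_int n * (of_int c2 * v) \<in> qorder k" "of_int n * of_int c1 \<in> qorder k"
      using l(2) by (simp_all only: v_def qorder_subring)
    ultimately show ?thesis by blast
  qed
  have "gen (g * k) a s = zlat a b"
  proof
    show "gen (g * k) a s \<subseteq> zlat a b"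
    proof
      fix z assume "z \<in> gen (g * k) a s"
      then obtain x y where xy: "x \<in> qorder (g * k)" "y \<in> qorder (g * k)" "z = x * a + y * s" by (elim genE)
      have "qorder (g * k) \<subseteq> qorder k"
        using qorder_mult_iff qorder_subring(3,5,7) by (metis of_int_of_nat_eq subsetI)
      then have "x \<in> multiplier_ring (zlat a b)" "y \<in> multiplier_ring (zlat a b)" using xy L by auto
      then show "z \<in> zlat a b" unfolding xy(3) using s by (intro zlat_closed(4) multiplier_ringD) (auto simp: zlat_closed(2))
    qed
    show "zlat a b \<subseteq> gen (g * k) a s"
    proof
      fix u assume u: "u \<in> zlat a b"
      obtain c1 c2 where "c1 * int e + c2 * int g = gcd (int e) (int g)" using bezout_int by blast
      moreover have "gcd (int e) (int g) = 1" using eg by (simp add: coprime_iff_gcd_eq_1)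
      ultimately have c: "c1 * int e + c2 * int g = 1" by simp
      obtain m n where mn: "u = of_int m * a + of_int n * b" using u by (auto simp: zlat_def)
      obtain x y where xy: "x \<in> qorder k" "y \<in> qorder k" "u = x * a + y * s" using gen_k[OF u] by blast
      have "u = of_int (c1 * int e + c2 * int g) * u" unfolding c by simp
      also have "\<dots> = of_int c1 * (of_int (int e) * u) + of_int c2 * (of_nat g * u)" by (simp add: algebra_simps)
      also have "of_int (int e) * u = of_int (int e * m) * a + of_int n * s" by (simp add: mn s_def algebra_simps)
      also have "of_nat g * u = (of_nat g * x) * a + (of_nat g * y) * s" by (simp add: xy(3) algebra_simps)
      finally have eq: "u = of_int c1 * (of_int (int e * m) * a + of_int n * s) + of_int c2 * ((of_nat g * x) * a + (of_nat g * y) * s)" .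
      have "of_nat g * v \<in> qorder (g * k)" if "v \<in> qorder k" for v
        unfolding qorder_mult_iff using that by (intro exI[of _ 0] exI[of _ v]) simp
      then show "u \<in> gen (g * k) a s" using xy(1,2) by (subst eq) (intro gen_closed genI qorder_subring(3); simp)
    qed
  qed
  moreover have "det2 a s = of_int (int e) * det2 a b"
    using det2_comb_int[of 1 a 0 b 0 "int e"] by (simp add: s_def)
  moreover have "[int e = int d] (mod int g)" using e(1) by (simp add: cong_int_iff)
  ultimately show thesis using that by blast
qed

end

section \<open>Cusps\<close>

lemma cong_totatives:
  assumes "x \<in> totatives g" "y \<in> totatives g"
  shows "[int x = int y] (mod int g) \<longleftrightarrow> x = y"
    and "[int x = - int y] (mod int g) \<longleftrightarrow> g dvd x + y"
proof -
  have x: "0 < x" "x \<le> g" "0 < y" "y \<le> g" using assms by (auto simp: totatives_def)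
  show "[int x = int y] (mod int g) \<longleftrightarrow> x = y"
  proof
    assume "[int x = int y] (mod int g)"
    then have "int g dvd int x - int y" by (simp add: cong_iff_dvd_diff)
    moreover have "\<bar>int x - int y\<bar> < int g" using x by linarith
    ultimately show "x = y" using dvd_imp_le_int[of "int x - int y" "int g"] by (cases "x = y") auto
  qed simp
  have "[int x = - int y] (mod int g) \<longleftrightarrow> int g dvd int (x + y)" by (simp add: cong_iff_dvd_diff)
  then show "[int x = - int y] (mod int g) \<longleftrightarrow> g dvd x + y" by (simp only: int_dvd_int_iff)
qed

text \<open>The two elements are \<open>x\<close> and \<open>g - x\<close>. If they coincided,
  \<open>x\<close> would be both a divisor of \<open>g = 2 * x\<close> and coprime to it, so
  \<open>g\<close> would be 2.\<close>

lemma totatives_negatives: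
  assumes "g > 2" "x \<in> totatives g"
  shows "card {y \<in> totatives g. y = x \<or> g dvd x + y} = 2"
proof -
  have x: "0 < x" "x < g" "coprime x g" using assms totatives_less[of x g] by (auto simp: totatives_def)
  have "y = g - x" if "y \<in> totatives g" "g dvd x + y" for y
  proof -
    have y: "0 < y" "y < g" using that assms totatives_less[of y g] by (auto simp: totatives_def)
    obtain j where "x + y = g * j" using \<open>g dvd x + y\<close> by (elim dvdE)
    moreover have "0 < x + y" "x + y < g * 2" using x y by auto
    ultimately have "0 < j" "j < 2" by (auto intro: gr0I)
    then have "j = 1" by simp
    then show ?thesis using \<open>x + y = g * j\<close> by simp
  qed
  moreover have "coprime (g - x) g"
  proof (rule coprimeI)
    fix c assume c: "c dvd g - x" "c dvd g"
    then have "c dvd x" using x(2) by (intro dvd_diffD1[of c g x]) auto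
    then show "is_unit c" using c(2) x(3) coprime_common_divisor by blast
  qed
  then have "g - x \<in> totatives g" "g dvd x + (g - x)" using x by (auto simp: totatives_def)
  ultimately have "{y \<in> totatives g. y = x \<or> g dvd x + y} = {x, g - x}" using assms(2) by blast
  moreover have "x \<noteq> g - x"
  proof
    assume "x = g - x"
    then have "g = 2 * x" using x by simp
    then have "x dvd g" by simp
    then have "is_unit x" using x(3) by (metis coprime_absorb_left)
    then show False using \<open>g = 2 * x\<close> assms(1) by simp
  qed
  ultimately show ?thesis by simp
qed

section \<open>The projective line in homogeneous coordinates\<close>

definition row :: "'a :: field_char_0 \<Rightarrow> 'a \<Rightarrow> 'a^2" where
  "row r s = (\<chi> i. if i = 1 then r else s)"

lemma row_nth [simp]: "row r s $ 1 = r" "row r s $ 2 = s"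
  by (simp_all add: row_def)

lemma row_eq_iff: "v = row r s \<longleftrightarrow> v $ 1 = r \<and> v $ 2 = s"
  by (auto simp: vec_eq_iff forall_2)

lemma row_eta: "row (v $ 1) (v $ 2) = v"
  by (simp add: vec_eq_iff forall_2)

lemma scale_row: "c *s row r s = row (c * r) (c * s)"
  by (simp add: vec_eq_iff forall_2)

lemma row_mult: "row r s v* M = row (r * M $ 1 $ 1 + s * M $ 2 $ 1) (r * M $ 1 $ 2 + s * M $ 2 $ 2)"
  by (simp add: vec_eq_iff forall_2 vector_matrix_mult_def sum_2 mult.commute)

definition line :: "'a :: field_char_0 \<Rightarrow> 'a \<Rightarrow> ('a^2) set" where
  "line r s = {row (c * r) (c * s) | c. c \<noteq> 0}"

lemma proj_coords_UNIV: "proj_coords UNIV = {row r s | r s. r \<noteq> 0 \<or> s \<noteq> 0}"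
proof -
  have "v \<in> {row r s | r s. r \<noteq> 0 \<or> s \<noteq> 0}" if "v \<noteq> 0" for v :: "'a^2"
    using that row_eta[of v, symmetric] by (auto simp: vec_eq_iff forall_2)
  moreover have "row r s \<noteq> 0" if "r \<noteq> 0 \<or> s \<noteq> 0" for r s :: 'a
    using that by (auto simp: vec_eq_iff forall_2)
  ultimately show ?thesis unfolding proj_coords_def by auto
qed

lemma proj_line_UNIV: "proj_line UNIV = {line r s | r s. r \<noteq> 0 \<or> s \<noteq> (0 :: 'a :: field_char_0)}"
proof -
  define P :: "(('a^2) \<times> ('a^2)) set" where
    "P = {(v, w). v \<in> proj_coords UNIV \<and> w \<in> proj_coords UNIV \<and> (\<exists>c\<in>UNIV. c \<noteq> 0 \<and> w = c *s v)}"
  have P: "P `` {row r s} = line r s" if rs: "r \<noteq> 0 \<or> s \<noteq> 0" for r s :: 'a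
  proof -
    have mem: "row (c * r) (c * s) \<in> proj_coords UNIV" if "c \<noteq> 0" for c
    proof -
      have "c * r \<noteq> 0 \<or> c * s \<noteq> 0" using that rs by simp
      then show ?thesis unfolding proj_coords_UNIV by blast
    qed
    show ?thesis using mem mem[of 1] unfolding P_def line_def scale_row[symmetric] by auto
  qed
  have "proj_line UNIV = (\<lambda>v. P `` {v}) ` proj_coords UNIV"
    unfolding proj_line_def quotient_def P_def[symmetric] by blast
  also have "\<dots> = {line r s | r s. r \<noteq> 0 \<or> s \<noteq> 0}"
    unfolding proj_coords_UNIV
  proof (intro equalityI subsetI)
    fix p assume "p \<in> (\<lambda>v. P `` {v}) ` {row r s | r s :: 'a. r \<noteq> 0 \<or> s \<noteq> 0}"
    then obtain r s where rs: "r \<noteq> 0 \<or> s \<noteq> 0" "p = P `` {row r s}" by blast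
    then have "p = line r s" using P by simp
    then show "p \<in> {line r s | r s. r \<noteq> 0 \<or> s \<noteq> 0}" using rs(1) by blast
  next
    fix p assume "p \<in> {line r s | r s :: 'a. r \<noteq> 0 \<or> s \<noteq> 0}"
    then obtain r s where rs: "r \<noteq> 0 \<or> s \<noteq> 0" "p = line r s" by blast
    then have "p = P `` {row r s}" using P by simp
    then show "p \<in> (\<lambda>v. P `` {v}) ` {row r s | r s :: 'a. r \<noteq> 0 \<or> s \<noteq> 0}" using rs(1) by blast
  qed
  finally show ?thesis .
qed

lemma line_eq_iff:
  assumes "r \<noteq> 0 \<or> s \<noteq> 0"
  shows "line r s = line r' s' \<longleftrightarrow> (\<exists>c. c \<noteq> 0 \<and> r' = c * r \<and> s' = c * s)"
proof
  assume "line r s = line r' s'"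
  moreover have "row r' s' \<in> line r' s'" unfolding line_def by (auto intro!: exI[of _ 1])
  ultimately have "row r' s' \<in> line r s" by simp
  then show "\<exists>c. c \<noteq> 0 \<and> r' = c * r \<and> s' = c * s" unfolding line_def by (auto simp: row_eq_iff)
next
  assume "\<exists>c. c \<noteq> 0 \<and> r' = c * r \<and> s' = c * s"
  then obtain c where c: "c \<noteq> 0" "r' = c * r" "s' = c * s" by blast
  have "row (d * r) (d * s) = row ((d / c) * r') ((d / c) * s')" for d using c by simp
  moreover have "d / c \<noteq> 0" if "d \<noteq> 0" for d using that c by simp
  moreover have "row (d * r') (d * s') = row ((d * c) * r) ((d * c) * s)" "d \<noteq> 0 \<longrightarrow> d * c \<noteq> 0" for d
    using c by (simp_all add: mult.assoc)
  ultimately show "line r s = line r' s'" unfolding line_def by blast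
qed

context quadratic_basis
begin

text \<open>Equality of cusps on the level of coordinates. The factor \<open>c\<close> ranges over
  the whole field, so the lattices of the two pairs are homothetic rather than equal.\<close>

definition cusp_equiv :: "nat \<Rightarrow> 'a \<Rightarrow> 'a \<Rightarrow> 'a \<Rightarrow> 'a \<Rightarrow> bool" where
  "cusp_equiv f r s r' s' \<longleftrightarrow> (\<exists>c. c \<noteq> 0 \<and> unimodular_equiv f (c * r) (c * s) r' s')"

lemma cusp_equiv_refl: "cusp_equiv f r s r s"
  unfolding cusp_equiv_def using unimodular_equiv_refl by (intro exI[of _ 1]) simp

lemma cusp_equiv_sym:
  assumes "cusp_equiv f r s r' s'"
  shows "cusp_equiv f r' s' r s"
proof -
  obtain c where c: "c \<noteq> 0" "unimodular_equiv f (c * r) (c * s) r' s'"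
    using assms unfolding cusp_equiv_def by blast
  have "unimodular_equiv f (inverse c * r') (inverse c * s') (inverse c * (c * r)) (inverse c * (c * s))"
    by (rule unimodular_equiv_scale[OF unimodular_equiv_sym[OF c(2)]])
  then show ?thesis unfolding cusp_equiv_def using c(1)
    by (intro exI[of _ "inverse c"]) (simp flip: mult.assoc)
qed

lemma cusp_equiv_trans:
  assumes "cusp_equiv f r s r' s'" "cusp_equiv f r' s' r'' s''"
  shows "cusp_equiv f r s r'' s''"
proof -
  obtain c where c: "c \<noteq> 0" "unimodular_equiv f (c * r) (c * s) r' s'"
    using assms unfolding cusp_equiv_def by blast
  obtain d where d: "d \<noteq> 0" "unimodular_equiv f (d * r') (d * s') r'' s''"
    using assms unfolding cusp_equiv_def by blast
  have "unimodular_equiv f (d * (c * r)) (d * (c * s)) r'' s''"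
    using unimodular_equiv_trans[OF unimodular_equiv_scale[OF c(2)] d(2)] .
  then show ?thesis unfolding cusp_equiv_def using c(1) d(1)
    by (intro exI[of _ "d * c"]) (simp add: mult.assoc)
qed

lemma cusp_equiv_gen:
  assumes "cusp_equiv f r s r' s'"
  shows "\<exists>c. c \<noteq> 0 \<and> gen f r' s' = (*) c ` gen f r s"
proof -
  obtain c where c: "c \<noteq> 0" "unimodular_equiv f (c * r) (c * s) r' s'"
    using assms unfolding cusp_equiv_def by blast
  have "gen f r' s' = (*) c ` gen f r s"
    unfolding gen_scale[symmetric] by (rule unimodular_equiv_gen[OF c(2)])
  then show ?thesis using c(1) by blast
qed

abbreviation cusp_rel :: "nat \<Rightarrow> (('a^2) set \<times> ('a^2) set) set" where
  "cusp_rel f \<equiv> {(p, q). p \<in> proj_line UNIV \<and> q \<in> proj_line UNIV \<and> (\<exists>M\<in>SL2 (qorder f). q = (\<lambda>v. v v* M) ` p)}"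

lemma line_mult: "(\<lambda>v. v v* M) ` line r s = line (r * M $ 1 $ 1 + s * M $ 2 $ 1) (r * M $ 1 $ 2 + s * M $ 2 $ 2)"
proof -
  have "row (c * r) (c * s) v* M = row (c * (r * M $ 1 $ 1 + s * M $ 2 $ 1)) (c * (r * M $ 1 $ 2 + s * M $ 2 $ 2))" for c
    unfolding row_mult by (simp add: algebra_simps)
  then show ?thesis unfolding line_def image_def by (auto; metis)
qed

lemma unimodular_equiv_iff_SL2:
  "unimodular_equiv f r s r' s' \<longleftrightarrow>
     (\<exists>M\<in>SL2 (qorder f). r' = r * M $ 1 $ 1 + s * M $ 2 $ 1 \<and> s' = r * M $ 1 $ 2 + s * M $ 2 $ 2)"
proof
  assume "unimodular_equiv f r s r' s'"
  then obtain x y z t where x: "x \<in> qorder f" "y \<in> qorder f" "z \<in> qorder f" "t \<in> qorder f"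
    and det: "x * t - y * z = 1" and eq: "r' = x * r + y * s" "s' = z * r + t * s"
    unfolding unimodular_equiv_def by blast
  define M :: "'a^2^2" where "M = (\<chi> i j. if i = 1 then (if j = 1 then x else z) else (if j = 1 then y else t))"
  have M: "M $ 1 $ 1 = x" "M $ 1 $ 2 = z" "M $ 2 $ 1 = y" "M $ 2 $ 2 = t" by (simp_all add: M_def)
  have "M \<in> SL2 (qorder f)" unfolding SL2_def using x det by (simp add: forall_2 M det_2 mult.commute)
  then show "\<exists>M\<in>SL2 (qorder f). r' = r * M $ 1 $ 1 + s * M $ 2 $ 1 \<and> s' = r * M $ 1 $ 2 + s * M $ 2 $ 2"
    using eq M by (intro bexI[of _ M]) (simp_all add: mult.commute)
next
  assume "\<exists>M\<in>SL2 (qorder f). r' = r * M $ 1 $ 1 + s * M $ 2 $ 1 \<and> s' = r * M $ 1 $ 2 + s * M $ 2 $ 2"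
  then obtain M :: "'a^2^2" where M: "M \<in> SL2 (qorder f)" "r' = r * M $ 1 $ 1 + s * M $ 2 $ 1" "s' = r * M $ 1 $ 2 + s * M $ 2 $ 2"
    by blast
  then have "M $ 1 $ 1 * M $ 2 $ 2 - M $ 2 $ 1 * M $ 1 $ 2 = 1" by (simp add: SL2_def det_2 mult.commute)
  moreover have "M $ i $ j \<in> qorder f" for i j using M(1) by (simp add: SL2_def)
  moreover have "r' = M $ 1 $ 1 * r + M $ 2 $ 1 * s" "s' = M $ 1 $ 2 * r + M $ 2 $ 2 * s"
    using M by (simp_all add: mult.commute)
  ultimately show "unimodular_equiv f r s r' s'" unfolding unimodular_equiv_def by blast
qed

lemma cusp_rel_iff:
  assumes "r \<noteq> 0 \<or> s \<noteq> 0" "r' \<noteq> 0 \<or> s' \<noteq> 0"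
  shows "(line r s, line r' s') \<in> cusp_rel f \<longleftrightarrow> cusp_equiv f r s r' s'"
proof -
  have "(line r s, line r' s') \<in> cusp_rel f \<longleftrightarrow>
    (\<exists>M\<in>SL2 (qorder f). line r' s' = line (r * M $ 1 $ 1 + s * M $ 2 $ 1) (r * M $ 1 $ 2 + s * M $ 2 $ 2))"
    using assms by (auto simp: proj_line_UNIV line_mult)
  also have "\<dots> \<longleftrightarrow> (\<exists>r1 s1. unimodular_equiv f r s r1 s1 \<and> line r' s' = line r1 s1)"
    unfolding unimodular_equiv_iff_SL2 by blast
  also have "\<dots> \<longleftrightarrow> (\<exists>c. c \<noteq> 0 \<and> unimodular_equiv f r s (c * r') (c * s'))"
    unfolding line_eq_iff[OF assms(2)] by blast
  \<comment> \<open>So far \<open>c\<close> scales the target, whereas \<open>cusp_equiv\<close>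
    scales the source; symmetry on both levels reconciles them.\<close>
  also have "\<dots> \<longleftrightarrow> (\<exists>c. c \<noteq> 0 \<and> unimodular_equiv f (c * r') (c * s') r s)"
    using unimodular_equiv_sym by blast
  also have "\<dots> \<longleftrightarrow> cusp_equiv f r' s' r s" unfolding cusp_equiv_def ..
  also have "\<dots> \<longleftrightarrow> cusp_equiv f r s r' s'" using cusp_equiv_sym by blast
  finally show ?thesis .
qed

lemma equiv_cusp_rel: "equiv (proj_line UNIV) (cusp_rel f)"
proof (rule equivI)
  show "refl_on (proj_line UNIV) (cusp_rel f)"
  proof (rule refl_onI)
    fix p :: "('a^2) set" assume "p \<in> proj_line UNIV"
    then obtain r s where "p = line r s" "r \<noteq> 0 \<or> s \<noteq> 0" unfolding proj_line_UNIV by blast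
    then show "(p, p) \<in> cusp_rel f" by (simp only: cusp_rel_iff cusp_equiv_refl)
  qed
  show "sym (cusp_rel f)"
  proof (rule symI)
    fix p q assume pq: "(p, q) \<in> cusp_rel f"
    then have "p \<in> proj_line UNIV" "q \<in> proj_line UNIV" by auto
    then obtain r s r' s' where "p = line r s" "r \<noteq> 0 \<or> s \<noteq> 0" "q = line r' s'" "r' \<noteq> 0 \<or> s' \<noteq> 0"
      unfolding proj_line_UNIV by blast
    then show "(q, p) \<in> cusp_rel f" using pq cusp_equiv_sym by (simp only: cusp_rel_iff)
  qed
  show "trans (cusp_rel f)"
  proof (rule transI)
    fix p q u assume pq: "(p, q) \<in> cusp_rel f" "(q, u) \<in> cusp_rel f"
    then have "p \<in> proj_line UNIV" "q \<in> proj_line UNIV" "u \<in> proj_line UNIV" by auto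
    then obtain r s r' s' r'' s'' where "p = line r s" "r \<noteq> 0 \<or> s \<noteq> 0" "q = line r' s'" "r' \<noteq> 0 \<or> s' \<noteq> 0"
      "u = line r'' s''" "r'' \<noteq> 0 \<or> s'' \<noteq> 0"
      unfolding proj_line_UNIV by blast
    then show "(p, u) \<in> cusp_rel f" using pq cusp_equiv_trans[of f r s r' s' r'' s''] by (simp only: cusp_rel_iff)
  qed
qed auto

definition cusp :: "nat \<Rightarrow> 'a \<Rightarrow> 'a \<Rightarrow> ('a^2) set set" where
  "cusp f r s = cusp_rel f `` {line r s}"

lemma cusp_eq_iff:
  assumes "r \<noteq> 0 \<or> s \<noteq> 0" "r' \<noteq> 0 \<or> s' \<noteq> 0"
  shows "cusp f r s = cusp f r' s' \<longleftrightarrow> cusp_equiv f r s r' s'"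
proof -
  have "line r s \<in> proj_line UNIV" "line r' s' \<in> proj_line UNIV" using assms unfolding proj_line_UNIV by blast+
  then have "cusp f r s = cusp f r' s' \<longleftrightarrow> (line r s, line r' s') \<in> cusp_rel f"
    unfolding cusp_def by (rule eq_equiv_class_iff[OF equiv_cusp_rel])
  then show ?thesis using cusp_rel_iff[OF assms] by simp
qed

lemma cusps_qorder:
  assumes "f > 0"
  shows "cusps (qorder f) = {cusp f r s | r s. r \<noteq> 0 \<or> s \<noteq> 0}"
proof -
  have "cusps (qorder f) = (\<lambda>p. cusp_rel f `` {p}) ` proj_line UNIV"
    unfolding cusps_def frac_field_qorder[OF assms] quotient_def by blast
  also have "\<dots> = {cusp f r s | r s. r \<noteq> 0 \<or> s \<noteq> 0}"
    unfolding cusp_def by (subst (2) proj_line_UNIV) blast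
  finally show ?thesis .
qed

section \<open>Counting the cusps over a class of the Picard group\<close>

definition class_cusps :: "nat \<Rightarrow> 'a set set \<Rightarrow> ('a^2) set set set" where
  "class_cusps f C = {cusp f r s | r s. (r \<noteq> 0 \<or> s \<noteq> 0) \<and> gen f r s \<in> C}"

text \<open>An element \<open>u\<close> of norm -1 has the inverse \<open>- conj u\<close>, again in
  the order, so the norm condition already makes it a unit.\<close>

definition has_norm_minus_one :: "nat \<Rightarrow> bool" where
  "has_norm_minus_one k \<longleftrightarrow> (\<exists>u\<in>qorder k. nrm u = -1)"

lemma has_unit_of_norm_minus_one_iff: "has_unit_of_norm_minus_one (qorder k) \<longleftrightarrow> has_norm_minus_one k"
proof
  assume "has_norm_minus_one k"
  then obtain u where u: "u \<in> qorder k" "nrm u = -1" unfolding has_norm_minus_one_def by blast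
  have "u * (- conj u) = 1" using mult_conj[of u] u(2) by simp
  moreover have "- conj u \<in> qorder k" using u(1) by (intro qorder_subring)
  ultimately have "u \<in> Units (field_ring\<lparr>carrier := qorder k\<rparr>)"
    unfolding Units_def using u(1)
    by (auto simp: ring_of_type_algebra_def mult.commute intro!: bexI[of _ "- conj u"])
  then show "has_unit_of_norm_minus_one (qorder k)"
    unfolding has_unit_of_norm_minus_one_def quadratic_norm_eq using u(2) by blast
next
  assume "has_unit_of_norm_minus_one (qorder k)"
  then show "has_norm_minus_one k"
    unfolding has_unit_of_norm_minus_one_def quadratic_norm_eq has_norm_minus_one_def
    by (auto simp: Units_def)
qed

text \<open>As \<open>c\<close> maps the lattice onto itself, its matrix in the basis
  \<open>a, b\<close> is invertible over the integers, and the determinant of that matrix is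
  \<open>nrm c\<close>.\<close>

lemma unit_norm:
  assumes ab: "det2 a b \<noteq> 0" and c: "c \<noteq> 0" and eq: "(*) c ` zlat a b = zlat a b"
    and L: "multiplier_ring (zlat a b) = qorder k"
  shows "nrm c = 1 \<or> (nrm c = -1 \<and> has_norm_minus_one k)"
proof -
  have "c * y \<in> zlat a b" if "y \<in> zlat a b" for y using that eq by blast
  then have ck: "c \<in> qorder k" using L unfolding multiplier_ring_def by blast
  have ca: "c * a \<in> zlat a b" "c * b \<in> zlat a b" using eq zlat_closed(2,3) by blast+
  obtain i :: int where i: "det2 (c * a) (c * b) = of_int i * det2 a b" using det2_lattice[OF ca] by blast
  have "zlat (c * a) (c * b) = zlat a b" using eq zlat_scale by metis
  then have "a \<in> zlat (c * a) (c * b)" "b \<in> zlat (c * a) (c * b)" using zlat_closed(2,3) by metis+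
  then obtain j :: int where j: "det2 a b = of_int j * det2 (c * a) (c * b)" using det2_lattice by blast
  have "of_int j * (of_int i * det2 a b) = det2 a b" unfolding i[symmetric] by (rule j[symmetric])
  then have "of_int (j * i) * det2 a b = of_int 1 * det2 a b" by (simp add: mult.assoc)
  then have "(of_int (j * i) :: rat) = of_int 1" using ab by simp
  then have "j * i = 1" by (simp only: of_int_eq_iff)
  then have "i = 1 \<or> i = -1" by (auto simp: zmult_eq_1_iff)
  moreover have "nrm c = of_int i" using i ab unfolding det2_mult by simp
  ultimately show ?thesis using ck unfolding has_norm_minus_one_def by auto
qed

text \<open>Both pairs generate the same lattice, so a factor \<open>c\<close> relating them must
  preserve it, and \<open>unit_norm\<close> leaves only the norms 1 and -1.\<close>

lemma cusp_equiv_iff_cong: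
  assumes ab: "det2 a b \<noteq> 0" and L: "multiplier_ring (zlat a b) = qorder k" and pos: "g * k > 0"
    and gen: "gen (g * k) r s = zlat a b" and gen': "gen (g * k) r' s' = zlat a b"
    and det: "det2 r s = of_int n * det2 a b" and det': "det2 r' s' = of_int n' * det2 a b"
  shows "cusp_equiv (g * k) r s r' s' \<longleftrightarrow>
    [n' = n] (mod int g) \<or> has_norm_minus_one k \<and> [n' = - n] (mod int g)"
proof
  assume "cusp_equiv (g * k) r s r' s'"
  then obtain c where c: "c \<noteq> 0" "unimodular_equiv (g * k) (c * r) (c * s) r' s'"
    unfolding cusp_equiv_def by blast
  have gc: "gen (g * k) (c * r) (c * s) = zlat a b"
    using unimodular_equiv_gen[OF c(2)] gen' by simp
  then have "(*) c ` zlat a b = zlat a b" unfolding gen_scale gen .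
  from unit_norm[OF ab c(1) this L]
  consider "nrm c = 1" | "nrm c = -1" "has_norm_minus_one k" by blast
  then show "[n' = n] (mod int g) \<or> has_norm_minus_one k \<and> [n' = - n] (mod int g)"
  proof cases
    case 1
    then have "det2 (c * r) (c * s) = of_int n * det2 a b" unfolding det2_mult det by simp
    from unimodular_equiv_det2[OF L gc this c(2)] show ?thesis using det' ab by auto
  next
    case 2
    then have "det2 (c * r) (c * s) = of_int (- n) * det2 a b" unfolding det2_mult det by simp
    from unimodular_equiv_det2[OF L gc this c(2)] show ?thesis using det' ab 2(2) by auto
  qed
next
  assume "[n' = n] (mod int g) \<or> has_norm_minus_one k \<and> [n' = - n] (mod int g)"
  then show "cusp_equiv (g * k) r s r' s'"
  proof (elim disjE conjE)
    assume "[n' = n] (mod int g)"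
    then have "unimodular_equiv (g * k) r s r' s'"
      by (rule unimodular_equivI_det2[OF ab L pos gen gen' det det'])
    then show ?thesis unfolding cusp_equiv_def by (intro exI[of _ 1]) simp
  next
    assume "has_norm_minus_one k" and cong: "[n' = - n] (mod int g)"
    then obtain u where u: "u \<in> qorder k" "nrm u = -1" unfolding has_norm_minus_one_def by blast
    have uu: "u * (- conj u) = 1" using mult_conj[of u] u(2) by simp
    have "- conj u \<in> qorder k" using u(1) by (intro qorder_subring)
    have "(*) u ` zlat a b = zlat a b"
    proof
      show "(*) u ` zlat a b \<subseteq> zlat a b" using u(1) L multiplier_ringD by blast
      show "zlat a b \<subseteq> (*) u ` zlat a b"
      proof
        fix x assume "x \<in> zlat a b"
        then have "- conj u * x \<in> zlat a b" using \<open>- conj u \<in> qorder k\<close> L multiplier_ringD by blast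
        moreover have "x = u * (- conj u * x)" by (simp only: mult.assoc[symmetric] uu mult_1_left)
        ultimately show "x \<in> (*) u ` zlat a b" by blast
      qed
    qed
    then have gu: "gen (g * k) (u * r) (u * s) = zlat a b" unfolding gen_scale gen .
    have "det2 (u * r) (u * s) = of_int (- n) * det2 a b" unfolding det2_mult det u(2) by simp
    from unimodular_equivI_det2[OF ab L pos gu gen' this det' cong]
    show ?thesis unfolding cusp_equiv_def using u(2) nrm_eq_0_iff[of u] by (intro exI[of _ u]) auto
  qed
qed

text \<open>A pair is chosen for each \<open>d\<close> in \<open>totatives g\<close>, and
  \<open>T\<close> sends \<open>d\<close> to its cusp. Counting the totatives by the fibres of
  \<open>T\<close>, all of the same size, gives the result as a product of natural numbers.\<close>

lemma card_class_cusps: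
  assumes f: "f = g * k" "f > 0" and C: "C \<in> carrier (Pic (qorder k))"
  shows "finite (class_cusps f C) \<and>
    card (class_cusps f C) * (if has_norm_minus_one k \<and> g > 2 then 2 else 1) = totient g"
proof -
  have pos: "g * k > 0" "k > 0" "g > 0" using f by simp_all
  obtain L where L: "is_lattice L" "multiplier_ring L = qorder k" and CL: "C = homothety_class L"
    using C unfolding carrier_Pic[OF pos(2)] by blast
  obtain a b where ab: "det2 a b \<noteq> 0" and Lab: "L = zlat a b" using L(1) unfolding is_lattice_def by blast
  note L = L(2)[unfolded Lab]
  have "\<exists>r s n. gen (g * k) r s = zlat a b \<and> det2 r s = of_int n * det2 a b \<and> [n = int d] (mod int g)"
    if "d \<in> totatives g" for d
    by (rule exists_gen_with_det2[OF ab L pos(2), of d g]) (use that in \<open>auto simp: totatives_def\<close>)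
  then obtain \<rho> \<sigma> \<nu> where rho: "\<And>d. d \<in> totatives g \<Longrightarrow> gen f (\<rho> d) (\<sigma> d) = zlat a b"
    and det: "\<And>d. d \<in> totatives g \<Longrightarrow> det2 (\<rho> d) (\<sigma> d) = of_int (\<nu> d) * det2 a b"
    and cong: "\<And>d. d \<in> totatives g \<Longrightarrow> [\<nu> d = int d] (mod int g)"
    unfolding f(1) by metis
  have nz: "r \<noteq> 0 \<or> s \<noteq> 0" if "gen f r s = zlat a b" for r s
  proof (rule ccontr)
    assume "\<not> ?thesis"
    then have "gen f r s \<subseteq> {0}" unfolding gen_def by auto
    then have "a = 0" using that zlat_closed(2) by blast
    then show False using ab by (simp add: det2_def)
  qed
  define T where "T d = cusp f (\<rho> d) (\<sigma> d)" for d
  have T_eq: "T x = T y \<longleftrightarrow> y = x \<or> has_norm_minus_one k \<and> g dvd x + y"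
    if x: "x \<in> totatives g" and y: "y \<in> totatives g" for x y
  proof -
    have "T x = T y \<longleftrightarrow> cusp_equiv (g * k) (\<rho> x) (\<sigma> x) (\<rho> y) (\<sigma> y)"
      unfolding T_def f(1)[symmetric] by (rule cusp_eq_iff) (rule nz, rule rho, fact)+
    also have "\<dots> \<longleftrightarrow> [\<nu> y = \<nu> x] (mod int g) \<or> has_norm_minus_one k \<and> [\<nu> y = - \<nu> x] (mod int g)"
      using rho[OF x] rho[OF y] unfolding f(1)
      by (intro cusp_equiv_iff_cong[OF ab L pos(1) _ _ det[OF x] det[OF y]])
    also have "[\<nu> y = \<nu> x] (mod int g) \<longleftrightarrow> [int y = int x] (mod int g)"
      using cong[OF x] cong[OF y] by (meson cong_sym cong_trans)
    also have "[\<nu> y = - \<nu> x] (mod int g) \<longleftrightarrow> [int y = - int x] (mod int g)"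
      using cong[OF x] cong[OF y] by (meson cong_minus_minus_iff cong_sym cong_trans)
    finally show ?thesis using cong_totatives[OF y x] by (simp add: add.commute)
  qed
  have img: "T ` totatives g = class_cusps f C"
  proof
    show "T ` totatives g \<subseteq> class_cusps f C"
    proof
      fix p assume "p \<in> T ` totatives g"
      then obtain d where d: "d \<in> totatives g" "p = cusp f (\<rho> d) (\<sigma> d)" by (auto simp: T_def)
      have "gen f (\<rho> d) (\<sigma> d) \<in> C" unfolding rho[OF d(1)] CL Lab by (rule homothety_class_self)
      then show "p \<in> class_cusps f C" unfolding class_cusps_def using nz[OF rho[OF d(1)]] d(2) by blast
    qed
    show "class_cusps f C \<subseteq> T ` totatives g"
    proof
      fix p assume "p \<in> class_cusps f C"
      then obtain r s where rs: "r \<noteq> 0 \<or> s \<noteq> 0" "gen f r s \<in> C" and p: "p = cusp f r s"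
        unfolding class_cusps_def by blast
      then obtain c where c: "c \<noteq> 0" "gen f r s = (*) c ` zlat a b" unfolding CL Lab homothety_class_def by blast
      \<comment> \<open>Dividing by \<open>c\<close> gives a pair in the same cusp whose lattice is
        \<open>zlat a b\<close> itself, so that its determinant is comparable with the chosen
        ones.\<close>
      define r' s' where "r' = inverse c * r" and "s' = inverse c * s"
      have gen': "gen f r' s' = zlat a b"
        unfolding r'_def s'_def gen_scale c(2) by (rule scale_inverse[OF c(1)])
      have "cusp_equiv f r s r' s'" unfolding cusp_equiv_def r'_def s'_def
        using c(1) unimodular_equiv_refl by (intro exI[of _ "inverse c"]) simp
      then have p': "p = cusp f r' s'" using cusp_eq_iff[OF rs(1) nz[OF gen']] p by simp
      have "r' \<in> zlat a b" "s' \<in> zlat a b" using gen_mem gen' by blast+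
      then obtain n :: int where n: "det2 r' s' = of_int n * det2 a b" using det2_lattice by blast
      have "coprime n (int g)" by (rule coprime_det2[OF ab L _ n]) (use gen' f(1) in simp)
      (* totatives 1 is {1}, so the residue 0 has to be avoided for g = 1 *)
      define d where "d = (if g = 1 then 1 else nat (n mod int g))"
      have dn: "[int d = n] (mod int g)" using pos(3) by (simp add: d_def cong_def)
      then have "coprime (int d) (int g)" using \<open>coprime n (int g)\<close> by (metis cong_imp_coprime cong_sym)
      then have dg: "coprime d g" by simp
      moreover have "d \<le> g" using pos(3) by (auto simp: d_def nat_le_iff intro: less_imp_le)
      moreover have "d > 0" using dg by (cases "d = 0") (auto simp: d_def split: if_splits)
      ultimately have d: "d \<in> totatives g" by (simp add: totatives_def)
      have "[\<nu> d = n] (mod int g)" using cong[OF d] dn by (rule cong_trans)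
      then have "cusp_equiv (g * k) r' s' (\<rho> d) (\<sigma> d)"
        using rho[OF d] gen' unfolding f(1)
        by (subst cusp_equiv_iff_cong[OF ab L pos(1) _ _ n det[OF d]]) auto
      then have "p = T d" unfolding T_def p' using cusp_eq_iff[OF nz[OF gen'] nz[OF rho[OF d]]] f(1) by simp
      then show "p \<in> T ` totatives g" using d by blast
    qed
  qed
  \<comment> \<open>The size of a fibre: a unit of norm -1 identifies each residue with its
    negative, and for \<open>g \<le> 2\<close> these are the same.\<close>
  define e :: nat where "e = (if has_norm_minus_one k \<and> g > 2 then 2 else 1)"
  have fib: "card {y \<in> totatives g. T y = T x} = e" if x: "x \<in> totatives g" for x
  proof -
    have eq: "{y \<in> totatives g. T y = T x} = {y \<in> totatives g. y = x \<or> has_norm_minus_one k \<and> g dvd x + y}"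
      using T_eq[OF x] by (metis (no_types, lifting))
    show ?thesis
    proof (cases "has_norm_minus_one k \<and> g > 2")
      case True
      then show ?thesis unfolding eq using totatives_negatives[OF _ x] by (simp add: e_def)
    next
      case False
      have "{y \<in> totatives g. y = x \<or> has_norm_minus_one k \<and> g dvd x + y} = {x}"
      proof (cases "has_norm_minus_one k")
        case True
        then have g: "g \<le> 2" using False by auto
        have one: "y = 1" if "y \<in> totatives g" for y
        proof (rule ccontr)
          assume "y \<noteq> 1"
          moreover have "0 < y" "y \<le> g" "coprime y g" using that by (auto simp: totatives_def)
          ultimately have "y = 2" "g = 2" using g by linarith+
          then show False using \<open>coprime y g\<close> by simp
        qed
        have "y = x" if "y \<in> totatives g" for y using one[OF that] one[OF x] by simp
        then show ?thesis using x by blast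
      qed (use x in auto)
      then show ?thesis unfolding eq using False by (auto simp: e_def)
    qed
  qed
  have "totient g = card (totatives g)" by (simp add: totient_def)
  also have "\<dots> = (\<Sum>x\<in>totatives g. 1)" by simp
  also have "\<dots> = (\<Sum>p\<in>T ` totatives g. \<Sum>x\<in>{x \<in> totatives g. T x = p}. 1)"
    by (rule sum.image_gen) simp
  also have "\<dots> = (\<Sum>p\<in>T ` totatives g. e)"
    by (rule sum.cong) (use fib in auto)
  also have "\<dots> = card (class_cusps f C) * e" unfolding img by simp
  finally have "card (class_cusps f C) * e = totient g" by simp
  moreover have "finite (class_cusps f C)" unfolding img[symmetric] by simp
  ultimately show ?thesis unfolding e_def by simp
qed

lemma cusps_eq_Union:
  assumes f: "f > 0"
  shows "cusps (qorder f) = (\<Union>(k, C)\<in>(SIGMA k:{k. k dvd f}. carrier (Pic (qorder k))). class_cusps f C)"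
proof
  show "(\<Union>(k, C)\<in>(SIGMA k:{k. k dvd f}. carrier (Pic (qorder k))). class_cusps f C) \<subseteq> cusps (qorder f)"
    unfolding cusps_qorder[OF f] class_cusps_def by blast
  show "cusps (qorder f) \<subseteq> (\<Union>(k, C)\<in>(SIGMA k:{k. k dvd f}. carrier (Pic (qorder k))). class_cusps f C)"
  proof
    fix p assume "p \<in> cusps (qorder f)"
    then obtain r s where rs: "r \<noteq> 0 \<or> s \<noteq> 0" and p: "p = cusp f r s" unfolding cusps_qorder[OF f] by blast
    obtain k where k: "k dvd f" "multiplier_ring (gen f r s) = qorder k"
      using gen_multiplier_ring[OF f rs] by blast
    have "k > 0" using k(1) f by (auto intro: gr0I)
    then have "homothety_class (gen f r s) \<in> carrier (Pic (qorder k))"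
      unfolding carrier_Pic[OF \<open>k > 0\<close>] using gen_is_lattice[OF f rs] k(2) by blast
    moreover have "p \<in> class_cusps f (homothety_class (gen f r s))"
      unfolding class_cusps_def p using rs homothety_class_self by blast
    ultimately show "p \<in> (\<Union>(k, C)\<in>(SIGMA k:{k. k dvd f}. carrier (Pic (qorder k))). class_cusps f C)"
      using k(1) by blast
  qed
qed

text \<open>Pairs with the same cusp generate homothetic lattices, which share their multiplier
  ring; so the cusp determines both the class and \<open>k\<close>.\<close>

lemma class_cusps_disjoint:
  assumes f: "f > 0" and "k dvd f" "C \<in> carrier (Pic (qorder k))" "k' dvd f" "C' \<in> carrier (Pic (qorder k'))"
    and p: "p \<in> class_cusps f C" "p \<in> class_cusps f C'"
  shows "k = k' \<and> C = C'"
proof -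
  have kp: "k > 0" "k' > 0" using assms by (auto intro: gr0I)
  obtain r s where rs: "r \<noteq> 0 \<or> s \<noteq> 0" "gen f r s \<in> C" "p = cusp f r s"
    using p(1) unfolding class_cusps_def by blast
  obtain r' s' where rs': "r' \<noteq> 0 \<or> s' \<noteq> 0" "gen f r' s' \<in> C'" "p = cusp f r' s'"
    using p(2) unfolding class_cusps_def by blast
  have "cusp_equiv f r s r' s'" using rs rs' cusp_eq_iff by metis
  then obtain c where c: "c \<noteq> 0" "gen f r' s' = (*) c ` gen f r s" using cusp_equiv_gen by blast
  obtain L where L: "multiplier_ring L = qorder k" "C = homothety_class L"
    using assms(3) unfolding carrier_Pic[OF kp(1)] by blast
  obtain L' where L': "multiplier_ring L' = qorder k'" "C' = homothety_class L'"
    using assms(5) unfolding carrier_Pic[OF kp(2)] by blast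
  obtain d where d: "d \<noteq> 0" "gen f r s = (*) d ` L" using rs(2) L(2) unfolding homothety_class_def by blast
  obtain d' where d': "d' \<noteq> 0" "gen f r' s' = (*) d' ` L'" using rs'(2) L'(2) unfolding homothety_class_def by blast
  have "(*) d' ` L' = (*) c ` (*) d ` L" using c d d' by simp
  then have "multiplier_ring L' = multiplier_ring L" "homothety_class L' = homothety_class L"
    using c(1) d(1) d'(1) by (metis multiplier_ring_scale, metis homothety_class_scale)
  then show ?thesis using L L' qorder_inject by simp
qed

text \<open>The cusps form a disjoint union over all pairs of a divisor \<open>k\<close> and a
  class. The contribution of a class depends on \<open>k\<close> only, so the sum over classes
  becomes the factor \<open>order (Pic (qorder k))\<close>.\<close>

lemma cusps_formula:
  assumes f: "f > 0"
  shows "finite (cusps (qorder f)) \<and> real (card (cusps (qorder f))) =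
    (\<Sum>k | k dvd f. real (totient (f div k)) / 2 ^ (if has_norm_minus_one k \<and> f div k > 2 then 1 else 0)
       * real (order (Pic (qorder k))))"
proof -
  define I where "I = (SIGMA k:{k. k dvd f}. carrier (Pic (qorder k)))"
  have kp: "k > 0" if "k dvd f" for k using that f by (auto intro: gr0I)
  have "finite {k. k dvd f}" using f by simp
  then have finI: "finite I" unfolding I_def using finite_Pic kp by (intro finite_SigmaI) auto
  have fc: "finite (class_cusps f C)"
      "real (card (class_cusps f C)) = real (totient (f div k)) / 2 ^ (if has_norm_minus_one k \<and> f div k > 2 then 1 else 0)"
    if kC: "k dvd f" "C \<in> carrier (Pic (qorder k))" for k C
  proof -
    have "f = (f div k) * k" using kC(1) by simp
    note cc = card_class_cusps[OF this f kC(2)]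
    show "finite (class_cusps f C)" using cc by blast
    have "real (card (class_cusps f C)) * real (if has_norm_minus_one k \<and> f div k > 2 then 2 else 1) = real (totient (f div k))"
      using cc by (metis of_nat_mult)
    then show "real (card (class_cusps f C)) = real (totient (f div k)) / 2 ^ (if has_norm_minus_one k \<and> f div k > 2 then 1 else 0)"
      by (auto split: if_splits)
  qed
  have eq: "cusps (qorder f) = (\<Union>x\<in>I. class_cusps f (snd x))"
    unfolding cusps_eq_Union[OF f] I_def by (auto simp: case_prod_beta)
  have fin: "finite (class_cusps f (snd x))" if "x \<in> I" for x using that fc(1) by (auto simp: I_def)
  have "card (cusps (qorder f)) = (\<Sum>x\<in>I. card (class_cusps f (snd x)))"
    unfolding eq
  proof (rule card_UN_disjoint[OF finI])
    show "\<forall>i\<in>I. finite (class_cusps f (snd i))" using fin by blast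
    show "\<forall>i\<in>I. \<forall>j\<in>I. i \<noteq> j \<longrightarrow> class_cusps f (snd i) \<inter> class_cusps f (snd j) = {}"
    proof (intro ballI impI equals0I)
      fix i j p assume ij: "i \<in> I" "j \<in> I" "i \<noteq> j" "p \<in> class_cusps f (snd i) \<inter> class_cusps f (snd j)"
      have "fst i = fst j \<and> snd i = snd j"
        using ij by (intro class_cusps_disjoint[OF f, of "fst i" "snd i" "fst j" "snd j" p]) (auto simp: I_def)
      then show False using ij(3) by (simp add: prod_eq_iff)
    qed
  qed
  then have "real (card (cusps (qorder f))) = (\<Sum>x\<in>I. real (card (class_cusps f (snd x))))" by simp
  also have "\<dots> = (\<Sum>(k, C)\<in>I. real (totient (f div k)) / 2 ^ (if has_norm_minus_one k \<and> f div k > 2 then 1 else 0))"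
    by (intro sum.cong) (auto simp: I_def fc(2))
  also have "\<dots> = (\<Sum>k | k dvd f. \<Sum>C\<in>carrier (Pic (qorder k)).
      real (totient (f div k)) / 2 ^ (if has_norm_minus_one k \<and> f div k > 2 then 1 else 0))"
    unfolding I_def using \<open>finite {k. k dvd f}\<close> finite_Pic kp by (intro sum.Sigma[symmetric]) auto
  also have "\<dots> = (\<Sum>k | k dvd f. real (totient (f div k)) / 2 ^ (if has_norm_minus_one k \<and> f div k > 2 then 1 else 0)
       * real (order (Pic (qorder k))))"
    by (simp add: order_def mult.commute)
  finally show ?thesis using finI fin unfolding eq by auto
qed

end

theorem theorem1p4:
  fixes f :: nat
  assumes "rat_vs.dim (UNIV :: 'a :: field_char_0 set) = 2"
    and "f > 0"
  shows "finite (cusps (quadratic_order f :: 'a set)) \<and>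
         (\<forall>f'. f' dvd f \<longrightarrow> finite (carrier (Pic (quadratic_order f' :: 'a set)))) \<and>
         real (card (cusps (quadratic_order f :: 'a set))) =
           (\<Sum>f' | f' dvd f.
              real (totient (f div f')) / 2 ^ epsilon TYPE('a) f f' *
              real (order (Pic (quadratic_order f' :: 'a set))))"
proof -
  obtain w :: 'a and A B :: int where w: "w * w = of_int A * w + of_int B" "w \<notin> \<rat>"
    "\<And>z. \<exists>x y. z = of_rat x + of_rat y * w"
    "\<And>z. algebraic_int z \<longleftrightarrow> (\<exists>m n. z = of_int m + of_int n * w)"
    using quadratic_field_integral_basis[OF assms(1)] by blast
  \<comment> \<open>The basis is an auxiliary choice that the statement does not mention;
    \<open>quadratic_order_eq\<close> and \<open>has_unit_of_norm_minus_one_iff\<close> translate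
    between the two.\<close>
  interpret quadratic_basis w A B by unfold_locales (rule w)+
  have pos: "k > 0" if "k dvd f" for k using that assms(2) by (auto intro: gr0I)
  have "real (totient (f div k)) / 2 ^ epsilon TYPE('a) f k * real (order (Pic (quadratic_order k :: 'a set))) =
      real (totient (f div k)) / 2 ^ (if has_norm_minus_one k \<and> f div k > 2 then 1 else 0)
       * real (order (Pic (qorder k)))" if "k dvd f" for k
    unfolding epsilon_def quadratic_order_eq[OF pos[OF that]] has_unit_of_norm_minus_one_iff ..
  then have "(\<Sum>k | k dvd f. real (totient (f div k)) / 2 ^ epsilon TYPE('a) f k * real (order (Pic (quadratic_order k :: 'a set)))) =
      (\<Sum>k | k dvd f. real (totient (f div k)) / 2 ^ (if has_norm_minus_one k \<and> f div k > 2 then 1 else 0)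
       * real (order (Pic (qorder k))))"
    by (intro sum.cong) auto
  then show ?thesis
    using cusps_formula[OF assms(2)] finite_Pic pos quadratic_order_eq assms(2) by simp
qed

end
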